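(* There exist irreducible representations of $\mathrm{Is}(\mathbf{H}_{\mathbf{R}}^2)$ into $\mathrm{Is}(\mathbf{H}_{\mathbf{R}}^\infty)$ with a countable orbit, and there exist irreducible representations of $\mathrm{Is}(\mathbf{H}_{\mathbf{R}}^3)^\circ$ into $\mathrm{Is}(\mathbf{H}_{\mathbf{R}}^\infty)$ with a countable orbit. (That is, for $G=\mathrm{Is}(\mathbf{H}_{\mathbf{R}}^2)$ and for $G=\mathrm{Is}(\mathbf{H}_{\mathbf{R}}^3)^\circ$ there is a group homomorphism $\varrho\colon G\to\mathrm{Is}(\mathbf{H}_{\mathbf{R}}^\infty)$, not required to be continuous, which is irreducible and such that $\varrho(G)p$ is countable for some $p\in\mathbf{H}_{\mathbf{R}}^\infty$.)
   Context: For a real Hilbert space $H$ of Hilbertian dimension $\kappa$ (any cardinal), let $B(z\oplus u,w\oplus v)=zw-\langle u,v\rangle$ on $\mathbf{R}\oplus H$. The real hyperbolic space $\mathbf{H}_{\mathbf{R}}^\kappa$ is the projectivisation of the set of $B$-positive vectors, with distance $\cosh d(x,y)=|B(X,Y)|/(B(X,X)B(Y,Y))^{1/2}$ for representatives $X,Y$ of $x,y$. $\mathbf{H}_{\mathbf{R}}^\infty$ denotes the case $\kappa=\aleph_0$. $\mathrm{Is}$ denotes the isometry group and $\mathrm{Is}(\mathbf{H}_{\mathbf{R}}^3)^\circ$ is the index two subgroup of orientation-preserving isometries. $\mathrm{Is}(\mathbf{H}_{\mathbf{R}}^\kappa)$ is identified with $\mathbf{PO}(B)$, the quotient of the group $\mathbf{O}(B)$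 of invertible operators preserving $B$. A representation into $\mathrm{Is}(\mathbf{H}_{\mathbf{R}}^\infty)\cong\mathbf{PO}(B)$ is irreducible if the associated projective representation on $\mathbf{R}\oplus H$ has no closed invariant linear subspace other than $0$ and the whole space. Equivalently, the action is non-elementary (it preserves no non-empty finite subset of $\mathbf{H}_{\mathbf{R}}^\infty\cup\partial\mathbf{H}_{\mathbf{R}}^\infty$) and minimal (every orbit is total, i.e. not contained in a proper real hyperbolic subspace). *)

theory Defs
  imports "HOL-Analysis.Analysis" "HOL-Algebra.Bij"
begin

section \<open>Hilbertian dimension\<close>

text \<open>A real Hilbert space \<open>H\<close> is a type of class \<open>{real_inner, banach}\<close>.  Its Hilbertian
  dimension is the cardinality of any Hilbert basis; for \<open>real^'n\<close> this is \<open>CARD('n)\<close>.\<close>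

definition hilbert_basis :: "'h::{real_inner, banach} set \<Rightarrow> bool" where
  "hilbert_basis S \<longleftrightarrow>
     pairwise orthogonal S \<and> (\<forall>x\<in>S. norm x = 1) \<and> closure (span S) = UNIV"

section \<open>The hyperbolic space over a real Hilbert space\<close>

definition hform :: "real \<times> 'h::real_inner \<Rightarrow> real \<times> 'h \<Rightarrow> real" where
  "hform X Y = fst X * fst Y - snd X \<bullet> snd Y"

text \<open>Points are the lines spanned by positive vectors; the argument of type \<open>'h itself\<close> only
  records the Hilbert space.\<close>

definition hyp_space :: "'h::real_inner itself \<Rightarrow> (real \<times> 'h) set set" where
  "hyp_space _ = {span {X} | X. hform X X > 0}"

definition hdist :: "(real \<times> 'h::real_inner) set \<Rightarrow> (real \<times> 'h) set \<Rightarrow> real" where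
  "hdist x y = (THE d. 0 \<le> d \<and>
     (\<forall>X \<in> x - {0}. \<forall>Y \<in> y - {0}.
        cosh d = \<bar>hform X Y\<bar> / sqrt (hform X X * hform Y Y)))"

text \<open>The isometry group, with composition as product.  As usual for \<^const>\<open>BijGroup\<close>, its elements
  are functions that are \<open>undefined\<close> outside the hyperbolic space.\<close>

definition hyp_isometries ::
    "'h::real_inner itself \<Rightarrow> ((real \<times> 'h) set \<Rightarrow> (real \<times> 'h) set) set" where
  "hyp_isometries H = {f \<in> Bij (hyp_space H).
     \<forall>x \<in> hyp_space H. \<forall>y \<in> hyp_space H. hdist (f x) (f y) = hdist x y}"

definition Is :: "'h::real_inner itself \<Rightarrow> ((real \<times> 'h) set \<Rightarrow> (real \<times> 'h) set) monoid" where
  "Is H = (BijGroup (hyp_space H))\<lparr>carrier := hyp_isometries H\<rparr>"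

section \<open>Linear lifts of isometries and irreducibility\<close>

definition O_form :: "(real \<times> 'h::real_inner \<Rightarrow> real \<times> 'h) set" where
  "O_form = {T. bounded_linear T \<and> bij T \<and> (\<forall>X Y. hform (T X) (T Y) = hform X Y)}"

text \<open>The identification of the isometry group with the projective orthogonal group of the form:
  \<open>T\<close> lifts \<open>f\<close> if it induces \<open>f\<close> on positive lines.  Every isometry has exactly two lifts, and
  they differ by a sign.\<close>

definition lifts :: "(real \<times> 'h::real_inner \<Rightarrow> real \<times> 'h) \<Rightarrow>
    ((real \<times> 'h) set \<Rightarrow> (real \<times> 'h) set) \<Rightarrow> bool" where
  "lifts T f \<longleftrightarrow> T \<in> O_form \<and> (\<forall>x \<in> hyp_space TYPE('h). f x = T ` x)"

definition irreducible_rep :: "('g, 'm) monoid_scheme \<Rightarrow>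
    ('g \<Rightarrow> (real \<times> 'h::real_inner) set \<Rightarrow> (real \<times> 'h) set) \<Rightarrow> bool" where
  "irreducible_rep G \<rho> \<longleftrightarrow>
     (\<forall>W. subspace W \<and> closed W \<and>
        (\<forall>g \<in> carrier G. \<forall>T. lifts T (\<rho> g) \<longrightarrow> T ` W \<subseteq> W) \<longrightarrow>
        W = {0} \<or> W = UNIV)"

section \<open>Orientation-preserving isometries\<close>

text \<open>Coordinates on \<open>\<real> \<oplus> \<real>\<^sup>n\<close>, indexed by \<open>None\<close> and the indices of \<open>\<real>\<^sup>n\<close>, in order
  to use determinants of matrices.\<close>

definition to_coords :: "real \<times> (real^'n) \<Rightarrow> real^('n option)" where
  "to_coords X = (\<chi> i. case i of None \<Rightarrow> fst X | Some k \<Rightarrow> snd X $ k)"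

definition of_coords :: "real^('n option) \<Rightarrow> real \<times> (real^'n)" where
  "of_coords v = (v $ None, \<chi> k. v $ Some k)"

definition lift_det :: "(real \<times> (real^'n) \<Rightarrow> real \<times> (real^'n)) \<Rightarrow> real" where
  "lift_det T = det (matrix (to_coords \<circ> T \<circ> of_coords))"

text \<open>Exactly one of the two lifts of an isometry preserves the sheet
  \<open>{X. hform X X = 1 \<and> fst X > 0}\<close> of the hyperboloid.  At each of its points \<open>X\<close> the vector \<open>X\<close>
  is transversal to the sheet, and this lift takes the transversal field to itself; hence it
  preserves the orientation of the sheet iff its determinant is positive.\<close>

definition preserves_sheet :: "(real \<times> 'h::real_inner \<Rightarrow> real \<times> 'h) \<Rightarrow> bool" where
  "preserves_sheet T \<longleftrightarrow> (\<forall>X. hform X X > 0 \<and> fst X > 0 \<longrightarrow> fst (T X) > 0)"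

definition orientation_preserving ::
    "((real \<times> (real^'n)) set \<Rightarrow> (real \<times> (real^'n)) set) \<Rightarrow> bool" where
  "orientation_preserving f \<longleftrightarrow> (\<exists>T. lifts T f \<and> preserves_sheet T \<and> lift_det T > 0)"

definition Is_plus :: "(real^'n) itself \<Rightarrow>
    ((real \<times> (real^'n)) set \<Rightarrow> (real \<times> (real^'n)) set) monoid" where
  "Is_plus H = (Is H)\<lparr>carrier := {f \<in> hyp_isometries H. orientation_preserving f}\<rparr>"

section \<open>Well-definedness\<close>

lemma hform_scaleR: "hform (a *\<^sub>R X) (b *\<^sub>R Y) = a * b * hform X Y"
  by (simp add: hform_def algebra_simps)

lemma hform_reverse_Cauchy_Schwarz:
  fixes X Y :: "real \<times> 'h::real_inner"
  assumes "hform X X > 0" "hform Y Y > 0"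
  shows "sqrt (hform X X * hform Y Y) \<le> \<bar>hform X Y\<bar>"
proof -
  define z u w v where "z = \<bar>fst X\<bar>" and "u = norm (snd X)" and "w = \<bar>fst Y\<bar>" and "v = norm (snd Y)"
  have X: "hform X X = z\<^sup>2 - u\<^sup>2" and Y: "hform Y Y = w\<^sup>2 - v\<^sup>2"
    by (simp_all add: hform_def z_def u_def w_def v_def dot_square_norm) (simp_all add: power2_eq_square)
  have nn: "0 \<le> z" "0 \<le> u" "0 \<le> w" "0 \<le> v" by (simp_all add: z_def u_def w_def v_def)
  have "u\<^sup>2 \<le> z\<^sup>2" "v\<^sup>2 \<le> w\<^sup>2" using assms X Y by linarith+
  then have "u \<le> z" "v \<le> w" using nn power2_le_imp_le by blast+
  then have uv: "u * v \<le> z * w" using nn by (intro mult_mono) auto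
  have "\<bar>snd X \<bullet> snd Y\<bar> \<le> u * v" by (simp add: u_def v_def Cauchy_Schwarz_ineq2)
  then have le: "z * w - u * v \<le> \<bar>hform X Y\<bar>"
    using abs_triangle_ineq2[of "fst X * fst Y" "snd X \<bullet> snd Y"]
    by (simp add: hform_def z_def w_def abs_mult)
  have "hform X X * hform Y Y = (z * w - u * v)\<^sup>2 - (z * v - w * u)\<^sup>2"
    unfolding X Y by (simp add: power2_eq_square algebra_simps)
  then have "hform X X * hform Y Y \<le> (z * w - u * v)\<^sup>2" by simp
  then have "sqrt (hform X X * hform Y Y) \<le> z * w - u * v"
    using uv by (simp add: real_le_lsqrt)
  with le show ?thesis by simp
qed

lemma hdist_span:
  fixes X Y :: "real \<times> 'h::real_inner"
  assumes "hform X X > 0" "hform Y Y > 0"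
  shows "hdist (span {X}) (span {Y}) = arcosh (\<bar>hform X Y\<bar> / sqrt (hform X X * hform Y Y))"
proof -
  define c where "c = \<bar>hform X Y\<bar> / sqrt (hform X X * hform Y Y)"
  have "sqrt (hform X X * hform Y Y) > 0" using assms by simp
  then have c: "1 \<le> c"
    using hform_reverse_Cauchy_Schwarz[OF assms] by (simp add: c_def)
  have ratio: "\<bar>hform X' Y'\<bar> / sqrt (hform X' X' * hform Y' Y') = c"
    if X': "X' \<in> span {X} - {0}" and Y': "Y' \<in> span {Y} - {0}" for X' Y'
  proof -
    obtain a b where ab: "X' = a *\<^sub>R X" "Y' = b *\<^sub>R Y" "a \<noteq> 0" "b \<noteq> 0"
      using X' Y' by (auto simp: span_singleton)
    have eq: "hform X' X' * hform Y' Y' = (a * b)\<^sup>2 * (hform X X * hform Y Y)"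
      unfolding ab hform_scaleR by (simp add: power2_eq_square)
    have "sqrt (hform X' X' * hform Y' Y') = \<bar>a * b\<bar> * sqrt (hform X X * hform Y Y)"
      unfolding eq real_sqrt_mult real_sqrt_abs ..
    moreover have "\<bar>hform X' Y'\<bar> = \<bar>a * b\<bar> * \<bar>hform X Y\<bar>"
      unfolding ab hform_scaleR by (simp add: abs_mult)
    ultimately show ?thesis using ab by (simp add: c_def)
  qed
  have "X \<noteq> 0" "Y \<noteq> 0" using assms by (auto simp: hform_def)
  then have mem: "X \<in> span {X} - {0}" "Y \<in> span {Y} - {0}" by (auto intro: span_base)
  show ?thesis
    unfolding hdist_def c_def[symmetric]
  proof (rule the_equality)
    show "0 \<le> arcosh c \<and> (\<forall>X' \<in> span {X} - {0}. \<forall>Y' \<in> span {Y} - {0}.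
        cosh (arcosh c) = \<bar>hform X' Y'\<bar> / sqrt (hform X' X' * hform Y' Y'))"
      using c ratio by (simp add: cosh_arcosh_real arcosh_nonneg_real)
  next
    fix d assume d: "0 \<le> d \<and> (\<forall>X' \<in> span {X} - {0}. \<forall>Y' \<in> span {Y} - {0}.
        cosh d = \<bar>hform X' Y'\<bar> / sqrt (hform X' X' * hform Y' Y'))"
    then have "cosh d = c" using mem ratio by metis
    then show "d = arcosh c" using d by (metis arcosh_cosh_real)
  qed
qed

lemma subgroup_hyp_isometries: "subgroup (hyp_isometries H) (BijGroup (hyp_space H))"
proof
  let ?S = "hyp_space H"
  show sub: "hyp_isometries H \<subseteq> carrier (BijGroup ?S)"
    by (auto simp: hyp_isometries_def BijGroup_def)
  show "\<one>\<^bsub>BijGroup ?S\<^esub> \<in> hyp_isometries H"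
    by (auto simp: hyp_isometries_def BijGroup_def id_Bij)
  fix f assume f: "f \<in> hyp_isometries H"
  then have fB: "f \<in> Bij ?S" by (simp add: hyp_isometries_def)
  have finto: "f x \<in> ?S" if "x \<in> ?S" for x
    using fB that by (auto dest: Bij_imp_funcset)
  show "inv\<^bsub>BijGroup ?S\<^esub> f \<in> hyp_isometries H"
  proof -
    have "f ` ?S = ?S" using fB by (auto simp: Bij_def bij_betw_def)
    then have into: "inv_into ?S f x \<in> ?S" and r: "f (inv_into ?S f x) = x" if "x \<in> ?S" for x
      using that inv_into_into[of x f ?S] f_inv_into_f[of x f ?S] by simp_all
    have "hdist (inv_into ?S f x) (inv_into ?S f y) = hdist x y" if "x \<in> ?S" "y \<in> ?S" for x y
    proof -
      have "hdist (f (inv_into ?S f x)) (f (inv_into ?S f y)) =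
          hdist (inv_into ?S f x) (inv_into ?S f y)"
        using f into[OF that(1)] into[OF that(2)] by (simp add: hyp_isometries_def)
      then show ?thesis by (simp only: r[OF that(1)] r[OF that(2)])
    qed
    then show ?thesis
      using fB by (simp add: inv_BijGroup hyp_isometries_def restrict_inv_into_Bij)
  qed
  fix g assume g: "g \<in> hyp_isometries H"
  then have gB: "g \<in> Bij ?S" by (simp add: hyp_isometries_def)
  have ginto: "g x \<in> ?S" if "x \<in> ?S" for x
    using gB that by (auto dest: Bij_imp_funcset)
  show "f \<otimes>\<^bsub>BijGroup ?S\<^esub> g \<in> hyp_isometries H"
    using f g fB gB ginto by (simp add: BijGroup_def hyp_isometries_def compose_Bij compose_eq)
qed

lemma group_Is: "group (Is H)"
  unfolding Is_def by (intro subgroup.subgroup_is_group subgroup_hyp_isometries group_BijGroup)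

lemma of_to_coords [simp]: "of_coords (to_coords X) = X"
  by (simp add: of_coords_def to_coords_def vec_eq_iff prod_eq_iff)

lemma to_of_coords [simp]: "to_coords (of_coords v) = v"
  by (auto simp: of_coords_def to_coords_def vec_eq_iff split: option.split)

lemma linear_to_coords: "linear to_coords"
  by (rule linearI) (auto simp: to_coords_def vec_eq_iff split: option.split)

lemma linear_of_coords: "linear of_coords"
  by (rule linearI) (auto simp: of_coords_def vec_eq_iff)

lemma linear_in_coords: "linear T \<Longrightarrow> linear (to_coords \<circ> T \<circ> of_coords)"
  by (intro linear_compose linear_to_coords linear_of_coords)

lemma lift_det_id: "lift_det id = 1"
  by (simp add: lift_det_def comp_def flip: id_def)

lemma lift_det_comp:
  assumes "linear S" "linear T"
  shows "lift_det (S \<circ> T) = lift_det S * lift_det T"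
proof -
  have "to_coords \<circ> (S \<circ> T) \<circ> of_coords =
      (to_coords \<circ> S \<circ> of_coords) \<circ> (to_coords \<circ> T \<circ> of_coords)"
    by (simp add: fun_eq_iff)
  then show ?thesis
    unfolding lift_det_def
    by (simp only: matrix_compose[OF linear_in_coords[OF assms(2)] linear_in_coords[OF assms(1)]] det_mul)
qed

lemma subgroup_orientation_preserving:
  fixes H :: "(real^'n) itself"
  shows "subgroup {f \<in> hyp_isometries H. orientation_preserving f} (Is H)"
proof -
  interpret group "Is H" by (rule group_Is)
  let ?S = "hyp_space H" and ?P = "{f \<in> hyp_isometries H. orientation_preserving f}"
  have S: "hyp_space TYPE(real^'n) = ?S" by (simp add: hyp_space_def)
  have carr: "carrier (Is H) = hyp_isometries H" by (simp add: Is_def)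
  have mult: "f \<otimes>\<^bsub>Is H\<^esub> g = compose ?S f g" if "f \<in> hyp_isometries H" "g \<in> hyp_isometries H" for f g
    using that by (simp add: Is_def BijGroup_def hyp_isometries_def)
  have one: "\<one>\<^bsub>Is H\<^esub> = (\<lambda>x\<in>?S. x)" by (simp add: Is_def BijGroup_def)
  have maps: "f x \<in> ?S" if "f \<in> hyp_isometries H" "x \<in> ?S" for f x
    using that by (auto simp: hyp_isometries_def dest: Bij_imp_funcset)
  have lin: "linear T" if "T \<in> O_form" for T :: "real \<times> (real^'n) \<Rightarrow> real \<times> (real^'n)"
    using that by (simp add: O_form_def bounded_linear.linear)
  have "orientation_preserving (\<one>\<^bsub>Is H\<^esub>)"
    unfolding orientation_preserving_def
    by (rule exI[of _ id])
       (auto simp: one lifts_def S O_form_def preserves_sheet_def lift_det_id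
             intro: bounded_linear_ident[folded id_def])
  moreover have "orientation_preserving (f \<otimes>\<^bsub>Is H\<^esub> g)" if f: "f \<in> ?P" and g: "g \<in> ?P" for f g
  proof -
    obtain T U where T: "lifts T f" "preserves_sheet T" "lift_det T > 0"
      and U: "lifts U g" "preserves_sheet U" "lift_det U > 0"
      using f g by (auto simp: orientation_preserving_def)
    have O: "T \<in> O_form" "U \<in> O_form" using T U by (auto simp: lifts_def)
    have "lifts (T \<circ> U) (f \<otimes>\<^bsub>Is H\<^esub> g)"
      unfolding lifts_def S
    proof
      show "T \<circ> U \<in> O_form"
        using O bounded_linear_compose[of T U]
        by (simp add: O_form_def bij_comp comp_def[of T U, symmetric] del: split_paired_All)
      show "\<forall>x\<in>?S. (f \<otimes>\<^bsub>Is H\<^esub> g) x = (T \<circ> U) ` x"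
      proof
        fix x assume x: "x \<in> ?S"
        have "g x \<in> ?S" using maps g x by auto
        then show "(f \<otimes>\<^bsub>Is H\<^esub> g) x = (T \<circ> U) ` x"
          using T U f g x by (simp add: mult compose_eq lifts_def S image_comp)
      qed
    qed
    moreover have "preserves_sheet (T \<circ> U)"
      using T U O by (simp add: preserves_sheet_def O_form_def del: split_paired_All)
    moreover have "lift_det (T \<circ> U) > 0"
      using T U O by (simp add: lift_det_comp lin)
    ultimately show ?thesis unfolding orientation_preserving_def by blast
  qed
  moreover have "orientation_preserving (inv\<^bsub>Is H\<^esub> f)" if f: "f \<in> ?P" for f
  proof -
    obtain T where T: "lifts T f" "preserves_sheet T" "lift_det T > 0"
      using f by (auto simp: orientation_preserving_def)
    define U where "U = inv_into UNIV T"
    have O: "T \<in> O_form" using T by (simp add: lifts_def)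
    then have b: "bij T" and lT: "linear T" and pT: "hform (T X) (T Y) = hform X Y" for X Y
      using lin by (auto simp: O_form_def simp del: split_paired_All)
    have TU: "T (U X) = X" and UT: "U (T X) = X" for X
      using b by (simp_all add: U_def bij_is_surj surj_f_inv_f bij_is_inj)
    have lU: "linear U"
      unfolding U_def using lT b by (simp add: inj_linear_imp_inv_linear bij_is_inj)
    have pU: "hform (U X) (U Y) = hform X Y" for X Y
      using pT[of "U X" "U Y"] by (simp add: TU)
    have OU: "U \<in> O_form"
      using lU pU bij_imp_bij_inv[OF b]
      by (simp add: O_form_def linear_conv_bounded_linear flip: U_def)
    have fH: "f \<in> hyp_isometries H" using f by simp
    have iH: "inv\<^bsub>Is H\<^esub> f \<in> hyp_isometries H"
      using inv_closed[of f] fH by (simp add: carr)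
    have "lifts U (inv\<^bsub>Is H\<^esub> f)"
      unfolding lifts_def S
    proof (intro conjI ballI OU)
      fix x assume x: "x \<in> ?S"
      have y: "(inv\<^bsub>Is H\<^esub> f) x \<in> ?S" using maps iH x by blast
      have "f \<otimes>\<^bsub>Is H\<^esub> inv\<^bsub>Is H\<^esub> f = \<one>\<^bsub>Is H\<^esub>" using fH by (simp add: r_inv carr)
      then have "compose ?S f (inv\<^bsub>Is H\<^esub> f) x = x" using mult[OF fH iH] one x by simp
      then have "T ` (inv\<^bsub>Is H\<^esub> f) x = x" using T(1) x y by (simp add: compose_eq lifts_def S)
      then have "U ` x = U ` T ` (inv\<^bsub>Is H\<^esub> f) x" by simp
      also have "\<dots> = (inv\<^bsub>Is H\<^esub> f) x" by (simp add: image_image UT)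
      finally show "(inv\<^bsub>Is H\<^esub> f) x = U ` x" by simp
    qed
    moreover have "preserves_sheet U"
      unfolding preserves_sheet_def
    proof (intro allI impI, rule ccontr)
      fix X :: "real \<times> (real^'n)"
      assume X: "hform X X > 0 \<and> fst X > 0" and neg: "\<not> fst (U X) > 0"
      have pos: "hform (U X) (U X) > 0" using X pU by simp
      then have "fst (U X) \<noteq> 0"
        using inner_ge_zero[of "snd (U X)"] by (auto simp: hform_def simp del: inner_ge_zero)
      then have "fst (- U X) > 0" "hform (- U X) (- U X) > 0"
        using neg pos by (auto simp: hform_def)
      then have "fst (T (- U X)) > 0" using T(2) unfolding preserves_sheet_def by blast
      then show False using X by (simp add: linear_neg[OF lT] TU)
    qed
    moreover have "lift_det U > 0"
    proof -
      have "U \<circ> T = id" by (simp add: fun_eq_iff UT)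
      then have "lift_det U * lift_det T = 1"
        using lift_det_comp[OF lU lT] lift_det_id by metis
      then show ?thesis using T(3) by (metis zero_less_mult_pos2 zero_less_one)
    qed
    ultimately show ?thesis unfolding orientation_preserving_def by blast
  qed
  ultimately show ?thesis
    using inv_closed m_closed one_closed by (intro subgroup.intro) (auto simp: carr)
qed

lemma group_Is_plus: "group (Is_plus H)"
proof -
  have "Is_plus H = (Is H)\<lparr>carrier := {f \<in> hyp_isometries H. orientation_preserving f}\<rparr>"
    by (simp add: Is_plus_def)
  then show ?thesis
    using subgroup.subgroup_is_group[OF subgroup_orientation_preserving group_Is] by simp
qed

end

theory Submission
  imports Defs "HOL-Algebra.Free_Abelian_Groups" "HOL-Computational_Algebra.Computational_Algebra"
    "HOL-Real_Asymp.Real_Asymp"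
begin

text \<open>The field of complex numbers carries a non-archimedean absolute value of residue
  characteristic zero for which it is separable: a transcendence basis of the complex numbers can be
  sent injectively into one of the field of rational Laurent series, and the \<open>X\<close>-adic
  valuation transported in this way extends to the complex numbers by the theorem on extension of valuations.
  For such an absolute value there are only countably many balls, and they are the vertices of a
  tree on which the matrices of determinant \<open>1\<close> or \<open>-1\<close> act.  The kernel
  \<open>c ^ d(x, y)\<close> of a tree is of hyperbolic type for every \<open>c > 1\<close>, so the tree embeds equivariantly
  into the infinite-dimensional hyperbolic space, and the action on the span of the vertices is
  the required representation.  It is irreducible because averages over integral unipotent matrices
  bring every vector not orthogonal to a vertex close to a nonzero multiple of this vertex.\<close>

section \<open>Fields generated by a set and transcendence bases\<close>

text \<open>The groups are uncountable, so a countable orbit requires a stabilizer of countable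
  index. The integral matrices of the chosen absolute value form such a subgroup because it has
  countably many values and a countable set comes within distance 1 of every number. Rational
  Laurent series provide this: their truncated expansions are countable in number, while the series
  themselves have the cardinality of the continuum. Residue characteristic zero makes every positive
  integer a unit, so shears by different naturals can move a vertex into pairwise different
  directions, as the averages need. The complex numbers being algebraically closed, the value group
  is divisible and the tree is not discrete. Modulo sign, the real matrices of determinant 1 or -1
  are the isometries of the plane, and the complex ones of determinant 1 are the
  orientation-preserving isometries of space, so one argument covers both groups.\<close>

inductive_set gen_field :: "'a::field set \<Rightarrow> 'a set" for S where
  base: "x \<in> S \<Longrightarrow> x \<in> gen_field S"
| one: "1 \<in> gen_field S"
| add: "x \<in> gen_field S \<Longrightarrow> y \<in> gen_field S \<Longrightarrow> x + y \<in> gen_field S"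
| uminus: "x \<in> gen_field S \<Longrightarrow> - x \<in> gen_field S"
| mult: "x \<in> gen_field S \<Longrightarrow> y \<in> gen_field S \<Longrightarrow> x * y \<in> gen_field S"
| inverse: "x \<in> gen_field S \<Longrightarrow> inverse x \<in> gen_field S"

text \<open>A relation generated by componentwise field operations, instead of a map on the
  generated field: it exists before anything is known about well-definedness, and becomes the graph
  of a field isomorphism as soon as the two components of a pair vanish only simultaneously.\<close>

inductive_set gen_graph :: "('a::field \<times> 'b::field) set \<Rightarrow> ('a \<times> 'b) set" for R where
  base: "(x, y) \<in> R \<Longrightarrow> (x, y) \<in> gen_graph R"
| one: "(1, 1) \<in> gen_graph R"
| add: "(x, y) \<in> gen_graph R \<Longrightarrow> (x', y') \<in> gen_graph R \<Longrightarrow> (x + x', y + y') \<in> gen_graph R"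
| uminus: "(x, y) \<in> gen_graph R \<Longrightarrow> (- x, - y) \<in> gen_graph R"
| mult: "(x, y) \<in> gen_graph R \<Longrightarrow> (x', y') \<in> gen_graph R \<Longrightarrow> (x * x', y * y') \<in> gen_graph R"
| inverse: "(x, y) \<in> gen_graph R \<Longrightarrow> (inverse x, inverse y) \<in> gen_graph R"

lemma gen_field_zero: "0 \<in> gen_field S"
  using gen_field.add[OF gen_field.one gen_field.uminus[OF gen_field.one]] by simp

lemma gen_graph_zero: "(0, 0) \<in> gen_graph R"
  using gen_graph.add[OF gen_graph.one gen_graph.uminus[OF gen_graph.one]] by simp

lemma gen_field_sum: "(\<And>i. i \<in> A \<Longrightarrow> f i \<in> gen_field S) \<Longrightarrow> sum f A \<in> gen_field S"
  by (induction A rule: infinite_finite_induct) (auto intro: gen_field.add gen_field_zero)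

lemma gen_field_power: "x \<in> gen_field S \<Longrightarrow> x ^ n \<in> gen_field S"
  by (induction n) (auto intro: gen_field.mult gen_field.one)

lemma gen_graph_sum:
  "(\<And>i. i \<in> A \<Longrightarrow> (f i, g i) \<in> gen_graph R) \<Longrightarrow> (sum f A, sum g A) \<in> gen_graph R"
  by (induction A rule: infinite_finite_induct) (auto intro: gen_graph.add gen_graph_zero)

lemma gen_graph_power: "(x, y) \<in> gen_graph R \<Longrightarrow> (x ^ n, y ^ n) \<in> gen_graph R"
  by (induction n) (auto intro: gen_graph.mult gen_graph.one)

lemma gen_graph_of_nat: "(of_nat n, of_nat n) \<in> gen_graph R"
  by (induction n) (auto intro: gen_graph.add gen_graph.one gen_graph_zero)

lemma gen_graph_of_int: "(of_int n, of_int n) \<in> gen_graph R"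
proof (cases n)
  case (nonneg m)
  then show ?thesis using gen_graph_of_nat by auto
next
  case (neg m)
  then show ?thesis using gen_graph.uminus[OF gen_graph_of_nat[of "Suc m"]] by simp
qed

lemma gen_graph_of_rat:
  "(of_rat q, of_rat q) \<in> gen_graph (R :: ('a::field_char_0 \<times> 'b::field_char_0) set)"
proof -
  obtain a b where q: "q = of_int a / of_int b" by (metis Fract_of_int_quotient Rat_cases)
  have "(of_int a * inverse (of_int b), of_int a * inverse (of_int b)) \<in> gen_graph R"
    by (intro gen_graph.mult gen_graph.inverse gen_graph_of_int)
  then show ?thesis
    by (simp only: q of_rat_divide of_rat_of_int_eq flip: divide_inverse)
qed

lemma gen_field_mono: "S \<subseteq> S' \<Longrightarrow> gen_field S \<subseteq> gen_field S'"
proof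
  fix x assume S: "S \<subseteq> S'" and "x \<in> gen_field S"
  from this(2) show "x \<in> gen_field S'"
    by induction (use S in \<open>auto intro: gen_field.intros\<close>)
qed

lemma gen_graph_mono: "R \<subseteq> R' \<Longrightarrow> z \<in> gen_graph R \<Longrightarrow> z \<in> gen_graph R'"
proof -
  assume S: "R \<subseteq> R'" and "z \<in> gen_graph R"
  then have "(fst z, snd z) \<in> gen_graph R" by simp
  then have "(fst z, snd z) \<in> gen_graph R'"
    by (induction rule: gen_graph.induct) (use S in \<open>auto intro: gen_graph.intros\<close>)
  then show "z \<in> gen_graph R'" by simp
qed

lemma gen_field_finite_character:
  "x \<in> gen_field S \<Longrightarrow> \<exists>S0. finite S0 \<and> S0 \<subseteq> S \<and> x \<in> gen_field S0"
proof (induction rule: gen_field.induct)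
  case (base x)
  then show ?case by (intro exI[of _ "{x}"]) (auto intro: gen_field.base)
next
  case (add x y)
  then obtain A B where "finite A" "A \<subseteq> S" "x \<in> gen_field A" "finite B" "B \<subseteq> S" "y \<in> gen_field B" by blast
  then show ?case
    using gen_field_mono[of A "A \<union> B"] gen_field_mono[of B "A \<union> B"]
    by (intro exI[of _ "A \<union> B"]) (auto intro: gen_field.add)
next
  case (mult x y)
  then obtain A B where "finite A" "A \<subseteq> S" "x \<in> gen_field A" "finite B" "B \<subseteq> S" "y \<in> gen_field B" by blast
  then show ?case
    using gen_field_mono[of A "A \<union> B"] gen_field_mono[of B "A \<union> B"]
    by (intro exI[of _ "A \<union> B"]) (auto intro: gen_field.mult)
qed (auto intro: gen_field.intros)

lemma gen_graph_finite_character: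
  "(x, y) \<in> gen_graph R \<Longrightarrow> \<exists>R0. finite R0 \<and> R0 \<subseteq> R \<and> (x, y) \<in> gen_graph R0"
proof (induction rule: gen_graph.induct)
  case (base x y)
  then show ?case by (intro exI[of _ "{(x, y)}"]) (auto intro: gen_graph.base)
next
  case (add x y x' y')
  then obtain A B where "finite A" "A \<subseteq> R" "(x, y) \<in> gen_graph A"
    "finite B" "B \<subseteq> R" "(x', y') \<in> gen_graph B" by blast
  then show ?case
    using gen_graph_mono[of A "A \<union> B"] gen_graph_mono[of B "A \<union> B"]
    by (intro exI[of _ "A \<union> B"]) (auto intro: gen_graph.add)
next
  case (mult x y x' y')
  then obtain A B where "finite A" "A \<subseteq> R" "(x, y) \<in> gen_graph A"
    "finite B" "B \<subseteq> R" "(x', y') \<in> gen_graph B" by blast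
  then show ?case
    using gen_graph_mono[of A "A \<union> B"] gen_graph_mono[of B "A \<union> B"]
    by (intro exI[of _ "A \<union> B"]) (auto intro: gen_graph.mult)
qed (auto intro: gen_graph.intros)

lemma gen_graph_fst: "(x, y) \<in> gen_graph R \<Longrightarrow> x \<in> gen_field (fst ` R)"
  by (induction rule: gen_graph.induct) (force intro: gen_field.intros)+

lemma gen_graph_snd: "(x, y) \<in> gen_graph R \<Longrightarrow> y \<in> gen_field (snd ` R)"
  by (induction rule: gen_graph.induct) (force intro: gen_field.intros)+

lemma gen_field_graph: "x \<in> gen_field (fst ` R) \<Longrightarrow> \<exists>y. (x, y) \<in> gen_graph R"
  by (induction rule: gen_field.induct) (force intro: gen_graph.intros)+

lemma gen_field_diag: "x \<in> gen_field S \<Longrightarrow> (x, x) \<in> gen_graph (Id_on S)"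
  by (induction rule: gen_field.induct) (auto intro: gen_graph.intros)

text \<open>Carries an algebraic equation over one field to the corresponding equation over the
  other.\<close>

definition poly_pair :: "('a::field \<times> 'b::field) set \<Rightarrow> 'a poly \<Rightarrow> 'b poly \<Rightarrow> bool" where
  "poly_pair R p q \<longleftrightarrow> (\<forall>i. (coeff p i, coeff q i) \<in> gen_graph R)"

lemma poly_pair_add: "poly_pair R p p' \<Longrightarrow> poly_pair R q q' \<Longrightarrow> poly_pair R (p + q) (p' + q')"
  by (simp add: poly_pair_def gen_graph.add)

lemma poly_pair_uminus: "poly_pair R p p' \<Longrightarrow> poly_pair R (- p) (- p')"
  by (simp add: poly_pair_def gen_graph.uminus)

lemma poly_pair_mult: "poly_pair R p p' \<Longrightarrow> poly_pair R q q' \<Longrightarrow> poly_pair R (p * q) (p' * q')"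
  by (simp add: poly_pair_def coeff_mult gen_graph_sum gen_graph.mult)

lemma poly_pair_const: "(x, y) \<in> gen_graph R \<Longrightarrow> poly_pair R [:x:] [:y:]"
  by (auto simp: poly_pair_def coeff_pCons gen_graph_zero split: nat.split)

lemma poly_pair_X: "poly_pair R [:0, 1:] [:0, 1:]"
  by (auto simp: poly_pair_def coeff_pCons gen_graph_zero gen_graph.one split: nat.split)

text \<open>Elements of a simple extension are quotients of polynomials in the new generator; here
  the extensions by \<open>x\<close> and by \<open>y\<close> are described by corresponding
  quotients. The assumption on roots keeps numerators zero or nonzero together, which is what the
  inverse case needs.\<close>

lemma gen_graph_insert_quotient:
  assumes H: "\<And>p p'. poly_pair R p p' \<Longrightarrow> poly p x = 0 \<longleftrightarrow> poly p' y = 0"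
    and "(z, w) \<in> gen_graph (insert (x, y) R)"
  shows "\<exists>p p' q q'. poly_pair R p p' \<and> poly_pair R q q' \<and> poly q x \<noteq> 0 \<and> poly q' y \<noteq> 0 \<and>
    z = poly p x / poly q x \<and> w = poly p' y / poly q' y"
  using assms(2)
proof (induction rule: gen_graph.induct)
  case (base z w)
  then consider "z = x" "w = y" | "(z, w) \<in> R" by blast
  then show ?case
  proof cases
    case 1
    then show ?thesis
      by (intro exI[of _ "[:0, 1:]"] exI[of _ "[:1:]"]) (auto intro!: poly_pair_X poly_pair_const gen_graph.one)
  next
    case 2
    then show ?thesis
      by (intro exI[of _ "[:z:]"] exI[of _ "[:w:]"] exI[of _ "[:1:]"])
         (auto intro!: poly_pair_const gen_graph.one gen_graph.base)
  qed
next
  case one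
  show ?case
    by (intro exI[of _ "[:1:]"]) (auto intro!: poly_pair_const gen_graph.one)
next
  case (add z w z' w')
  obtain p p' q q' where 1: "poly_pair R p p'" "poly_pair R q q'" "poly q x \<noteq> 0" "poly q' y \<noteq> 0"
    "z = poly p x / poly q x" "w = poly p' y / poly q' y" using add.IH by blast
  obtain r r' s s' where 2: "poly_pair R r r'" "poly_pair R s s'" "poly s x \<noteq> 0" "poly s' y \<noteq> 0"
    "z' = poly r x / poly s x" "w' = poly r' y / poly s' y" using add.IH by blast
  show ?case
    by (intro exI[of _ "p * s + r * q"] exI[of _ "p' * s' + r' * q'"] exI[of _ "q * s"] exI[of _ "q' * s'"])
       (use 1 2 in \<open>auto intro!: poly_pair_add poly_pair_mult simp: add_frac_eq\<close>)
next
  case (uminus z w)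
  obtain p p' q q' where 1: "poly_pair R p p'" "poly_pair R q q'" "poly q x \<noteq> 0" "poly q' y \<noteq> 0"
    "z = poly p x / poly q x" "w = poly p' y / poly q' y" using uminus.IH by blast
  show ?case
    by (intro exI[of _ "- p"] exI[of _ "- p'"] exI[of _ q] exI[of _ q'])
       (use 1 in \<open>auto intro!: poly_pair_uminus\<close>)
next
  case (mult z w z' w')
  obtain p p' q q' where 1: "poly_pair R p p'" "poly_pair R q q'" "poly q x \<noteq> 0" "poly q' y \<noteq> 0"
    "z = poly p x / poly q x" "w = poly p' y / poly q' y" using mult.IH by blast
  obtain r r' s s' where 2: "poly_pair R r r'" "poly_pair R s s'" "poly s x \<noteq> 0" "poly s' y \<noteq> 0"
    "z' = poly r x / poly s x" "w' = poly r' y / poly s' y" using mult.IH by blast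
  show ?case
    by (intro exI[of _ "p * r"] exI[of _ "p' * r'"] exI[of _ "q * s"] exI[of _ "q' * s'"])
       (use 1 2 in \<open>auto intro!: poly_pair_mult\<close>)
next
  case (inverse z w)
  obtain p p' q q' where 1: "poly_pair R p p'" "poly_pair R q q'" "poly q x \<noteq> 0" "poly q' y \<noteq> 0"
    "z = poly p x / poly q x" "w = poly p' y / poly q' y" using inverse.IH by blast
  show ?case
  proof (cases "poly p x = 0")
    case True
    \<comment> \<open>Both elements are zero and \<open>inverse 0 = 0\<close>, so the quotient 0 / 1
      represents their inverses.\<close>
    then have "z = 0" "w = 0" using 1 H[OF 1(1)] by auto
    then show ?thesis
      by (rule_tac exI[of _ "[:0:]"], rule_tac exI[of _ "[:0:]"], rule_tac exI[of _ "[:1:]"],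
          rule_tac exI[of _ "[:1:]"])
         (auto intro!: poly_pair_const[of 1 1] gen_graph.one simp: poly_pair_def[of R 0 0] gen_graph_zero)
  next
    case False
    then have "poly p' y \<noteq> 0" using H[OF 1(1)] by simp
    with False 1 show ?thesis
      by (intro exI[of _ q] exI[of _ q'] exI[of _ p] exI[of _ p']) auto
  qed
qed

section \<open>Algebraic dependence, exchange and transcendence bases\<close>

definition alg_over :: "'a::field set \<Rightarrow> 'a \<Rightarrow> bool" where
  "alg_over S x \<longleftrightarrow> (\<exists>p. p \<noteq> 0 \<and> (\<forall>i. coeff p i \<in> gen_field S) \<and> poly p x = 0)"

lemma alg_over_gen_field: "x \<in> gen_field S \<Longrightarrow> alg_over S x"
  unfolding alg_over_def
  by (rule exI[of _ "[:-x, 1:]"])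
     (auto simp: coeff_pCons gen_field_zero gen_field.intros split: nat.split)

lemma alg_over_mono: "alg_over S x \<Longrightarrow> S \<subseteq> S' \<Longrightarrow> alg_over S' x"
  unfolding alg_over_def using gen_field_mono by blast

lemma alg_over_finite_character:
  assumes "alg_over S x"
  obtains S0 where "finite S0" "S0 \<subseteq> S" "alg_over S0 x"
proof -
  obtain p where p: "p \<noteq> 0" "\<And>i. coeff p i \<in> gen_field S" "poly p x = 0"
    using assms by (auto simp: alg_over_def)
  have "\<forall>i. \<exists>S0. finite S0 \<and> S0 \<subseteq> S \<and> coeff p i \<in> gen_field S0"
    using gen_field_finite_character p(2) by blast
  then obtain T where T: "\<And>i. finite (T i)" "\<And>i. T i \<subseteq> S" "\<And>i. coeff p i \<in> gen_field (T i)"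
    by metis
  let ?S0 = "\<Union>i\<le>degree p. T i"
  have "coeff p i \<in> gen_field ?S0" for i
  proof (cases "i \<le> degree p")
    case True
    then have "T i \<subseteq> ?S0" by blast
    then show ?thesis using gen_field_mono T(3) by blast
  qed (simp add: coeff_eq_0 gen_field_zero)
  then have "alg_over ?S0 x" using p by (auto simp: alg_over_def)
  moreover have "finite ?S0" "?S0 \<subseteq> S" using T by auto
  ultimately show thesis by (rule that[rotated 2])
qed

text \<open>The diagonal case of \<open>gen_graph_insert_quotient\<close>: in the relation generated
  by \<open>Id_on S\<close> the two polynomials of a pair coincide.\<close>

lemma gen_field_insert_quotient:
  assumes "z \<in> gen_field (insert x S)"
  shows "\<exists>p q. (\<forall>i. coeff p i \<in> gen_field S) \<and> (\<forall>i. coeff q i \<in> gen_field S) \<and>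
    poly q x \<noteq> 0 \<and> z = poly p x / poly q x"
proof -
  have d: "u = v \<and> u \<in> gen_field T" if "(u, v) \<in> gen_graph (Id_on T)" for u v and T :: "'a set"
    using that by (induction rule: gen_graph.induct) (auto intro: gen_field.intros)
  then have eq: "p = q" if "poly_pair (Id_on S) p q" for p q
    using that by (auto simp: poly_pair_def poly_eq_iff)
  have "Id_on (insert x S) = insert (x, x) (Id_on S)" by auto
  then have "(z, z) \<in> gen_graph (insert (x, x) (Id_on S))"
    using gen_field_diag[OF assms] by simp
  from gen_graph_insert_quotient[OF _ this] eq
  obtain p p' q q' where pq: "poly_pair (Id_on S) p p'" "poly_pair (Id_on S) q q'" "poly q x \<noteq> 0"
    "z = poly p x / poly q x" by metis
  have "(\<forall>i. coeff p i \<in> gen_field S) \<and> (\<forall>i. coeff q i \<in> gen_field S)"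
    using pq(1,2) d unfolding poly_pair_def by blast
  with pq show ?thesis by blast
qed

text \<open>Steinitz exchange. After clearing denominators, an equation for \<open>b\<close> with
  coefficients depending on \<open>x\<close> is a polynomial relation between \<open>x\<close> and
  \<open>b\<close> over \<open>S\<close>. Sorted by powers of \<open>x\<close> it is an equation for
  \<open>x\<close>, and it is nontrivial because \<open>b\<close> satisfies no equation over
  \<open>S\<close>.\<close>

lemma alg_over_exchange:
  assumes a: "alg_over (insert x S) b" and nb: "\<not> alg_over S b"
  shows "alg_over (insert b S) x"
proof -
  obtain p where p: "p \<noteq> 0" "\<And>i. coeff p i \<in> gen_field (insert x S)" "poly p b = 0"
    using a by (auto simp: alg_over_def)
  have "\<forall>i. \<exists>f g. (\<forall>j. coeff f j \<in> gen_field S) \<and> (\<forall>j. coeff g j \<in> gen_field S) \<and>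
    poly g x \<noteq> 0 \<and> coeff p i = poly f x / poly g x"
    using gen_field_insert_quotient[OF p(2)] by blast
  then obtain P Q where P: "\<And>i j. coeff (P i) j \<in> gen_field S" and Q: "\<And>i j. coeff (Q i) j \<in> gen_field S"
    and Q0: "\<And>i. poly (Q i) x \<noteq> 0" and PQ: "\<And>i. coeff p i = poly (P i) x / poly (Q i) x"
    by metis
  let ?n = "degree p"
  have mult: "\<forall>j. coeff (f * g) j \<in> gen_field S"
    if "\<forall>j. coeff f j \<in> gen_field S" "\<forall>j. coeff g j \<in> gen_field S" for f g :: "'a poly"
    using that by (auto simp: coeff_mult intro!: gen_field_sum gen_field.mult)
  have prd: "\<forall>j. coeff (prod Q A) j \<in> gen_field S" for A
    by (induction A rule: infinite_finite_induct)
       (use mult Q in \<open>auto simp: gen_field.one gen_field_zero coeff_pCons one_pCons split: nat.split\<close>)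
  \<comment> \<open>Numerators over a common denominator: \<open>R i\<close> has coefficients in the
    field generated by \<open>S\<close>, and its value at \<open>x\<close> is the coefficient of
    \<open>b ^ i\<close> times the fixed nonzero factor \<open>D\<close>.\<close>
  define R where "R i = P i * prod Q ({..?n} - {i})" for i
  have RS: "coeff (R i) j \<in> gen_field S" for i j
    unfolding R_def using mult P prd by blast
  define D where "D = poly (prod Q {..?n}) x"
  have D: "D \<noteq> 0" using Q0 by (simp add: D_def poly_prod)
  have Rx: "poly (R i) x = coeff p i * D" if "i \<le> ?n" for i
  proof -
    have "prod Q {..?n} = Q i * prod Q ({..?n} - {i})"
      using that by (intro prod.remove) auto
    then show ?thesis using Q0[of i] by (simp add: R_def D_def PQ)
  qed
  define M where "M = (\<Sum>i\<le>?n. smult (b ^ i) (R i))"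
  have cM: "coeff M j = (\<Sum>i\<le>?n. b ^ i * coeff (R i) j)" for j
    by (simp add: M_def coeff_sum)
  have "poly M x = (\<Sum>i\<le>?n. b ^ i * (coeff p i * D))"
    by (simp add: M_def poly_sum Rx)
  also have "\<dots> = poly p b * D"
    by (simp add: poly_altdef sum_distrib_left mult_ac)
  finally have Mx: "poly M x = 0" using p by simp
  have Mb: "coeff M j \<in> gen_field (insert b S)" for j
  proof -
    have "coeff (R i) j \<in> gen_field (insert b S)" for i using RS gen_field_mono[of S "insert b S"] by blast
    then show ?thesis unfolding cM
      by (intro gen_field_sum gen_field.mult gen_field_power) (auto intro: gen_field.base)
  qed
  have "R ?n \<noteq> 0" using Rx[of ?n] D p(1) by auto
  then obtain j where j: "coeff (R ?n) j \<noteq> 0" by (auto simp: poly_eq_iff)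
  \<comment> \<open>The coefficient of \<open>x ^ j\<close> in the relation, as a polynomial in
    \<open>b\<close>, for a \<open>j\<close> that occurs in the leading \<open>R ?n\<close>. Its
    value at \<open>b\<close> is the coefficient of \<open>M\<close> at \<open>j\<close>.\<close>
  define N where "N = (\<Sum>i\<le>?n. monom (coeff (R i) j) i)"
  have cN: "coeff N i = (if i \<le> ?n then coeff (R i) j else 0)" for i
    by (auto simp: N_def coeff_sum if_distrib sum.delta cong: if_cong)
  have "coeff N ?n \<noteq> 0" using cN j by simp
  then have "N \<noteq> 0" by auto
  moreover have "\<forall>i. coeff N i \<in> gen_field S" using cN RS gen_field_zero by auto
  ultimately have "poly N b \<noteq> 0" using nb by (auto simp: alg_over_def)
  moreover have "poly N b = coeff M j"
    by (simp add: N_def cM poly_sum poly_monom mult.commute)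
  ultimately have "M \<noteq> 0" by auto
  with Mx Mb show ?thesis unfolding alg_over_def by blast
qed

definition alg_indep :: "'a::field set \<Rightarrow> bool" where
  "alg_indep B \<longleftrightarrow> (\<forall>b\<in>B. \<not> alg_over (B - {b}) b)"

text \<open>A dependence in the union of a chain involves finitely many elements and so occurs in
  one member, which makes Zorn's lemma applicable. Adding an element to a maximal independent set
  creates a dependence, and the exchange lemma turns it into an equation for the added
  element.\<close>

lemma transcendence_basis_exists:
  "\<exists>B :: 'a::field set. alg_indep B \<and> (\<forall>x. alg_over B x)"
proof -
  have "\<exists>M\<in>{B :: 'a set. alg_indep B}. \<forall>X\<in>{B. alg_indep B}. M \<subseteq> X \<longrightarrow> X = M"
  proof (rule subset_Zorn')
    fix C assume C: "subset.chain {B :: 'a set. alg_indep B} C"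
    have "\<not> alg_over (\<Union>C - {b}) b" if "b \<in> \<Union>C" for b
    proof
      assume "alg_over (\<Union>C - {b}) b"
      then obtain S0 where S0: "finite S0" "S0 \<subseteq> \<Union>C - {b}" "alg_over S0 b"
        by (rule alg_over_finite_character)
      have "finite (insert b S0)" "insert b S0 \<subseteq> \<Union>C" "C \<noteq> {}" using S0 that by auto
      then obtain X where X: "X \<in> C" "insert b S0 \<subseteq> X"
        by (metis C finite_subset_Union_chain)
      then have "alg_indep X" using C by (auto simp: subset.chain_def)
      moreover have "alg_over (X - {b}) b"
        using alg_over_mono[OF S0(3)] X S0(2) by blast
      ultimately show False using X by (auto simp: alg_indep_def)
    qed
    then show "\<Union>C \<in> {B. alg_indep B}" by (simp add: alg_indep_def)
  qed
  then obtain B :: "'a set" where B: "alg_indep B" and mx: "\<And>X. alg_indep X \<Longrightarrow> B \<subseteq> X \<Longrightarrow> X = B"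
    by auto
  have "alg_over B x" for x
  proof (cases "x \<in> B")
    case False
    then have "\<not> alg_indep (insert x B)" using mx[of "insert x B"] by blast
    then obtain b where b: "b \<in> insert x B" "alg_over (insert x B - {b}) b"
      unfolding alg_indep_def by blast
    show ?thesis
    proof (cases "b = x")
      case True
      then show ?thesis using b False by simp
    next
      case neq: False
      then have bB: "b \<in> B" using b by simp
      have "insert x B - {b} = insert x (B - {b})" using neq by auto
      then have "alg_over (insert b (B - {b})) x"
        using alg_over_exchange[of x "B - {b}" b] b B bB by (auto simp: alg_indep_def)
      then show ?thesis using bB by (simp add: insert_absorb)
    qed
  qed (intro alg_over_gen_field gen_field.base)
  with B show ?thesis by blast
qed

section \<open>Cardinality of generated fields and of transcendence bases\<close>

datatype field_term = FVar nat | FOne | FAdd field_term field_term | FNeg field_term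
  | FMul field_term field_term | FInv field_term

instance field_term :: countable
  by countable_datatype

primrec field_term_value :: "(nat \<Rightarrow> 'a::field) \<Rightarrow> field_term \<Rightarrow> 'a" where
  "field_term_value s (FVar n) = s n"
| "field_term_value s FOne = 1"
| "field_term_value s (FAdd t u) = field_term_value s t + field_term_value s u"
| "field_term_value s (FNeg t) = - field_term_value s t"
| "field_term_value s (FMul t u) = field_term_value s t * field_term_value s u"
| "field_term_value s (FInv t) = inverse (field_term_value s t)"

text \<open>Field expressions in countably many variables are countable in number and name every
  element of the generated field.\<close>

lemma countable_gen_field:
  assumes "countable S"
  shows "countable (gen_field S)"
proof -
  obtain s :: "nat \<Rightarrow> 'a" where s: "S \<subseteq> range s"
    using assms by (metis countable_as_injective_image_subset empty_subsetI infinite_imp_nonempty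
        range_from_nat_into subset_refl uncountable_def)
  have "x \<in> range (field_term_value s)" if "x \<in> gen_field S" for x
    using that
  proof induction
    case (base x)
    then obtain n where "x = field_term_value s (FVar n)" using s by auto
    then show ?case by blast
  next
    case one
    have "1 = field_term_value s FOne" by simp
    then show ?case by blast
  next
    case (add x y)
    then obtain t u where "x = field_term_value s t" "y = field_term_value s u" by blast
    then have "x + y = field_term_value s (FAdd t u)" by simp
    then show ?case by blast
  next
    case (uminus x)
    then obtain t where "x = field_term_value s t" by blast
    then have "- x = field_term_value s (FNeg t)" by simp
    then show ?case by blast
  next
    case (mult x y)
    then obtain t u where "x = field_term_value s t" "y = field_term_value s u" by blast
    then have "x * y = field_term_value s (FMul t u)" by simp
    then show ?case by blast
  next
    case (inverse x)
    then obtain t where "x = field_term_value s t" by blast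
    then have "inverse x = field_term_value s (FInv t)" by simp
    then show ?case by blast
  qed
  then show ?thesis
    by (intro countable_subset[of "gen_field S" "range (field_term_value s)"]) auto
qed

lemma countable_roots_polys:
  fixes A :: "'a::idom set"
  assumes "countable A"
  shows "countable {x. \<exists>p. p \<noteq> 0 \<and> (\<forall>i. coeff p i \<in> A) \<and> poly p x = 0}"
proof -
  let ?P = "{p. p \<noteq> 0 \<and> (\<forall>i. coeff p i \<in> A)}"
  have "coeffs ` ?P \<subseteq> lists A" by (auto simp: coeffs_def split: if_splits)
  then have "countable (coeffs ` ?P)" using assms countable_lists countable_subset by blast
  then have "countable ?P" by (rule countable_image_inj_on) (meson inj_onI coeffs_eq_iff)
  then have "countable (\<Union>p\<in>?P. {x. poly p x = 0})"
    by (intro countable_UN) (auto intro!: countable_finite poly_roots_finite)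
  then show ?thesis by (rule countable_subset[rotated]) auto
qed

lemma countable_alg_over: "countable S \<Longrightarrow> countable {x. alg_over S x}"
  unfolding alg_over_def by (intro countable_roots_polys countable_gen_field)

lemma infinite_times_self_lepoll: "infinite A \<Longrightarrow> A \<times> A \<lesssim> A"
  unfolding lepoll_def card_of_ordLeq by (intro ordIso_imp_ordLeq card_of_Times_same_infinite)

text \<open>Each \<open>x\<close> is algebraic over a finite part \<open>S x\<close> of the basis
  and is recovered from that part together with its index in an enumeration of the countably many
  elements algebraic over it. An infinite set has only as many finite parts as elements.\<close>

lemma transcendence_basis_lepoll:
  fixes B :: "'a::field set"
  assumes B: "\<And>x. alg_over B x" and unc: "uncountable (UNIV :: 'a set)"
  shows "(UNIV :: 'a set) \<lesssim> B"
proof -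
  have inf: "infinite B"
  proof
    assume "finite B"
    then have "countable {x. alg_over B x}" by (simp add: countable_alg_over countable_finite)
    then show False using B unc by simp
  qed
  have "\<forall>x. \<exists>S. finite S \<and> S \<subseteq> B \<and> alg_over S x"
    using alg_over_finite_character[OF B] by metis
  then obtain S where S: "\<And>x. finite (S x)" "\<And>x. S x \<subseteq> B" "\<And>x. alg_over (S x) x" by metis
  define f where "f x = (S x, to_nat_on {y. alg_over (S x) y} x)" for x
  have "inj f"
  proof (rule injI)
    fix x y assume "f x = f y"
    then have eq: "S x = S y" "to_nat_on {z. alg_over (S x) z} x = to_nat_on {z. alg_over (S x) z} y"
      by (auto simp: f_def)
    have xy: "x \<in> {z. alg_over (S x) z}" "y \<in> {z. alg_over (S x) z}"
      using S(3)[of x] S(3)[of y] unfolding eq(1) by simp_all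
    have "countable {z. alg_over (S x) z}" by (intro countable_alg_over countable_finite S(1))
    from inj_onD[OF inj_on_to_nat_on[OF this] eq(2) xy] show "x = y" .
  qed
  moreover have "range f \<subseteq> Fpow B \<times> UNIV" using S by (auto simp: f_def Fpow_def)
  ultimately have "(UNIV :: 'a set) \<lesssim> Fpow B \<times> (UNIV :: nat set)"
    unfolding lepoll_def by blast
  also have "Fpow B \<times> (UNIV :: nat set) \<lesssim> B \<times> B"
    using eqpoll_Fpow[OF inf] inf
    by (intro times_lepoll_mono) (auto simp: infinite_le_lepoll eqpoll_imp_lepoll)
  also have "B \<times> B \<lesssim> B"
    using inf by (rule infinite_times_self_lepoll)
  finally show ?thesis .
qed

section \<open>Partial embedding of the complex numbers into Laurent series\<close>

lemma complex_lepoll_fls: "(UNIV :: complex set) \<lesssim> (UNIV :: rat fls set)"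
proof -
  have R: "(UNIV :: real set) \<lesssim> (UNIV :: nat set set)"
    using nat_sets_eqpoll_reals eqpoll_sym eqpoll_imp_lepoll by blast
  have "inj (\<lambda>z. (Re z, Im z))" by (auto simp: inj_def complex_eq_iff)
  then have "(UNIV :: complex set) \<lesssim> (UNIV :: real set) \<times> (UNIV :: real set)"
    unfolding lepoll_def by blast
  also have "(UNIV :: real set) \<times> (UNIV :: real set) \<lesssim> (UNIV :: real set)"
    by (rule infinite_times_self_lepoll) (rule infinite_UNIV_char_0)
  also note R
  also have "(UNIV :: nat set set) \<lesssim> (UNIV :: rat fls set)"
  proof -
    define f :: "nat set \<Rightarrow> rat fls" where "f A = fps_to_fls (Abs_fps (\<lambda>n. if n \<in> A then 1 else 0))" for A
    have "inj f"
    proof (rule injI)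
      fix A B assume "f A = f B"
      then have "Abs_fps (\<lambda>n. if n \<in> A then 1 else 0 :: rat) $ n = Abs_fps (\<lambda>n. if n \<in> B then 1 else 0) $ n" for n
        by (simp add: f_def)
      then have "n \<in> A \<longleftrightarrow> n \<in> B" for n unfolding fps_nth_Abs_fps by (metis zero_neq_one)
      then show "A = B" by blast
    qed
    then show ?thesis unfolding lepoll_def by blast
  qed
  finally show ?thesis .
qed

text \<open>Independent generators satisfy no relation, whatever field they lie in. By finite
  character, induction over finite sets suffices: over the empty set both components are the same
  rational number, and when a generator is added, a polynomial vanishes at it only if all its
  coefficients vanish, a condition controlled by the induction hypothesis.\<close>

lemma gen_graph_zero_iff:
  fixes B :: "'a::field_char_0 set" and C :: "'b::field_char_0 set"
  assumes B: "alg_indep B" and C: "alg_indep C" and t: "inj_on t B" "t ` B \<subseteq> C"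
    and xy: "(x, y) \<in> gen_graph ((\<lambda>b. (b, t b)) ` B)"
  shows "x = 0 \<longleftrightarrow> y = 0"
proof -
  have fin: "\<forall>x y. (x, y) \<in> gen_graph ((\<lambda>b. (b, t b)) ` A) \<longrightarrow> (x = 0 \<longleftrightarrow> y = 0)"
    if "finite A" "A \<subseteq> B" for A
    using that
  proof (induction A)
    case empty
    have "\<exists>q. x = of_rat q \<and> y = of_rat q" if "(x, y) \<in> gen_graph {}" for x :: 'a and y :: 'b
      using that
    proof (induction rule: gen_graph.induct)
      case one
      show ?case by (rule exI[of _ 1]) simp
    next
      case (add x y x' y')
      then show ?case by (metis of_rat_add)
    next
      case (uminus x y)
      then show ?case by (metis of_rat_minus)
    next
      case (mult x y x' y')
      then show ?case by (metis of_rat_mult)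
    next
      case (inverse x y)
      then show ?case by (metis of_rat_inverse)
    qed simp
    then show ?case by fastforce
  next
    case (insert b A)
    let ?R = "(\<lambda>b. (b, t b)) ` A"
    have fR: "fst ` ?R = A" "snd ` ?R = t ` A" by (auto simp: image_image)
    have A: "A \<subseteq> B - {b}" "t ` A \<subseteq> C - {t b}" "b \<in> B" "t b \<in> C"
      using insert.hyps insert.prems t unfolding inj_on_def by blast+
    have nb: "\<not> alg_over A b" "\<not> alg_over (t ` A) (t b)"
      using A B C alg_over_mono by (metis alg_indep_def)+
    have H: "poly p b = 0 \<longleftrightarrow> poly p' (t b) = 0" if pp: "poly_pair ?R p p'" for p p'
    proof -
      have "coeff p i = 0 \<longleftrightarrow> coeff p' i = 0" for i
        using insert.IH insert.prems pp by (auto simp: poly_pair_def)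
      then have z: "p = 0 \<longleftrightarrow> p' = 0" by (simp add: poly_eq_iff)
      have "\<forall>i. coeff p i \<in> gen_field A" "\<forall>i. coeff p' i \<in> gen_field (t ` A)"
        using pp gen_graph_fst[of _ _ ?R] gen_graph_snd[of _ _ ?R] unfolding fR poly_pair_def by blast+
      then have "poly p b = 0 \<longrightarrow> p = 0" "poly p' (t b) = 0 \<longrightarrow> p' = 0"
        using nb unfolding alg_over_def by blast+
      then show ?thesis using z by auto
    qed
    show ?case
    proof (intro allI impI)
      fix x y assume "(x, y) \<in> gen_graph ((\<lambda>b. (b, t b)) ` insert b A)"
      then have "(x, y) \<in> gen_graph (insert (b, t b) ?R)" by simp
      from gen_graph_insert_quotient[OF H this]
      show "x = 0 \<longleftrightarrow> y = 0" using H by (metis divide_eq_0_iff)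
    qed
  qed
  obtain R0 where R0: "finite R0" "R0 \<subseteq> (\<lambda>b. (b, t b)) ` B" "(x, y) \<in> gen_graph R0"
    using gen_graph_finite_character[OF xy] by blast
  obtain A where A: "A \<subseteq> B" "finite A" "R0 = (\<lambda>b. (b, t b)) ` A"
    using finite_subset_image[OF R0(1,2)] by blast
  show ?thesis using fin[OF A(2,1)] R0(3) unfolding A(3) by blast
qed

lemma of_rat_fls: "(of_rat q :: rat fls) = fls_const q"
proof -
  obtain a b where q: "q = of_int a / of_int b" by (metis Fract_of_int_quotient Rat_cases)
  have "(of_rat q :: rat fls) = of_int a / of_int b" by (simp only: q of_rat_divide of_rat_of_int_eq)
  also have "\<dots> = fls_const (of_int a / of_int b)" by (simp only: fls_of_int fls_const_divide_const)
  finally show ?thesis by (simp only: q)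
qed

lemma fls_pos_subdegree_minus_const:
  fixes w :: "'a::field fls"
  assumes "fls_subdegree w = 0" "w - fls_const (fls_nth w 0) \<noteq> 0"
  shows "fls_subdegree (w - fls_const (fls_nth w 0)) \<ge> 1"
proof (rule fls_subdegree_geI[OF assms(2)])
  fix k :: int assume "k < 1"
  then consider "k < 0" | "k = 0" by linarith
  then show "fls_nth (w - fls_const (fls_nth w 0)) k = 0"
    using assms(1) by cases auto
qed

text \<open>A basis of the complex numbers is mapped into a basis of the Laurent series. From the
  image of any basis element, inversion or subtraction of the constant term produces an element of
  positive order. The constant term is rational, so the subtraction has a counterpart in the complex
  numbers.\<close>

lemma complex_partial_embedding:
  obtains R :: "(complex \<times> rat fls) set" and T :: complex and w :: "rat fls"
  where "\<And>x y. (x, y) \<in> gen_graph R \<Longrightarrow> x = 0 \<longleftrightarrow> y = 0"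
    "\<And>x. alg_over (fst ` R) x" "(T, w) \<in> gen_graph R" "fls_subdegree w \<ge> 1"
proof -
  obtain B :: "complex set" where B: "alg_indep B" "\<And>x. alg_over B x"
    using transcendence_basis_exists by metis
  obtain C :: "rat fls set" where C: "alg_indep C" "\<And>x. alg_over C x"
    using transcendence_basis_exists by metis
  have unc: "uncountable (UNIV :: rat fls set)"
    using countable_lepoll[OF _ complex_lepoll_fls] uncountable_UNIV_complex by blast
  have "B \<lesssim> (UNIV :: complex set)" by (rule subset_imp_lepoll) simp
  also note complex_lepoll_fls
  also have "(UNIV :: rat fls set) \<lesssim> C" by (rule transcendence_basis_lepoll[OF C(2) unc])
  finally obtain t where t: "inj_on t B" "t ` B \<subseteq> C" by (auto simp: lepoll_def)
  define R where "R = (\<lambda>b. (b, t b)) ` B"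
  have zero: "x = 0 \<longleftrightarrow> y = 0" if "(x, y) \<in> gen_graph R" for x y
    using gen_graph_zero_iff[OF B(1) C(1) t that[unfolded R_def]] .
  have fR: "fst ` R = B" by (simp add: R_def image_image)
  have "B \<noteq> {}"
  proof
    assume "B = {}"
    then have "{x. alg_over {} x} = (UNIV :: complex set)" using B(2) by simp
    then show False
      using countable_alg_over[of "{} :: complex set"] uncountable_UNIV_complex by simp
  qed
  then obtain b where b: "b \<in> B" by blast
  then have bw: "(b, t b) \<in> gen_graph R" by (auto simp: R_def intro: gen_graph.base)
  have rat: "(of_rat q, of_rat q) \<in> gen_graph R" for q by (rule gen_graph_of_rat)
  have "\<exists>T w. (T, w) \<in> gen_graph R \<and> fls_subdegree w \<ge> 1"
  proof -
    consider "fls_subdegree (t b) \<ge> 1" | "fls_subdegree (t b) \<le> -1" | "fls_subdegree (t b) = 0" by linarith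
    then show ?thesis
    proof cases
      case 1
      then show ?thesis using bw by blast
    next
      case 2
      then have "fls_subdegree (inverse (t b)) \<ge> 1"
        using fls_inverse_subdegree[of "t b"] by linarith
      then show ?thesis using gen_graph.inverse[OF bw] by blast
    next
      case 3
      define c where "c = fls_nth (t b) 0"
      have "(b + - of_rat c, t b + - of_rat c) \<in> gen_graph R"
        by (rule gen_graph.add[OF bw gen_graph.uminus[OF rat]])
      then have d: "(b - of_rat c, t b - of_rat c) \<in> gen_graph R"
        by (simp only: diff_conv_add_uminus)
      have "of_rat c \<in> gen_field (B - {b})"
        using gen_graph_fst[OF gen_graph_of_rat[of c "(\<lambda>x. (x, x)) ` (B - {b})"]]
        by (simp add: image_image)
      then have "alg_over (B - {b}) (of_rat c)" by (rule alg_over_gen_field)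
      \<comment> \<open>Equality would make \<open>b\<close> algebraic over the other basis
        elements. So the difference is nonzero, and the zero criterion carries this over to the
        series.\<close>
      then have "b \<noteq> of_rat c" using B(1) b unfolding alg_indep_def by blast
      then have "t b - of_rat c \<noteq> 0" using zero[OF d] by simp
      moreover have "(of_rat c :: rat fls) = fls_const c" by (rule of_rat_fls)
      ultimately have "fls_subdegree (t b - of_rat c) \<ge> 1"
        using fls_pos_subdegree_minus_const[OF 3] by (simp add: c_def)
      then show ?thesis using d by blast
    qed
  qed
  then show thesis using that[of R] zero B(2) unfolding fR by blast
qed

section \<open>Valuation rings\<close>

definition is_subring :: "'a::comm_ring_1 set \<Rightarrow> bool" where
  "is_subring A \<longleftrightarrow> 1 \<in> A \<and> (\<forall>x\<in>A. \<forall>y\<in>A. x - y \<in> A \<and> x * y \<in> A)"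

lemma is_subringD:
  assumes "is_subring A"
  shows "1 \<in> A" "0 \<in> A" "x \<in> A \<Longrightarrow> - x \<in> A" "x \<in> A \<Longrightarrow> y \<in> A \<Longrightarrow> x - y \<in> A"
    "x \<in> A \<Longrightarrow> y \<in> A \<Longrightarrow> x + y \<in> A" "x \<in> A \<Longrightarrow> y \<in> A \<Longrightarrow> x * y \<in> A"
    "x \<in> A \<Longrightarrow> x ^ n \<in> A"
    "(\<And>i. i \<in> I \<Longrightarrow> f i \<in> A) \<Longrightarrow> sum f I \<in> A"
proof -
  show 1: "1 \<in> A" and d: "x \<in> A \<Longrightarrow> y \<in> A \<Longrightarrow> x - y \<in> A" and
    m: "x \<in> A \<Longrightarrow> y \<in> A \<Longrightarrow> x * y \<in> A" for x y
    using assms by (auto simp: is_subring_def)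
  show 0: "0 \<in> A" using d[OF 1 1] by simp
  show u: "x \<in> A \<Longrightarrow> - x \<in> A" for x using d[OF 0, of x] by simp
  show a: "x \<in> A \<Longrightarrow> y \<in> A \<Longrightarrow> x + y \<in> A" for x y using d[of x "- y"] u by simp
  show "x \<in> A \<Longrightarrow> x ^ n \<in> A" by (induction n) (auto intro: 1 m)
  show "(\<And>i. i \<in> I \<Longrightarrow> f i \<in> A) \<Longrightarrow> sum f I \<in> A"
    by (induction I rule: infinite_finite_induct) (auto intro: 0 a)
qed

definition adjoin :: "'a::comm_ring_1 set \<Rightarrow> 'a \<Rightarrow> 'a set" where
  "adjoin A x = {poly p x | p. \<forall>i. coeff p i \<in> A}"

lemma is_subring_adjoin:
  assumes A: "is_subring A"
  shows "is_subring (adjoin A x)"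
  unfolding is_subring_def
proof (intro conjI ballI)
  note r = is_subringD[OF A]
  show "1 \<in> adjoin A x" unfolding adjoin_def
    by (rule CollectI, rule exI[of _ "[:1:]"]) (auto simp: coeff_pCons r(1,2) split: nat.split)
  fix y z assume "y \<in> adjoin A x" "z \<in> adjoin A x"
  then obtain p q where p: "y = poly p x" "\<forall>i. coeff p i \<in> A" and q: "z = poly q x" "\<forall>i. coeff q i \<in> A"
    unfolding adjoin_def by blast
  have "\<forall>i. coeff (p - q) i \<in> A" using p q r(4) by simp
  moreover have "y - z = poly (p - q) x" using p q by simp
  ultimately show "y - z \<in> adjoin A x" unfolding adjoin_def by blast
  have "\<forall>i. coeff (p * q) i \<in> A" using p q unfolding coeff_mult by (blast intro: r(6,8))
  moreover have "y * z = poly (p * q) x" using p q by simp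
  ultimately show "y * z \<in> adjoin A x" unfolding adjoin_def by blast
qed

lemma subset_adjoin: "is_subring A \<Longrightarrow> A \<subseteq> adjoin A x"
proof
  fix y assume A: "is_subring A" and y: "y \<in> A"
  have "\<forall>i. coeff [:y:] i \<in> A" using y is_subringD(2)[OF A] by (auto simp: coeff_pCons split: nat.split)
  moreover have "y = poly [:y:] x" by simp
  ultimately show "y \<in> adjoin A x" unfolding adjoin_def by blast
qed

lemma mem_adjoin: "is_subring A \<Longrightarrow> x \<in> adjoin A x"
proof -
  assume A: "is_subring A"
  have "\<forall>i. coeff [:0, 1:] i \<in> A" using is_subringD(1,2)[OF A] by (auto simp: coeff_pCons split: nat.split)
  moreover have "x = poly [:0, 1:] x" by simp
  ultimately show ?thesis unfolding adjoin_def by blast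
qed

lemma maximal_subring_omitting:
  fixes A :: "'a::field set"
  assumes A: "is_subring A" and z: "z \<notin> A"
  shows "\<exists>M. is_subring M \<and> A \<subseteq> M \<and> z \<notin> M \<and>
    (\<forall>M'. is_subring M' \<and> M \<subseteq> M' \<and> z \<notin> M' \<longrightarrow> M' = M)"
proof -
  let ?S = "{M. is_subring M \<and> A \<subseteq> M \<and> z \<notin> M}"
  have "\<exists>M\<in>?S. \<forall>X\<in>?S. M \<subseteq> X \<longrightarrow> X = M"
  proof (rule subset_Zorn_nonempty)
    show "?S \<noteq> {}" using A z by blast
    fix C assume C0: "C \<noteq> {}" and C: "subset.chain ?S C"
    have sub: "is_subring X" "A \<subseteq> X" "z \<notin> X" if "X \<in> C" for X
      using that C by (auto simp: subset.chain_def)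
    have "is_subring (\<Union>C)"
      unfolding is_subring_def
    proof (intro conjI ballI)
      show "1 \<in> \<Union>C" using C0 sub is_subringD(1) by blast
      fix x y assume "x \<in> \<Union>C" "y \<in> \<Union>C"
      then obtain X Y where XY: "X \<in> C" "x \<in> X" "Y \<in> C" "y \<in> Y" by blast
      have "X \<subseteq> Y \<or> Y \<subseteq> X" using C XY by (auto simp: subset.chain_def)
      then obtain Z where Z: "Z \<in> C" "x \<in> Z" "y \<in> Z" using XY by blast
      then show "x - y \<in> \<Union>C" "x * y \<in> \<Union>C" using sub is_subringD(4,6) by blast+
    qed
    then show "\<Union>C \<in> ?S" using C0 sub by blast
  qed
  then obtain M where M: "M \<in> ?S" "\<forall>X\<in>?S. M \<subseteq> X \<longrightarrow> X = M" by (rule bexE)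
  from M(1) have "is_subring M \<and> A \<subseteq> M \<and> z \<notin> M" by simp
  moreover have "\<forall>M'. is_subring M' \<and> M \<subseteq> M' \<and> z \<notin> M' \<longrightarrow> M' = M"
    using M by blast
  ultimately show ?thesis by blast
qed

definition val_ring :: "'a::field set \<Rightarrow> bool" where
  "val_ring V \<longleftrightarrow> is_subring V \<and> (\<forall>x. x \<in> V \<or> inverse x \<in> V)"

text \<open>A subring that is maximal among those omitting the inverse of \<open>T\<close> is already a valuation ring:
  \<open>1 + T V\<close> consists of units, which is what the usual degree reduction needs.\<close>

lemma val_ring_exists:
  fixes A :: "'a::field set"
  assumes A: "is_subring A" "T \<in> A" "T \<noteq> 0" "inverse T \<notin> A"
  obtains V where "val_ring V" "A \<subseteq> V" "inverse T \<notin> V"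
proof -
  obtain V where V0: "is_subring V \<and> A \<subseteq> V \<and> inverse T \<notin> V \<and>
      (\<forall>M'. is_subring M' \<and> V \<subseteq> M' \<and> inverse T \<notin> M' \<longrightarrow> M' = V)"
    using maximal_subring_omitting[OF A(1,4)] ..
  then have V: "is_subring V" "A \<subseteq> V" "inverse T \<notin> V" by simp_all
  have mx: "M' = V" if "is_subring M'" "V \<subseteq> M'" "inverse T \<notin> M'" for M'
    using V0 that by blast
  note r = is_subringD[OF V(1)]
  have TV: "T \<in> V" using A V by blast
  have no1: "1 \<noteq> T * a" if "a \<in> V" for a
  proof
    assume "1 = T * a"
    then have "inverse T = a" using A(3) by (simp add: field_simps)
    then show False using V(3) that by simp
  qed
  have adj: "\<exists>a n. (\<forall>i. a i \<in> V) \<and> 1 = T * (\<Sum>i\<le>n. a i * x ^ i)" if "x \<notin> V" for x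
  proof -
    have "inverse T \<in> adjoin V x"
      using mx[OF is_subring_adjoin[OF V(1)] subset_adjoin[OF V(1)], of x] mem_adjoin[OF V(1), of x] that
      by blast
    then obtain p where p: "inverse T = poly p x" "\<forall>i. coeff p i \<in> V" unfolding adjoin_def by blast
    have "T * poly p x = 1" unfolding p(1)[symmetric] using A(3) by simp
    then show ?thesis using p(2) unfolding poly_altdef by metis
  qed
  \<comment> \<open>If \<open>u = 1 - T * b\<close> had no inverse in \<open>V\<close>, then 1 would
    be \<open>T\<close> times a polynomial in \<open>inverse u\<close>. Multiplication by
    \<open>u ^ n\<close> puts \<open>u ^ n\<close> into \<open>T V\<close>; but \<open>u ^ n\<close>
    is congruent to 1 modulo \<open>T V\<close>, so 1 itself would lie in \<open>T V\<close>, which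
    \<open>no1\<close> excludes.\<close>
  have unit: "inverse (1 - T * b) \<in> V" if b: "b \<in> V" for b
  proof (rule ccontr)
    define u where "u = 1 - T * b"
    have u0: "u \<noteq> 0" using no1[OF b] by (auto simp: u_def)
    assume "inverse (1 - T * b) \<notin> V"
    then obtain a n where a: "\<forall>i. a i \<in> V" "1 = T * (\<Sum>i\<le>n. a i * inverse u ^ i)"
      using adj unfolding u_def by blast
    have uV: "u \<in> V" unfolding u_def by (intro r(1,4,6) TV b)
    have "\<exists>c\<in>V. u ^ k = 1 - T * c" for k
    proof (induction k)
      case 0
      show ?case using r(2) by (intro bexI[of _ 0]) auto
    next
      case (Suc k)
      then obtain c where c: "c \<in> V" "u ^ k = 1 - T * c" by blast
      have "u ^ Suc k = (1 - T * b) * (1 - T * c)" unfolding power_Suc c(2) by (simp add: u_def)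
      also have "\<dots> = 1 - T * (c + b - T * b * c)" by (simp add: algebra_simps)
      finally have "u ^ Suc k = 1 - T * (c + b - T * b * c)" .
      moreover have "c + b - T * b * c \<in> V" by (intro r(4-6) TV b c(1))
      ultimately show ?case by blast
    qed
    then obtain c where c: "c \<in> V" "u ^ n = 1 - T * c" by blast
    have "u ^ n = T * (\<Sum>i\<le>n. a i * u ^ (n - i))"
    proof -
      have "u ^ n = u ^ n * (T * (\<Sum>i\<le>n. a i * inverse u ^ i))" using a(2) by simp
      also have "\<dots> = T * (\<Sum>i\<le>n. a i * (u ^ n * inverse u ^ i))"
        by (simp add: sum_distrib_left mult_ac)
      also have "(\<Sum>i\<le>n. a i * (u ^ n * inverse u ^ i)) = (\<Sum>i\<le>n. a i * u ^ (n - i))"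
        by (intro sum.cong) (use u0 in \<open>auto simp: power_diff power_inverse divide_inverse\<close>)
      finally show ?thesis .
    qed
    then have "1 = T * ((\<Sum>i\<le>n. a i * u ^ (n - i)) + c)" using c(2) by (simp add: algebra_simps)
    moreover have "(\<Sum>i\<le>n. a i * u ^ (n - i)) + c \<in> V" using a(1) uV c(1) by (auto intro!: r)
    ultimately show False using no1 by blast
  qed
  \<comment> \<open>That is, \<open>T\<close> generates the unit ideal in the ring obtained from
    \<open>V\<close> by adjoining \<open>x\<close>, by an expression of degree at most
    \<open>n\<close>.\<close>
  define L where "L n x \<longleftrightarrow> (\<exists>a. (\<forall>i. a i \<in> V) \<and> 1 = T * (\<Sum>i\<le>n. a i * x ^ i))" for n x
  \<comment> \<open>The relation for \<open>inverse x\<close> is divided by the unit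
    \<open>1 - T * b 0\<close> and multiplied by \<open>x ^ n\<close>. This expresses
    \<open>x ^ n\<close> by lower powers and so shortens a relation for \<open>x\<close> of minimal
    degree.\<close>
  have step: False if x0: "x \<noteq> 0" and n: "L n x" "\<And>k. L k x \<Longrightarrow> n \<le> k" and m: "L m (inverse x)" "m \<le> n" for x n m
  proof -
    obtain a where a: "\<And>i. a i \<in> V" "1 = T * (\<Sum>i\<le>n. a i * x ^ i)" using n by (auto simp: L_def)
    obtain b where b: "\<And>i. b i \<in> V" "1 = T * (\<Sum>i\<le>m. b i * inverse x ^ i)" using m by (auto simp: L_def)
    have "n \<noteq> 0" using a no1[of "a 0"] by (cases "n = 0") auto
    then obtain k where k: "n = Suc k" by (cases n) auto
    define u where "u = 1 - T * b 0"
    have u0: "u \<noteq> 0" using no1[OF b(1)[of 0]] by (auto simp: u_def)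
    have ui: "inverse u \<in> V" unfolding u_def by (rule unit[OF b(1)])
    define b' where "b' i = (if 1 \<le> i \<and> i \<le> m then b i else 0)" for i
    have b'V: "b' i \<in> V" for i using b(1) r(2) by (simp add: b'_def)
    have "(\<Sum>i\<le>m. b i * inverse x ^ i) = b 0 + (\<Sum>i\<in>{1..m}. b i * inverse x ^ i)"
      by (simp add: sum.atLeast1_atMost_eq sum.atMost_shift lessThan_Suc_atMost)
    also have "(\<Sum>i\<in>{1..m}. b i * inverse x ^ i) = (\<Sum>i\<in>{1..n}. b' i * inverse x ^ i)"
      by (intro sum.mono_neutral_cong_left) (use m(2) in \<open>auto simp: b'_def\<close>)
    finally have "u = T * (\<Sum>i\<in>{1..n}. b' i * inverse x ^ i)"
      using b(2) by (simp add: u_def algebra_simps)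
    then have "1 = T * inverse u * (\<Sum>i\<in>{1..n}. b' i * inverse x ^ i)"
      using u0 by (metis mult.assoc mult.commute right_inverse)
    then have "x ^ n = x ^ n * (T * inverse u * (\<Sum>i\<in>{1..n}. b' i * inverse x ^ i))" by simp
    also have "\<dots> = (\<Sum>i\<in>{1..n}. T * inverse u * b' i * (x ^ n * inverse x ^ i))"
      by (simp add: sum_distrib_left mult_ac)
    also have "\<dots> = (\<Sum>i\<in>{1..n}. T * inverse u * b' i * x ^ (n - i))"
      by (intro sum.cong) (use x0 in \<open>auto simp: power_diff power_inverse divide_inverse\<close>)
    also have "\<dots> = (\<Sum>i\<le>k. T * inverse u * b' (n - i) * x ^ i)"
      by (rule sum.reindex_bij_witness[of _ "\<lambda>i. n - i" "\<lambda>i. n - i"]) (auto simp: k)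
    finally have xn: "x ^ n = (\<Sum>i\<le>k. T * inverse u * b' (n - i) * x ^ i)" .
    have "1 = T * (\<Sum>i\<le>k. (a i + a n * (T * inverse u * b' (n - i))) * x ^ i)"
    proof -
      have "(\<Sum>i\<le>n. a i * x ^ i) = (\<Sum>i\<le>k. a i * x ^ i) + a n * x ^ n" by (simp add: k)
      also have "\<dots> = (\<Sum>i\<le>k. (a i + a n * (T * inverse u * b' (n - i))) * x ^ i)"
        unfolding xn by (simp add: sum_distrib_left sum.distrib algebra_simps)
      finally show ?thesis using a(2) by simp
    qed
    moreover have "a i + a n * (T * inverse u * b' (n - i)) \<in> V" for i
      by (intro r(5,6) a(1) TV ui b'V)
    ultimately have "L k x" unfolding L_def by (intro exI[of _ "\<lambda>i. a i + a n * (T * inverse u * b' (n - i))"]) blast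
    then show False using n(2) k by fastforce
  qed
  have "x \<in> V \<or> inverse x \<in> V" for x
  proof (rule ccontr)
    assume c: "\<not> (x \<in> V \<or> inverse x \<in> V)"
    then have x0: "x \<noteq> 0" using r(2) by auto
    define n m where "n = (LEAST n. L n x)" and "m = (LEAST n. L n (inverse x))"
    have ex: "\<exists>n. L n x" "\<exists>n. L n (inverse x)" using adj c unfolding L_def by blast+
    have n: "L n x" "\<And>k. L k x \<Longrightarrow> n \<le> k" unfolding n_def using ex(1) by (auto intro: LeastI_ex Least_le)
    have m: "L m (inverse x)" "\<And>k. L k (inverse x) \<Longrightarrow> m \<le> k"
      unfolding m_def using ex(2) by (auto intro: LeastI_ex Least_le)
    show False
    proof (cases "m \<le> n")
      case True
      then show False using step[OF x0 n m(1)] by blast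
    next
      case False
      then show False using step[of "inverse x" m n] x0 m n(1) by simp
    qed
  qed
  then have "val_ring V" using V(1) by (simp add: val_ring_def)
  then show thesis using V(2,3) by (rule that)
qed

text \<open>Applied to the terms of a polynomial at one of its roots, this shows that a power of an algebraic
  element has the value of an element of the base field.\<close>

lemma unit_ratio_exists:
  fixes t :: "'i \<Rightarrow> 'a::field"
  assumes V: "val_ring V" and fin: "finite I" and sum0: "(\<Sum>i\<in>I. t i) = 0" and ne: "\<exists>i\<in>I. t i \<noteq> 0"
  shows "\<exists>i\<in>I. \<exists>j\<in>I. i \<noteq> j \<and> t i \<noteq> 0 \<and> t j \<noteq> 0 \<and> t i / t j \<in> V \<and> t j / t i \<in> V"
proof -
  have sr: "is_subring V" and tot: "\<And>x. x \<in> V \<or> inverse x \<in> V" using V by (auto simp: val_ring_def)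
  note r = is_subringD[OF sr]
  define J where "J = {i \<in> I. t i \<noteq> 0}"
  have J: "finite J" "J \<noteq> {}" and J0: "\<And>j. j \<in> J \<Longrightarrow> t j \<noteq> 0"
    using fin ne by (auto simp: J_def)
  \<comment> \<open>A term of largest value exists because divisibility in a valuation ring is
    total.\<close>
  have "\<exists>i\<in>J. \<forall>j\<in>J. t j / t i \<in> V"
    using J J0
  proof (induction J rule: finite_ne_induct)
    case (singleton x)
    then show ?case using r(1) by simp
  next
    case (insert k F)
    then obtain i where i: "i \<in> F" "\<forall>j\<in>F. t j / t i \<in> V" by auto
    have n0: "t i \<noteq> 0" "t k \<noteq> 0" using insert.prems i by auto
    show ?case
    proof (cases "t k / t i \<in> V")
      case True
      then show ?thesis using i by blast
    next
      case False
      then have k: "t i / t k \<in> V" using tot[of "t k / t i"] by simp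
      have "t j / t k \<in> V" if "j \<in> F" for j
      proof -
        have "t j / t k = (t j / t i) * (t i / t k)" using n0 by simp
        then show ?thesis using i(2) that k r(6) by metis
      qed
      then show ?thesis using n0 r(1) by (intro bexI[of _ k]) auto
    qed
  qed
  then obtain i where i: "i \<in> J" "\<And>j. j \<in> J \<Longrightarrow> t j / t i \<in> V" by blast
  show ?thesis
  proof (rule ccontr)
    assume c: "\<not> ?thesis"
    \<comment> \<open>The maximal ideal of \<open>V\<close>; zero is listed separately because
      \<open>inverse 0 = 0\<close> lies in \<open>V\<close>. If no two terms had a unit ratio, the
      ratios of all other terms to the largest one would lie in \<open>m\<close>, although their sum
      is -1.\<close>
    define m where "m = {x \<in> V. x = 0 \<or> inverse x \<notin> V}"
    have m0: "0 \<in> m" using r(2) by (simp add: m_def)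
    have aux: "x + y \<in> m" if x: "x \<in> m" and y: "y \<in> m" and xy: "x / y \<in> V" and y0: "y \<noteq> 0" for x y
    proof -
      have V': "x + y \<in> V" using x y r(5) by (auto simp: m_def)
      have "inverse (x + y) \<notin> V" if s: "x + y \<noteq> 0"
      proof
        assume "inverse (x + y) \<in> V"
        then have "(x / y + 1) * inverse (x + y) \<in> V" using xy r(1,5,6) by metis
        moreover have "(x / y + 1) * inverse (x + y) = inverse y"
          using y0 s by (simp add: field_simps)
        ultimately show False using y y0 by (auto simp: m_def)
      qed
      then show ?thesis using V' by (auto simp: m_def)
    qed
    have madd: "x + y \<in> m" if x: "x \<in> m" and y: "y \<in> m" for x y
    proof (cases "x = 0 \<or> y = 0")
      case True
      then show ?thesis using x y by auto
    next
      case False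
      have "x / y \<in> V \<or> y / x \<in> V" using tot[of "x / y"] by simp
      then show ?thesis using aux[OF x y] aux[OF y x] False by (auto simp: add.commute)
    qed
    have "t j / t i \<in> m" if "j \<in> J - {i}" for j
    proof -
      have j: "j \<in> J" "j \<noteq> i" using that by auto
      have "t j / t i \<in> V" using i j by blast
      moreover have "inverse (t j / t i) \<notin> V"
      proof
        assume "inverse (t j / t i) \<in> V"
        then have "t i / t j \<in> V" by simp
        moreover have "i \<in> I" "j \<in> I" "t i \<noteq> 0" "t j \<noteq> 0" using i j by (auto simp: J_def)
        ultimately show False using c \<open>t j / t i \<in> V\<close> j(2) by metis
      qed
      ultimately show ?thesis by (simp add: m_def)
    qed
    then have "(\<Sum>j\<in>K. t j / t i) \<in> m" if "K \<subseteq> J - {i}" for K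
      using that by (induction K rule: infinite_finite_induct) (auto intro: m0 madd)
    then have "(\<Sum>j\<in>J - {i}. t j / t i) \<in> m" by blast
    moreover have "(\<Sum>j\<in>J - {i}. t j / t i) = -1"
    proof -
      have "(\<Sum>j\<in>J. t j) = (\<Sum>j\<in>I. t j)"
        by (rule sum.mono_neutral_left) (use fin in \<open>auto simp: J_def\<close>)
      with sum0 have "(\<Sum>j\<in>J. t j) = 0" by (simp only:)
      then have "(\<Sum>j\<in>J - {i}. t j) = - t i" using J(1) i(1) by (simp add: sum_diff1)
      then show ?thesis using J0[OF i(1)] by (simp flip: sum_divide_distrib)
    qed
    ultimately show False using r(1,3) by (auto simp: m_def)
  qed
qed

text \<open>Some power of \<open>x\<close> agrees with a power of \<open>T\<close> up to a unit, so
  \<open>x\<close> has a rational order, the quotient of the two exponents. It is well defined since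
  no nonzero power of \<open>T\<close> is a unit. The absolute value is 2 raised to minus the order,
  whence the countability of its range.\<close>

lemma real_valuation_exists:
  fixes V :: "'a::field set"
  assumes V: "val_ring V" and T: "T \<noteq> 0" "T \<in> V" "inverse T \<notin> V"
    and P: "\<And>x. x \<noteq> 0 \<Longrightarrow> \<exists>n p u. n > 0 \<and> u \<in> V \<and> inverse u \<in> V \<and> x ^ n = T powi p * u"
  obtains v :: "'a \<Rightarrow> real" where "v 0 = 0" "\<And>x. x \<noteq> 0 \<Longrightarrow> v x > 0" "\<And>x y. v (x * y) = v x * v y"
    "\<And>x y. v (x + y) \<le> max (v x) (v y)" "\<And>x. v x \<le> 1 \<longleftrightarrow> x \<in> V" "countable (range v)"
proof -
  have sr: "is_subring V" and tot: "\<And>x. x \<in> V \<or> inverse x \<in> V" using V by (auto simp: val_ring_def)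
  note r = is_subringD[OF sr]
  have T1: "inverse T ^ n \<notin> V" if "n > 0" for n
  proof
    assume n: "inverse T ^ n \<in> V"
    obtain k where k: "n = Suc k" using \<open>n > 0\<close> by (cases n) auto
    have "T ^ k * inverse T ^ n = inverse T" using T(1) by (simp add: k power_inverse field_simps)
    then show False using r(6)[OF r(7)[OF T(2), of k] n] T(3) by simp
  qed
  have unitT: "p = 0" if u: "T powi p = u" "u \<in> V" "inverse u \<in> V" for p u
  proof (rule ccontr)
    assume "p \<noteq> 0"
    then consider "p > 0" | "p < 0" by linarith
    then show False
    proof cases
      case 1
      then have "inverse T ^ nat p = inverse u" using u(1) by (simp add: power_int_def power_inverse)
      then show False using T1[of "nat p"] u(3) 1 by simp
    next
      case 2
      then have "inverse T ^ nat (-p) = u" using u(1) by (simp add: power_int_def)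
      then show False using T1[of "nat (-p)"] u(2) 2 by simp
    qed
  qed
  define rel where "rel x e \<longleftrightarrow> (\<exists>n p u. n > 0 \<and> u \<in> V \<and> inverse u \<in> V \<and> x ^ n = T powi p * u \<and>
    e = real_of_int p / real n \<and> u \<noteq> 0)" for x e
  have unique: "e = e'" if a: "rel x e" and b: "rel x e'" for x e e'
  proof -
    obtain n p u where 1: "n > 0" "u \<in> V" "inverse u \<in> V" "x ^ n = T powi p * u" "e = real_of_int p / real n" "u \<noteq> 0"
      using a by (auto simp: rel_def)
    obtain m q w where 2: "m > 0" "w \<in> V" "inverse w \<in> V" "x ^ m = T powi q * w" "e' = real_of_int q / real m" "w \<noteq> 0"
      using b by (auto simp: rel_def)
    note u0 = 1(6) 2(6)
    have "T powi (p * int m) * u ^ m = T powi (q * int n) * w ^ n"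
    proof -
      have "(x ^ n) ^ m = (x ^ m) ^ n" by (simp add: mult.commute flip: power_mult)
      then show ?thesis unfolding 1(4) 2(4) by (simp add: power_mult_distrib power_int_mult)
    qed
    then have "T powi (p * int m - q * int n) = w ^ n * inverse u ^ m"
      using u0 T(1) by (simp add: power_int_diff field_simps)
    moreover have "w ^ n * inverse u ^ m \<in> V" using 1 2 by (intro r(6,7))
    moreover have "inverse (w ^ n * inverse u ^ m) \<in> V"
    proof -
      have "inverse (w ^ n * inverse u ^ m) = inverse w ^ n * u ^ m"
        by (simp add: power_inverse)
      then show ?thesis using 1 2 by (metis r(6,7))
    qed
    ultimately have "p * int m - q * int n = 0" using unitT by blast
    then have "real_of_int (p * int m) = real_of_int (q * int n)" by simp
    then have "real_of_int p * real m = real_of_int q * real n" by simp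
    then show ?thesis unfolding 1(5) 2(5) using 1(1) 2(1) by (simp add: frac_eq_eq)
  qed
  have ex: "\<exists>e. rel x e" if x0: "x \<noteq> 0" for x
  proof -
    obtain n p u where n: "n > 0" "u \<in> V" "inverse u \<in> V" "x ^ n = T powi p * u" using P[OF x0] by blast
    then have "u \<noteq> 0" using x0 by auto
    with n show ?thesis unfolding rel_def by blast
  qed
  have relmult: "rel (x * y) (e + e')" if a: "rel x e" and b: "rel y e'" for x y e e'
  proof -
    obtain n p u where 1: "n > 0" "u \<in> V" "inverse u \<in> V" "x ^ n = T powi p * u" "e = real_of_int p / real n" "u \<noteq> 0"
      using a by (auto simp: rel_def)
    obtain m q w where 2: "m > 0" "w \<in> V" "inverse w \<in> V" "y ^ m = T powi q * w" "e' = real_of_int q / real m" "w \<noteq> 0"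
      using b by (auto simp: rel_def)
    have "(x * y) ^ (n * m) = (x ^ n) ^ m * (y ^ m) ^ n"
      by (simp add: power_mult_distrib mult.commute flip: power_mult)
    also have "\<dots> = T powi (p * int m + q * int n) * (u ^ m * w ^ n)"
      unfolding 1(4) 2(4) using T(1) by (simp add: power_mult_distrib power_int_mult power_int_add)
    finally have "(x * y) ^ (n * m) = T powi (p * int m + q * int n) * (u ^ m * w ^ n)" .
    moreover have "u ^ m * w ^ n \<in> V" using 1 2 by (intro r(6,7))
    moreover have "inverse (u ^ m * w ^ n) \<in> V"
      using r(6)[OF r(7)[OF 1(3), of m] r(7)[OF 2(3), of n]] by (simp add: power_inverse mult.commute)
    moreover have "e + e' = real_of_int (p * int m + q * int n) / real (n * m)"
      using 1 2 by (simp add: field_simps)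
    moreover have "n * m > 0" "u ^ m * w ^ n \<noteq> 0" using 1 2 by simp_all
    ultimately show ?thesis unfolding rel_def by blast
  qed
  define E where "E x = (THE e. rel x e)" for x
  have E: "rel x (E x)" if "x \<noteq> 0" for x
    unfolding E_def using ex[OF that] unique by (metis theI)
  have Emult: "E (x * y) = E x + E y" if "x \<noteq> 0" "y \<noteq> 0" for x y
    using unique[OF E relmult[OF E E]] that by simp
  have EV: "E x \<ge> 0 \<longleftrightarrow> x \<in> V" if x0: "x \<noteq> 0" for x
  proof -
    obtain n p u where 1: "n > 0" "u \<in> V" "inverse u \<in> V" "x ^ n = T powi p * u" "E x = real_of_int p / real n"
      using E[OF x0] by (auto simp: rel_def)
    have u0: "u \<noteq> 0" using 1 x0 by auto
    have "x ^ n \<in> V \<longleftrightarrow> x \<in> V"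
    proof
      assume xn: "x ^ n \<in> V"
      show "x \<in> V"
      proof (rule ccontr)
        assume "x \<notin> V"
        then have i: "inverse x \<in> V" using tot by blast
        obtain k where "n = Suc k" using 1(1) by (cases n) auto
        then have "x ^ n * inverse x ^ k = x" using x0 by (simp add: power_inverse)
        then show False using r(6)[OF xn r(7)[OF i, of k]] \<open>x \<notin> V\<close> by simp
      qed
    qed (rule r(7))
    moreover have "x ^ n \<in> V \<longleftrightarrow> p \<ge> 0"
    proof
      assume "p \<ge> 0"
      then have "x ^ n = T ^ nat p * u" using 1(4) by (simp add: power_int_def)
      then show "x ^ n \<in> V" using r(6)[OF r(7)[OF T(2)] 1(2)] by simp
    next
      assume xn: "x ^ n \<in> V"
      show "p \<ge> 0"
      proof (rule ccontr)
        assume "\<not> p \<ge> 0"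
        then have "inverse T ^ nat (- p) = x ^ n * inverse u" using 1(4) u0 by (simp add: power_int_def)
        then show False using T1[of "nat (- p)"] \<open>\<not> p \<ge> 0\<close> r(6)[OF xn 1(3)] by simp
      qed
    qed
    moreover have "E x \<ge> 0 \<longleftrightarrow> p \<ge> 0" using 1(1,5) by (simp add: zero_le_divide_iff)
    ultimately show ?thesis by simp
  qed
  define v where "v x = (if x = 0 then 0 else 2 powr (- E x))" for x
  have v0: "v 0 = 0" and vpos: "x \<noteq> 0 \<Longrightarrow> v x > 0" for x by (auto simp: v_def)
  have vm: "v (x * y) = v x * v y" for x y
    by (simp add: v_def Emult powr_add[symmetric])
  have vV: "v x \<le> 1 \<longleftrightarrow> x \<in> V" for x
  proof (cases "x = 0")
    case False
    have "v x \<le> 1 \<longleftrightarrow> 2 powr (- E x) \<le> 2 powr 0" using False by (simp add: v_def)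
    also have "\<dots> \<longleftrightarrow> E x \<ge> 0" by (subst powr_le_cancel_iff) auto
    finally show ?thesis using EV[OF False] by simp
  qed (simp add: v0 r(2))
  \<comment> \<open>Dividing by the larger element reduces the ultrametric inequality to the closure
    of \<open>V\<close> under adding 1.\<close>
  have tri: "v (x + y) \<le> v y" if "v x \<le> v y" "y \<noteq> 0" for x y
  proof -
    have "v (x / y) * v y = v x" using that(2) vm[of "x / y" y] by simp
    then have "v (x / y) \<le> 1"
      using that(1) vpos[OF that(2)] mult_le_cancel_right1[of "v y" "v (x / y)"]
      by (simp add: mult_le_cancel_right2 flip: \<open>v (x / y) * v y = v x\<close>)
    then have "v (x / y + 1) \<le> 1" using vV r(1,5) by blast
    then have "v (x / y + 1) * v y \<le> 1 * v y" using vpos[OF that(2)] by (intro mult_right_mono) auto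
    also have "v (x / y + 1) * v y = v (x + y)"
      unfolding vm[symmetric] using that(2) by (simp add: distrib_right)
    finally show ?thesis by simp
  qed
  have ultra: "v (x + y) \<le> max (v x) (v y)" for x y
  proof (cases "x = 0 \<or> y = 0")
    case True
    then show ?thesis using v0 by auto
  next
    case False
    then show ?thesis using tri[of x y] tri[of y x] by (cases "v x \<le> v y") (auto simp: add.commute)
  qed
  have "range v \<subseteq> insert 0 ((\<lambda>q. 2 powr (- of_rat q)) ` UNIV)"
  proof
    fix z assume "z \<in> range v"
    then obtain x where x: "z = v x" by blast
    show "z \<in> insert 0 ((\<lambda>q. 2 powr (- of_rat q)) ` UNIV)"
    proof (cases "x = 0")
      case False
      obtain n p where "E x = real_of_int p / real n" using E[OF False] by (auto simp: rel_def)
      then have "E x = of_rat (of_int p / of_nat n)" by (simp add: of_rat_divide)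
      then show ?thesis using x False unfolding v_def by (auto simp only: if_False)
    qed (simp add: x v0)
  qed
  then have "countable (range v)" by (rule countable_subset) simp
  then show thesis using that[of v] v0 vpos vm ultra vV by metis
qed

text \<open>\<open>vnat\<close> expresses residue characteristic zero and \<open>vbig\<close>
  nontriviality. The set \<open>D\<close> meets every ball of radius 1; together with
  \<open>vcount\<close>, and after rescaling, this leaves only countably many balls with radius in
  the value group.\<close>

locale valued_complex =
  fixes v :: "complex \<Rightarrow> real" and D :: "complex set"
  assumes v0 [simp]: "v 0 = 0" and vpos: "x \<noteq> 0 \<Longrightarrow> v x > 0" and vmult: "v (x * y) = v x * v y"
    and vadd: "v (x + y) \<le> max (v x) (v y)" and vnat: "n > 0 \<Longrightarrow> v (of_nat n) = 1"
    and vbig: "\<exists>x. v x > 1" and vcount: "countable (range v)"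
    and D: "countable D" "\<exists>d\<in>D. v (x - d) \<le> 1"

theorem valued_complex_exists: "\<exists>v D. valued_complex v D"
proof -
  obtain R :: "(complex \<times> rat fls) set" and T w where
    zero: "\<And>x y. (x, y) \<in> gen_graph R \<Longrightarrow> x = 0 \<longleftrightarrow> y = 0"
    and alg: "\<And>x. alg_over (fst ` R) x" and Tw: "(T, w) \<in> gen_graph R" and w: "fls_subdegree w \<ge> 1"
    by (rule complex_partial_embedding) (rule that)
  \<comment> \<open>The preimage of the ring of power series under the partial embedding; 0 is
    included because \<open>fls_subdegree 0 = 0\<close>.\<close>
  define A where "A = {x. \<exists>y. (x, y) \<in> gen_graph R \<and> fls_subdegree y \<ge> 0}"
  define F where "F = gen_field (fst ` R)"
  have FG: "\<exists>y. (x, y) \<in> gen_graph R" if "x \<in> F" for x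
    using gen_field_graph that unfolding F_def by blast
  have w0: "w \<noteq> 0" using w by auto
  then have T0: "T \<noteq> 0" using zero[OF Tw] by blast
  have sub_diff: "fls_subdegree (y - y') \<ge> 0" if "fls_subdegree y \<ge> 0" "fls_subdegree y' \<ge> 0" for y y' :: "rat fls"
    by (rule fls_subdegree_ge0I) (use that in simp)
  have sub_mult: "fls_subdegree (y * y') \<ge> 0" if "fls_subdegree y \<ge> 0" "fls_subdegree y' \<ge> 0" for y y' :: "rat fls"
    by (rule fls_mult_subdegree_ge_0[OF that])
  have A: "is_subring A"
    unfolding is_subring_def
  proof (intro conjI ballI)
    show "1 \<in> A" unfolding A_def using gen_graph.one by force
    fix x y assume "x \<in> A" "y \<in> A"
    then obtain x' y' where xy: "(x, x') \<in> gen_graph R" "fls_subdegree x' \<ge> 0"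
      "(y, y') \<in> gen_graph R" "fls_subdegree y' \<ge> 0" unfolding A_def by blast
    have "(x + - y, x' + - y') \<in> gen_graph R" by (rule gen_graph.add[OF xy(1) gen_graph.uminus[OF xy(3)]])
    then have "(x - y, x' - y') \<in> gen_graph R" by (simp only: diff_conv_add_uminus)
    then show "x - y \<in> A" using sub_diff[OF xy(2,4)] unfolding A_def by blast
    show "x * y \<in> A" using gen_graph.mult[OF xy(1,3)] sub_mult[OF xy(2,4)] unfolding A_def by blast
  qed
  have TA: "T \<in> A" using Tw w unfolding A_def by force
  have inj: "y = y'" if a: "(x, y) \<in> gen_graph R" "(x, y') \<in> gen_graph R" for x y y'
  proof -
    have "(x + - x, y + - y') \<in> gen_graph R" by (rule gen_graph.add[OF a(1) gen_graph.uminus[OF a(2)]])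
    from zero[OF this] have "y + - y' = 0" by simp
    then show ?thesis by simp
  qed
  have TA': "inverse T \<notin> A"
  proof
    assume "inverse T \<in> A"
    then obtain y where y: "(inverse T, y) \<in> gen_graph R" "fls_subdegree y \<ge> 0" unfolding A_def by blast
    then have "y = inverse w" using inj[OF _ gen_graph.inverse[OF Tw]] by blast
    then show False using y(2) w fls_inverse_subdegree[of w] by simp
  qed
  obtain V where V: "val_ring V" "A \<subseteq> V" "inverse T \<notin> V"
    by (rule val_ring_exists[OF A TA T0 TA'])
  have sr: "is_subring V" and tot: "\<And>x. x \<in> V \<or> inverse x \<in> V" using V(1) unfolding val_ring_def by blast+
  note r = is_subringD[OF sr]
  \<comment> \<open>The image \<open>w\<close> of \<open>T\<close> need not be a uniformizer. With
    \<open>n\<close> as its order, the power \<open>z ^ n\<close> of a nonzero element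
    \<open>z\<close> of the base field has order zero after division by a suitable power of
    \<open>T\<close>.\<close>
  define n where "n = nat (fls_subdegree w)"
  have n: "n > 0" "int n = fls_subdegree w" using w by (auto simp: n_def)
  have unitA: "x \<in> V \<and> inverse x \<in> V" if "(x, y) \<in> gen_graph R" "fls_subdegree y = 0" for x y
  proof -
    have "fls_subdegree (inverse y) = 0" using fls_inverse_subdegree[of y] that(2) by linarith
    then have "x \<in> A" "inverse x \<in> A"
      using that gen_graph.inverse[OF that(1)] unfolding A_def by force+
    then show ?thesis using V(2) by blast
  qed
  have graph_powi: "(x powi p, y powi p) \<in> gen_graph R" if "(x, y) \<in> gen_graph R" for x y and p :: int
    unfolding power_int_def
    using gen_graph_power[OF that] gen_graph_power[OF gen_graph.inverse[OF that]] by simp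
  have PF: "\<exists>p u. u \<in> V \<and> inverse u \<in> V \<and> z ^ n = T powi p * u" if z: "z \<in> F" "z \<noteq> 0" for z
  proof -
    obtain y where y: "(z, y) \<in> gen_graph R" using FG z(1) by blast
    then have y0: "y \<noteq> 0" using zero z(2) by blast
    let ?e = "fls_subdegree y"
    have "(z ^ n * T powi (- ?e), y ^ n * w powi (- ?e)) \<in> gen_graph R"
      by (intro gen_graph.mult gen_graph_power graph_powi y Tw)
    moreover have "fls_subdegree (y ^ n * w powi (- ?e)) = 0"
      using y0 w0 n(2) by (simp add: fls_subdegree_pow)
    ultimately have "z ^ n * T powi (- ?e) \<in> V \<and> inverse (z ^ n * T powi (- ?e)) \<in> V" by (rule unitA)
    moreover have "z ^ n = T powi ?e * (z ^ n * T powi (- ?e))"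
      using T0 by (simp add: power_int_minus field_simps)
    ultimately show ?thesis by blast
  qed
  have P: "\<exists>m p u. m > 0 \<and> u \<in> V \<and> inverse u \<in> V \<and> x ^ m = T powi p * u" if x: "x \<noteq> 0" for x
  proof -
    obtain p where p: "p \<noteq> 0" "\<And>i. coeff p i \<in> F" "poly p x = 0"
      using alg[of x] unfolding alg_over_def F_def by blast
    define t where "t i = coeff p i * x ^ i" for i
    have t0: "(\<Sum>i\<in>{..degree p}. t i) = 0" using p(3) by (simp add: poly_altdef t_def)
    have tn: "\<exists>i\<in>{..degree p}. t i \<noteq> 0" using p(1) x by (intro bexI[of _ "degree p"]) (auto simp: t_def)
    \<comment> \<open>Two terms of an equation for \<open>x\<close> differ by a unit factor.
      Cancelling the smaller power leaves a positive power of \<open>x\<close> equal to an element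
      of the base field times a unit.\<close>
    have ex: "\<exists>i j. i < j \<and> t i \<noteq> 0 \<and> t j \<noteq> 0 \<and> t j / t i \<in> V \<and> t i / t j \<in> V"
      using unit_ratio_exists[OF V(1) finite_atMost t0 tn] by (meson linorder_neqE_nat)
    then obtain i j where ij: "i < j" "t i \<noteq> 0" "t j \<noteq> 0" "t j / t i \<in> V" "t i / t j \<in> V" by blast
    define c where "c = coeff p i * inverse (coeff p j)"
    define d where "d = j - i"
    have d: "j = i + d" "d > 0" using ij(1) by (auto simp: d_def)
    have c0: "c \<noteq> 0" "c \<in> F"
      using ij(2,3) p(2) unfolding c_def t_def F_def by (auto intro: gen_field.mult gen_field.inverse)
    define u where "u = t j / t i"
    have u: "u \<in> V" "inverse u \<in> V" using ij(4,5) by (auto simp: u_def)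
    have xd: "x ^ d = c * u"
      using ij(2,3) x by (simp add: c_def u_def t_def d(1) power_add)
    obtain q u' where u': "u' \<in> V" "inverse u' \<in> V" "c ^ n = T powi q * u'" using PF[OF c0(2,1)] by blast
    have "x ^ (d * n) = T powi q * (u' * u ^ n)"
      by (simp add: power_mult xd power_mult_distrib u'(3))
    moreover have "u' * u ^ n \<in> V" by (intro r(6,7) u u')
    moreover have "inverse (u' * u ^ n) \<in> V"
      using r(6)[OF u'(2) r(7)[OF u(2), of n]] by (simp add: power_inverse mult.commute)
    moreover have "d * n > 0" using d n by simp
    ultimately show ?thesis by blast
  qed
  have TV: "T \<in> V" using TA V(2) by blast
  obtain v :: "complex \<Rightarrow> real" where v: "v 0 = 0" "\<And>x. x \<noteq> 0 \<Longrightarrow> v x > 0" "\<And>x y. v (x * y) = v x * v y"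
    "\<And>x y. v (x + y) \<le> max (v x) (v y)" "\<And>x. v x \<le> 1 \<longleftrightarrow> x \<in> V" "countable (range v)"
    by (rule real_valuation_exists[OF V(1) T0 TV V(3)]) (rule P, assumption, rule that)
  have v1: "v 1 = 1"
  proof -
    have "v 1 * v 1 = v 1 * 1" using v(3)[of 1 1] by simp
    then show ?thesis using v(2)[of 1] by (metis less_irrefl mult_cancel_left zero_neq_one)
  qed
  have vinv: "v (inverse x) = inverse (v x)" for x
  proof (cases "x = 0")
    case False
    then have "v (inverse x) * v x = 1" using v(3)[of "inverse x" x] v1 by simp
    then show ?thesis by (metis inverse_unique mult.commute)
  qed (simp add: v(1))
  have vpow: "v (x ^ k) = v x ^ k" for x k by (induction k) (simp_all add: v1 v(3))
  have vn: "v (of_nat k) = 1" if "k > 0" for k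
  proof -
    have "of_nat k \<in> V \<and> inverse (of_nat k :: complex) \<in> V"
      by (rule unitA[OF gen_graph_of_nat]) simp
    then have "v (of_nat k) \<le> 1" "inverse (v (of_nat k)) \<le> 1" using v(5) vinv by metis+
    moreover have "v (of_nat k) > 0" using v(2) that by simp
    ultimately show ?thesis by (simp add: inverse_le_1_iff)
  qed
  have vT: "v T < 1"
  proof -
    have "\<not> inverse (v T) \<le> 1" using v(5) V(3) vinv by metis
    then show ?thesis using v(2)[OF T0] by (simp add: inverse_le_1_iff)
  qed
  have vsum: "v (sum f I) \<le> B" if "finite I" "\<And>i. i \<in> I \<Longrightarrow> v (f i) \<le> B" "B \<ge> 0" for f :: "nat \<Rightarrow> complex" and I B
    using that
  proof (induction I rule: finite_induct)
    case (insert x I)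
    then show ?case using v(4)[of "f x" "sum f I"] by (auto simp: max_def split: if_splits intro: order_trans)
  qed (simp add: v(1))

  \<comment> \<open>The expansion between the exponents \<open>M\<close> and \<open>N\<close> is a
    datum of countable type, and \<open>pick\<close> selects one field element for each such
    datum.\<close>
  define key where "key y M N = (M, N, map (\<lambda>k. fls_nth y k) [M..N])" for y :: "rat fls" and M N :: int
  define pick where "pick k = (SOME x. \<exists>y. (x, y) \<in> gen_graph R \<and> fls_subdegree y \<ge> fst k \<and>
      key y (fst k) (fst (snd k)) = k)" for k :: "int \<times> int \<times> rat list"
  \<comment> \<open>The elements 0 and 1 are added to the approximants so that the approximating
    polynomials can stay monic of the same degree.\<close>
  define F0 where "F0 = insert 1 (insert 0 (range pick))"
  have cF0: "countable F0" unfolding F0_def by simp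
  have dense: "\<exists>z\<in>F0. v (x - z) \<le> e" if x: "x \<in> F" and e: "e > 0" for x e
  proof -
    obtain y where y: "(x, y) \<in> gen_graph R" using FG x by blast
    obtain m where m: "v T ^ m < e" using real_arch_pow_inv[OF e vT] by blast
    define M where "M = fls_subdegree y"
    \<comment> \<open>Since \<open>T\<close> has order \<open>n\<close>, a difference of order at
      least \<open>m * n\<close> is divisible by \<open>T ^ m\<close> in \<open>V\<close>.\<close>
    define N where "N = int (m * n)"
    let ?k = "key y M N"
    have "\<exists>z. \<exists>y'. (z, y') \<in> gen_graph R \<and> fls_subdegree y' \<ge> fst ?k \<and> key y' (fst ?k) (fst (snd ?k)) = ?k"
      using y by (intro exI[of _ x] exI[of _ y]) (simp add: key_def M_def)
    from someI_ex[OF this] obtain y' where y': "(pick ?k, y') \<in> gen_graph R" "fls_subdegree y' \<ge> M"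
      "key y' M N = key y M N" unfolding pick_def by (auto simp: key_def)
    have co: "fls_nth y' k = fls_nth y k" if "k < N" for k
    proof (cases "k < M")
      case True
      then show ?thesis using y'(2) by (simp add: M_def)
    next
      case False
      then have "k \<in> set [M..N]" using that by simp
      moreover have "map (fls_nth y') [M..N] = map (fls_nth y) [M..N]" using y'(3) by (simp add: key_def)
      ultimately show ?thesis by (simp only: map_eq_conv)
    qed
    have "(x + - pick ?k, y + - y') \<in> gen_graph R" by (rule gen_graph.add[OF y gen_graph.uminus[OF y'(1)]])
    then have d: "(x - pick ?k, y - y') \<in> gen_graph R" by (simp only: diff_conv_add_uminus)
    have "v (x - pick ?k) \<le> v T ^ m"
    proof (cases "y - y' = 0")
      case True
      then have "x - pick ?k = 0" using zero[OF d] by blast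
      then show ?thesis using v(1) v(2)[OF T0] by simp
    next
      case False
      have "fls_subdegree (y - y') \<ge> N" by (rule fls_subdegree_geI[OF False]) (simp add: co)
      then have "fls_subdegree ((y - y') * inverse w ^ m) \<ge> 0"
        using False w0 n(2) by (simp add: fls_subdegree_pow N_def)
      moreover have "((x - pick ?k) * inverse T ^ m, (y - y') * inverse w ^ m) \<in> gen_graph R"
        by (intro gen_graph.mult gen_graph_power gen_graph.inverse d Tw)
      ultimately have "(x - pick ?k) * inverse T ^ m \<in> V" using V(2) unfolding A_def by blast
      then have "v (x - pick ?k) * inverse (v T) ^ m \<le> 1" using v(5) v(3) vpow vinv by metis
      then show ?thesis using v(2)[OF T0] by (simp add: field_simps)
    qed
    then show ?thesis using m by (intro bexI[of _ "pick ?k"]) (auto simp: F0_def)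
  qed

  define D where "D = {x. \<exists>p. p \<noteq> 0 \<and> (\<forall>i. coeff p i \<in> F0) \<and> poly p x = 0}"
  have cD: "countable D" unfolding D_def by (rule countable_roots_polys[OF cF0])
  \<comment> \<open>Continuity of roots in its crudest form: a monic polynomial \<open>g\<close>
    close to an equation of \<open>x\<close> satisfies \<open>v (poly g x) \<le> 1\<close>. This
    value is the product of the values of \<open>x - y\<close> over the roots \<open>y\<close> of
    \<open>g\<close>, so one root is within distance 1 of \<open>x\<close>.\<close>
  have approx: "\<exists>d\<in>D. v (x - d) \<le> 1" for x
  proof -
    obtain q where q: "q \<noteq> 0" "\<And>i. coeff q i \<in> F" "poly q x = 0"
      using alg[of x] unfolding alg_over_def F_def by blast
    define d where "d = degree q"
    have d0: "d > 0" using q(1,3) by (metis d_def degree_eq_zeroE gr0I pCons_eq_0_iff poly_0 poly_const_conv)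
    define c where "c i = coeff q i * inverse (lead_coeff q)" for i
    have cF: "c i \<in> F" for i using q(2) unfolding c_def F_def by (intro gen_field.mult gen_field.inverse)
    have cd: "c d = 1" using q(1) by (simp add: c_def d_def)
    have cs: "(\<Sum>i\<le>d. c i * x ^ i) = 0"
    proof -
      have "(\<Sum>i\<le>d. c i * x ^ i) = poly q x * inverse (lead_coeff q)"
        by (simp add: c_def d_def poly_altdef sum_distrib_left mult_ac)
      then show ?thesis using q(3) by simp
    qed
    define B where "B = max 1 (v x)"
    have B: "B \<ge> 1" "v x \<le> B" by (auto simp: B_def)
    \<comment> \<open>The tolerance \<open>1 / B ^ d\<close> compensates for the factors
      \<open>x ^ i\<close>, whose values are at most \<open>B ^ d\<close>.\<close>
    have "\<exists>z. z \<in> F0 \<and> v (c i - z) \<le> 1 / B ^ d" for i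
      using dense[OF cF, of "1 / B ^ d" i] B(1) by (simp add: Bex_def)
    then have "\<forall>i. \<exists>z. z \<in> F0 \<and> v (c i - z) \<le> 1 / B ^ d" ..
    from choice[OF this] obtain z where z0: "\<forall>i. z i \<in> F0 \<and> v (c i - z i) \<le> 1 / B ^ d" ..
    then have z: "z i \<in> F0" "v (c i - z i) \<le> 1 / B ^ d" for i using spec[of _ i] by metis+
    define g where "g = monom 1 d + (\<Sum>i<d. monom (z i) i)"
    have cg: "coeff g k = (if k = d then 1 else if k < d then z k else 0)" for k
      unfolding g_def coeff_add coeff_sum coeff_monom by (simp add: sum.delta)
    have deg: "degree g = d"
      by (rule antisym[OF degree_le le_degree]) (auto simp: cg)
    have lead: "lead_coeff g = 1" by (simp add: deg cg)
    have g0: "g \<noteq> 0" using lead by auto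
    have gF: "coeff g k \<in> F0" for k using z(1) by (simp add: cg F0_def)
    have "poly g x = x ^ d + (\<Sum>i<d. z i * x ^ i)" by (simp add: g_def poly_sum poly_monom)
    also have "\<dots> = x ^ d + (\<Sum>i<d. z i * x ^ i) - (\<Sum>i\<le>d. c i * x ^ i)" by (simp add: cs)
    also have "\<dots> = (\<Sum>i<d. (z i - c i) * x ^ i)"
      by (simp add: lessThan_Suc_atMost[symmetric] cd sum_subtractf algebra_simps)
    finally have gx: "poly g x = (\<Sum>i<d. (z i - c i) * x ^ i)" .
    have vneg: "v (- y) = v y" for y
    proof -
      have "v (-1) * v (-1) = 1" using v(3)[of "-1" "-1"] v1 by simp
      then have "v (-1) = 1" using v(2)[of "-1"] by (auto simp: square_eq_1_iff)
      then show ?thesis using v(3)[of "-1" y] by simp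
    qed
    have "v (poly g x) \<le> 1"
      unfolding gx
    proof (rule vsum)
      fix i assume i: "i \<in> {..<d}"
      have "v ((z i - c i) * x ^ i) = v (c i - z i) * v x ^ i"
        using vneg[of "c i - z i"] by (simp add: v(3) vpow)
      also have "\<dots> \<le> 1 / B ^ d * B ^ d"
      proof (rule mult_mono)
        have vx: "0 \<le> v x" using v(1) v(2)[of x] by (cases "x = 0") auto
        have "v x ^ i \<le> B ^ i" using B(2) vx by (rule power_mono)
        also have "\<dots> \<le> B ^ d" using B(1) i by (intro power_increasing) auto
        finally show "v x ^ i \<le> B ^ d" .
        show "0 \<le> v x ^ i" using vx by simp
      qed (use z(2) B in auto)
      also have "\<dots> = 1" using B(1) by simp
      finally show "v ((z i - c i) * x ^ i) \<le> 1" .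
    qed auto
    moreover obtain Z where Z: "size Z = d" "g = (\<Prod>y\<in>#Z. [:-y, 1:])"
      using alg_closed_imp_factorization[OF g0] lead deg by auto
    have root: "y \<in> D" if "y \<in># Z" for y
    proof -
      have "poly g y = 0" unfolding Z(2) using that by (auto simp: poly_prod_mset prod_mset_zero_iff)
      then show ?thesis unfolding D_def using g0 gF by blast
    qed
    have "v (poly (\<Prod>y\<in>#Z'. [:-y, 1:]) x) > 1" if "Z' \<noteq> {#}" "\<And>y. y \<in># Z' \<Longrightarrow> v (x - y) > 1" for Z'
      using that
    proof (induction Z')
      case (add y Z')
      have s: "poly (\<Prod>y\<in>#add_mset y Z'. [:-y, 1:]) x = (x - y) * poly (\<Prod>y\<in>#Z'. [:-y, 1:]) x"
        by (simp add: algebra_simps)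
      have y: "v (x - y) > 1" using add.prems by simp
      show ?case
      proof (cases "Z' = {#}")
        case True
        then show ?thesis using y by simp
      next
        case False
        then have "v (poly (\<Prod>y\<in>#Z'. [:-y, 1:]) x) > 1" using add by simp
        then show ?thesis unfolding s v(3) using y less_1_mult by blast
      qed
    qed simp
    moreover have "Z \<noteq> {#}" using Z(1) d0 by auto
    ultimately have "\<exists>y\<in>#Z. v (x - y) \<le> 1" unfolding Z(2) by (meson not_le)
    then show ?thesis using root by blast
  qed
  have "\<exists>x. v x > 1"
  proof (rule exI[of _ "inverse T"])
    show "v (inverse T) > 1" using vT v(2)[OF T0] by (simp add: vinv one_less_inverse_iff)
  qed
  then have "valued_complex v D"
    unfolding valued_complex_def using v vn cD approx by blast
  then show ?thesis by blast
qed

section \<open>Tree kernels and their realization in Hilbert space\<close>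

definition quad_form :: "('a \<Rightarrow> 'a \<Rightarrow> real) \<Rightarrow> 'a set \<Rightarrow> ('a \<Rightarrow> real) \<Rightarrow> real" where
  "quad_form n S c = (\<Sum>x\<in>S. \<Sum>y\<in>S. c x * c y * n x y)"

text \<open>Subtracting its minimum from the kernel changes the form by a multiple of a square; afterwards the
  relation \<open>n x y > 0\<close> splits the set into smaller orthogonal blocks.\<close>

lemma ultrametric_kernel_pos:
  assumes "finite S"
    and "\<And>x y. x \<in> S \<Longrightarrow> y \<in> S \<Longrightarrow> n x y = n y x"
    and "\<And>x y. x \<in> S \<Longrightarrow> y \<in> S \<Longrightarrow> n x y \<ge> 0"
    and "\<And>x y z. x \<in> S \<Longrightarrow> y \<in> S \<Longrightarrow> z \<in> S \<Longrightarrow> min (n x z) (n z y) \<le> n x y"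
    and "\<And>x y. x \<in> S \<Longrightarrow> y \<in> S \<Longrightarrow> x \<noteq> y \<Longrightarrow> n x y < max (n x x) (n y y)"
  shows "quad_form n S c \<ge> 0 \<and> (quad_form n S c = 0 \<longrightarrow> (\<forall>x\<in>S. n x x > 0 \<longrightarrow> c x = 0))"
  using assms
proof (induction "card S" arbitrary: S n rule: less_induct)
  case less
  note fin = less.prems(1) and sym = less.prems(2) and nn = less.prems(3)
    and ultra = less.prems(4) and dist = less.prems(5)
  have zero_case: "quad_form m S c \<ge> 0 \<and> (quad_form m S c = 0 \<longrightarrow> (\<forall>x\<in>S. m x x > 0 \<longrightarrow> c x = 0))"
    if sym: "\<And>x y. x \<in> S \<Longrightarrow> y \<in> S \<Longrightarrow> m x y = m y x"
    and nn: "\<And>x y. x \<in> S \<Longrightarrow> y \<in> S \<Longrightarrow> m x y \<ge> 0"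
    and ultra: "\<And>x y z. x \<in> S \<Longrightarrow> y \<in> S \<Longrightarrow> z \<in> S \<Longrightarrow> min (m x z) (m z y) \<le> m x y"
    and dist: "\<And>x y. x \<in> S \<Longrightarrow> y \<in> S \<Longrightarrow> x \<noteq> y \<Longrightarrow> m x y < max (m x x) (m y y)"
    and x0: "x0 \<in> S" "y0 \<in> S" "m x0 y0 = 0" for m x0 y0
  proof (cases "S = {x0}")
    case True
    then show ?thesis using x0 by (simp add: quad_form_def)
  next
    case False
    have "\<exists>x y. x \<in> S \<and> y \<in> S \<and> x \<noteq> y \<and> m x y = 0"
    proof (cases "x0 = y0")
      case True
      obtain z where z: "z \<in> S" "z \<noteq> x0" using False x0 by blast
      have "min (m x0 z) (m z x0) \<le> m x0 x0" by (rule ultra) (use z x0 in auto)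
      then have "m x0 z \<le> 0" using sym[OF x0(1) z(1)] x0(3) True by simp
      then show ?thesis using nn[OF x0(1) z(1)] z x0 by force
    qed (use x0 in blast)
    then obtain x y where xy: "x \<in> S" "y \<in> S" "x \<noteq> y" "m x y = 0" by blast
    \<comment> \<open>The block of \<open>x\<close>. By the ultrametric inequality it is orthogonal
      to the rest, and \<open>y\<close> lies outside it, so both parts are smaller than
      \<open>S\<close>.\<close>
    define S1 where "S1 = {z \<in> S. z = x \<or> m x z > 0}"
    define S2 where "S2 = S - S1"
    have S: "S = S1 \<union> S2" "S1 \<inter> S2 = {}" "finite S1" "finite S2" "S1 \<subseteq> S" "S2 \<subseteq> S"
      using fin by (auto simp: S1_def S2_def)
    have "y \<notin> S1" "x \<notin> S2" using xy by (auto simp: S1_def S2_def)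
    then have card: "card S1 < card S" "card S2 < card S"
      using xy S(5,6) by (auto intro!: psubset_card_mono fin)
    have cross: "m z t = 0" if "z \<in> S1" "t \<in> S2" for z t
    proof -
      have zt: "z \<in> S" "t \<in> S" using that S by auto
      have t: "m x t = 0" "t \<noteq> x" using that zt nn[OF xy(1) zt(2)] by (auto simp: S1_def S2_def)
      show ?thesis
      proof (cases "z = x")
        case False
        then have "m x z > 0" using that by (auto simp: S1_def)
        moreover have "min (m x z) (m z t) \<le> m x t" by (rule ultra) (use xy zt in auto)
        ultimately show ?thesis using t nn[OF zt] by simp
      qed (use t in simp)
    qed
    have cross': "m t z = 0" if "z \<in> S1" "t \<in> S2" for z t
      using cross[OF that] sym[of t z] that S by auto
    have "quad_form m S c = (\<Sum>x\<in>S1 \<union> S2. \<Sum>y\<in>S1 \<union> S2. c x * c y * m x y)"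
      unfolding quad_form_def by (simp only: flip: S(1))
    also have "\<dots> = (\<Sum>x\<in>S1. \<Sum>y\<in>S1 \<union> S2. c x * c y * m x y) + (\<Sum>x\<in>S2. \<Sum>y\<in>S1 \<union> S2. c x * c y * m x y)"
      by (rule sum.union_disjoint) (use S in auto)
    also have "(\<Sum>x\<in>S1. \<Sum>y\<in>S1 \<union> S2. c x * c y * m x y) = quad_form m S1 c"
      unfolding quad_form_def
      by (intro sum.cong sum.mono_neutral_right) (use S cross in auto)
    also have "(\<Sum>x\<in>S2. \<Sum>y\<in>S1 \<union> S2. c x * c y * m x y) = quad_form m S2 c"
      unfolding quad_form_def
      by (intro sum.cong sum.mono_neutral_right) (use S cross' in auto)
    finally have Q: "quad_form m S c = quad_form m S1 c + quad_form m S2 c" .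
    have 1: "quad_form m S1 c \<ge> 0 \<and> (quad_form m S1 c = 0 \<longrightarrow> (\<forall>x\<in>S1. m x x > 0 \<longrightarrow> c x = 0))"
    proof (rule less.hyps[OF card(1) S(3)])
      have r: "x \<in> S" if "x \<in> S1" for x using that S(5) by blast
      show "m x y = m y x" if "x \<in> S1" "y \<in> S1" for x y by (rule sym[OF r[OF that(1)] r[OF that(2)]])
      show "m x y \<ge> 0" if "x \<in> S1" "y \<in> S1" for x y by (rule nn[OF r[OF that(1)] r[OF that(2)]])
      show "min (m x z) (m z y) \<le> m x y" if "x \<in> S1" "y \<in> S1" "z \<in> S1" for x y z
        by (rule ultra[OF r[OF that(1)] r[OF that(2)] r[OF that(3)]])
      show "m x y < max (m x x) (m y y)" if "x \<in> S1" "y \<in> S1" "x \<noteq> y" for x y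
        by (rule dist[OF r[OF that(1)] r[OF that(2)] that(3)])
    qed
    have 2: "quad_form m S2 c \<ge> 0 \<and> (quad_form m S2 c = 0 \<longrightarrow> (\<forall>x\<in>S2. m x x > 0 \<longrightarrow> c x = 0))"
    proof (rule less.hyps[OF card(2) S(4)])
      have r: "x \<in> S" if "x \<in> S2" for x using that S(6) by blast
      show "m x y = m y x" if "x \<in> S2" "y \<in> S2" for x y by (rule sym[OF r[OF that(1)] r[OF that(2)]])
      show "m x y \<ge> 0" if "x \<in> S2" "y \<in> S2" for x y by (rule nn[OF r[OF that(1)] r[OF that(2)]])
      show "min (m x z) (m z y) \<le> m x y" if "x \<in> S2" "y \<in> S2" "z \<in> S2" for x y z
        by (rule ultra[OF r[OF that(1)] r[OF that(2)] r[OF that(3)]])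
      show "m x y < max (m x x) (m y y)" if "x \<in> S2" "y \<in> S2" "x \<noteq> y" for x y
        by (rule dist[OF r[OF that(1)] r[OF that(2)] that(3)])
    qed
    show ?thesis
    proof (intro conjI impI)
      show "quad_form m S c \<ge> 0" using 1 2 Q by linarith
      assume "quad_form m S c = 0"
      then have "quad_form m S1 c = 0" "quad_form m S2 c = 0" using 1 2 Q by linarith+
      then show "\<forall>x\<in>S. m x x > 0 \<longrightarrow> c x = 0" using 1 2 S(1) by blast
    qed
  qed
  show ?case
  proof (cases "S = {}")
    case True
    then show ?thesis by (simp add: quad_form_def)
  next
    case False
    define A where "A = (\<lambda>(x, y). n x y) ` (S \<times> S)"
    have A: "finite A" "A \<noteq> {}" using fin False by (auto simp: A_def)
    define \<mu> where "\<mu> = Min A"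
    have mu_le: "\<mu> \<le> n x y" if "x \<in> S" "y \<in> S" for x y
      unfolding \<mu>_def by (rule Min_le) (use A that in \<open>auto simp: A_def\<close>)
    have "\<mu> \<in> A" unfolding \<mu>_def using A by (rule Min_in)
    then obtain x0 y0 where x0: "x0 \<in> S" "y0 \<in> S" "n x0 y0 = \<mu>" by (auto simp: A_def)
    have mu0: "\<mu> \<ge> 0" using x0 nn by force
    define m where "m x y = n x y - \<mu>" for x y
    have m: "quad_form m S c \<ge> 0 \<and> (quad_form m S c = 0 \<longrightarrow> (\<forall>x\<in>S. m x x > 0 \<longrightarrow> c x = 0))"
    proof (rule zero_case)
      show "m x y = m y x" if "x \<in> S" "y \<in> S" for x y using sym[OF that] by (simp add: m_def)
      show "m x y \<ge> 0" if "x \<in> S" "y \<in> S" for x y using mu_le[OF that] by (simp add: m_def)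
      show "min (m x z) (m z y) \<le> m x y" if "x \<in> S" "y \<in> S" "z \<in> S" for x y z
        using ultra[OF that] by (auto simp: m_def)
      show "m x y < max (m x x) (m y y)" if "x \<in> S" "y \<in> S" "x \<noteq> y" for x y
        using dist[OF that] by (auto simp: m_def)
      show "x0 \<in> S" "y0 \<in> S" "m x0 y0 = 0" using x0 by (auto simp: m_def)
    qed
    have Q: "quad_form n S c = quad_form m S c + \<mu> * (\<Sum>x\<in>S. c x)\<^sup>2"
    proof -
      have "(\<Sum>x\<in>S. c x)\<^sup>2 = (\<Sum>x\<in>S. \<Sum>y\<in>S. c x * c y)"
        by (simp add: power2_eq_square sum_product)
      then show ?thesis
        by (simp add: quad_form_def m_def sum_distrib_left sum.distrib[symmetric] algebra_simps)
    qed
    show ?thesis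
    proof (intro conjI impI)
      show "quad_form n S c \<ge> 0" using Q m mu0 by simp
      assume "quad_form n S c = 0"
      moreover have "\<mu> * (\<Sum>x\<in>S. c x)\<^sup>2 \<ge> 0" using mu0 by simp
      ultimately have q0: "quad_form m S c = 0" "\<mu> * (\<Sum>x\<in>S. c x)\<^sup>2 = 0" using Q m by linarith+
      then have c0: "\<forall>x\<in>S. m x x > 0 \<longrightarrow> c x = 0" using m by blast
      show "\<forall>x\<in>S. n x x > 0 \<longrightarrow> c x = 0"
      proof (cases "\<mu> = 0")
        case True
        then show ?thesis using c0 by (simp add: m_def)
      next
        case False
        \<comment> \<open>For a positive minimum the sum of the coefficients vanishes as well.
          Coefficients at points with diagonal value above the minimum are already zero; at most one
          other point exists, and its coefficient then equals the sum.\<close>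
        then have s0: "(\<Sum>x\<in>S. c x) = 0" using q0 by simp
        show ?thesis
        proof (intro ballI impI)
          fix x assume x: "x \<in> S"
          show "c x = 0"
          proof (cases "m x x > 0")
            case False
            then have nx: "n x x = \<mu>" using mu_le[OF x x] by (simp add: m_def)
            have "c y = 0" if "y \<in> S - {x}" for y
            proof -
              have y: "y \<in> S" "y \<noteq> x" using that by auto
              have "n x y < max (n x x) (n y y)" using dist[OF x y(1)] y(2) by blast
              then have "m y y > 0" using mu_le[OF x y(1)] nx by (auto simp: m_def)
              then show ?thesis using c0 y(1) by blast
            qed
            then have "(\<Sum>y\<in>S - {x}. c y) = 0" by simp
            then show ?thesis using s0 sum.remove[OF fin x, of c] by simp
          qed (use c0 x in blast)
        qed
      qed
    qed
  qed
qed

section \<open>Vectors with a prescribed Gram matrix\<close>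

lemma inner_sum_sum: "(\<Sum>i\<in>A. c i *\<^sub>R f i) \<bullet> (\<Sum>j\<in>B. d j *\<^sub>R g j) =
    (\<Sum>i\<in>A. \<Sum>j\<in>B. c i * d j * (f i \<bullet> g j))"
  by (simp only: inner_sum_left) (simp add: inner_sum_right sum_distrib_left mult_ac)

text \<open>A Gram-Schmidt step in reverse: \<open>u\<close> represents the prescribed inner
  products inside the old span, and a positive multiple of the new orthonormal vector
  \<open>E n\<close> supplies the missing length. Positivity of the form guarantees that some length
  is missing.\<close>

lemma gram_extend:
  fixes \<psi> E :: "nat \<Rightarrow> 'h::real_inner"
  assumes sym: "\<And>i j. N i j = N j i"
    and pos: "\<And>n c. \<exists>i<n. c i \<noteq> 0 \<Longrightarrow> quad_form N {..<n} c > 0"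
    and E: "\<And>i j. E i \<bullet> E j = (if i = j then 1 else 0)"
    and gram: "\<And>i j. i < n \<Longrightarrow> j < n \<Longrightarrow> \<psi> i \<bullet> \<psi> j = N i j"
    and sp: "span (\<psi> ` {..<n}) = span (E ` {..<n})"
  shows "\<exists>w. (\<forall>j<n. w \<bullet> \<psi> j = N n j) \<and> w \<bullet> w = N n n \<and>
    span (insert w (\<psi> ` {..<n})) = span (insert (E n) (E ` {..<n}))"
proof -
  have qf: "(\<Sum>i<n. c i *\<^sub>R \<psi> i) \<bullet> (\<Sum>i<n. c i *\<^sub>R \<psi> i) = quad_form N {..<n} c" for c
    by (simp add: inner_sum_sum quad_form_def gram)
  have inj: "inj_on \<psi> {..<n}"
  proof (rule inj_onI, rule ccontr)
    fix i j assume ij: "i \<in> {..<n}" "j \<in> {..<n}" "\<psi> i = \<psi> j" "i \<noteq> j"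
    define c :: "nat \<Rightarrow> real" where "c k = (if k = i then 1 else if k = j then -1 else 0)" for k
    have "(\<Sum>k<n. c k *\<^sub>R \<psi> k) = (\<Sum>k\<in>{i, j}. c k *\<^sub>R \<psi> k)"
      by (rule sum.mono_neutral_right) (use ij in \<open>auto simp: c_def\<close>)
    also have "\<dots> = 0" using ij by (simp add: c_def)
    finally have "quad_form N {..<n} c = 0" using qf[of c] by simp
    moreover have "\<exists>k<n. c k \<noteq> 0" using ij by (intro exI[of _ i]) (simp add: c_def)
    ultimately show False using pos by (metis less_irrefl)
  qed
  have ind: "independent (\<psi> ` {..<n})"
  proof
    assume "dependent (\<psi> ` {..<n})"
    then obtain u where u: "\<exists>v\<in>\<psi> ` {..<n}. u v \<noteq> 0" "(\<Sum>v\<in>\<psi> ` {..<n}. u v *\<^sub>R v) = 0"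
      by (auto simp: dependent_finite)
    have "(\<Sum>i<n. u (\<psi> i) *\<^sub>R \<psi> i) = 0"
      using u(2) by (simp add: sum.reindex[OF inj])
    then have "quad_form N {..<n} (\<lambda>i. u (\<psi> i)) = 0" using qf[of "\<lambda>i. u (\<psi> i)"] by simp
    moreover have "\<exists>i<n. u (\<psi> i) \<noteq> 0" using u(1) by auto
    ultimately show False using pos by (metis less_irrefl)
  qed
  obtain g :: "'h \<Rightarrow> real" where g: "linear g" "\<forall>x\<in>\<psi> ` {..<n}. g x = N n (inv_into {..<n} \<psi> x)"
    using linear_independent_extend[OF ind, of "\<lambda>x. N n (inv_into {..<n} \<psi> x)"] by blast
  have g\<psi>: "g (\<psi> j) = N n j" if "j < n" for j
    using g(2) that inv_into_f_f[OF inj] by auto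
  define u where "u = (\<Sum>i<n. g (E i) *\<^sub>R E i)"
  have uE: "u \<bullet> E j = g (E j)" if "j < n" for j
    using that by (simp add: u_def inner_sum_left E if_distrib sum.delta cong: if_cong)
  have ug: "u \<bullet> x = g x" if "x \<in> span (E ` {..<n})" for x
  proof (rule linear_eq_on_span[of "\<lambda>x. u \<bullet> x" g, OF _ g(1) _ that])
    show "linear ((\<bullet>) u)" by (simp add: bounded_linear.linear bounded_linear_inner_right)
    show "u \<bullet> y = g y" if "y \<in> E ` {..<n}" for y using uE that by auto
  qed
  have u\<psi>: "u \<bullet> \<psi> j = N n j" if "j < n" for j
  proof -
    have "\<psi> j \<in> span (E ` {..<n})" unfolding sp[symmetric] using that by (auto intro: span_base)
    then show ?thesis using ug g\<psi>[OF that] by simp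
  qed
  have uspan: "u \<in> span (E ` {..<n})"
    unfolding u_def by (intro span_sum span_scale span_base) auto
  have En: "E n \<bullet> x = 0" if "x \<in> span (E ` {..<n})" for x
  proof (rule linear_eq_on_span[of "\<lambda>x. E n \<bullet> x" "\<lambda>_. 0", OF _ _ _ that])
    show "linear ((\<bullet>) (E n))" by (simp add: bounded_linear.linear bounded_linear_inner_right)
    show "linear (\<lambda>_. 0 :: real)" by (simp add: linear_zero)
    show "E n \<bullet> y = 0" if "y \<in> E ` {..<n}" for y using E that by auto
  qed
  have pos_n: "N n n - u \<bullet> u > 0"
  proof -
    have "u \<in> span (\<psi> ` {..<n})" using uspan sp by simp
    then obtain a where a: "u = (\<Sum>x\<in>\<psi> ` {..<n}. a x *\<^sub>R x)"
      by (auto simp: span_finite)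
    then have a': "u = (\<Sum>i<n. a (\<psi> i) *\<^sub>R \<psi> i)" by (simp add: sum.reindex[OF inj])
    \<comment> \<open>With the coefficient -1 at \<open>n\<close>, this describes \<open>u\<close>
      minus the vector \<open>w\<close> to be constructed. The form takes the value
      \<open>N n n - u \<bullet> u\<close> on it, which is therefore positive.\<close>
    define c where "c i = (if i < n then a (\<psi> i) else -1)" for i
    have uc: "u = (\<Sum>i<n. c i *\<^sub>R \<psi> i)" unfolding a' by (rule sum.cong) (auto simp: c_def)
    have uu: "u \<bullet> u = (\<Sum>i<n. c i * N n i)"
    proof -
      have "u \<bullet> u = (\<Sum>i<n. c i * (u \<bullet> \<psi> i))" by (subst (2) uc) (simp add: inner_sum_right)
      then show ?thesis by (simp add: u\<psi>)
    qed
    have "\<exists>i<Suc n. c i \<noteq> 0" by (rule exI[of _ n]) (simp add: c_def)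
    then have "quad_form N {..<Suc n} c > 0" by (rule pos)
    also have "quad_form N {..<Suc n} c = quad_form N {..<n} c + 2 * c n * (\<Sum>i<n. c i * N n i) + c n * c n * N n n"
    proof -
      have "(\<Sum>i<n. c i * c n * N i n) = c n * (\<Sum>i<n. c i * N n i)"
        unfolding sum_distrib_left by (intro sum.cong refl) (simp add: sym[of n])
      moreover have "(\<Sum>i<n. c n * c i * N n i) = c n * (\<Sum>i<n. c i * N n i)"
        unfolding sum_distrib_left by (simp add: mult.assoc)
      ultimately show ?thesis by (simp add: quad_form_def sum.distrib)
    qed
    also have "\<dots> = N n n - u \<bullet> u" using qf[of c] uu by (simp add: uc[symmetric]) (simp add: c_def)
    finally show ?thesis .
  qed
  define s where "s = sqrt (N n n - u \<bullet> u)"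
  have s: "s > 0" "s * s = N n n - u \<bullet> u" using pos_n by (auto simp: s_def)
  define w where "w = u + s *\<^sub>R E n"
  have "w \<bullet> \<psi> j = N n j" if "j < n" for j
  proof -
    have "\<psi> j \<in> span (E ` {..<n})" unfolding sp[symmetric] using that by (auto intro: span_base)
    then show ?thesis using En u\<psi>[OF that] by (simp add: w_def inner_add_left)
  qed
  moreover have "w \<bullet> w = N n n"
    using En[OF uspan] s(2) E[of n n] by (simp add: w_def inner_add_left inner_add_right inner_commute)
  moreover have "span (insert w (\<psi> ` {..<n})) = span (insert (E n) (E ` {..<n}))"
  proof -
    have sub: "span (E ` {..<n}) \<subseteq> span (insert (E n) (E ` {..<n}))" "span (\<psi> ` {..<n}) \<subseteq> span (insert w (\<psi> ` {..<n}))"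
      by (intro span_mono; blast)+
    have w: "w \<in> span (insert (E n) (E ` {..<n}))"
      unfolding w_def using uspan sub by (intro span_add span_scale) (auto intro: span_base)
    have "E n = (1 / s) *\<^sub>R (w - u)" using s(1) by (simp add: w_def)
    moreover have "u \<in> span (insert w (\<psi> ` {..<n}))" using uspan sp sub by blast
    ultimately have E': "E n \<in> span (insert w (\<psi> ` {..<n}))"
      by (metis insertI1 span_base span_diff span_scale)
    show ?thesis
    proof
      have "\<psi> ` {..<n} \<subseteq> span (insert (E n) (E ` {..<n}))" using sub(1) span_superset[of "\<psi> ` {..<n}"] sp by blast
      then show "span (insert w (\<psi> ` {..<n})) \<subseteq> span (insert (E n) (E ` {..<n}))"
        using w by (intro span_minimal) auto
      have "E ` {..<n} \<subseteq> span (insert w (\<psi> ` {..<n}))" using sub(2) span_superset[of "E ` {..<n}"] sp by blast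
      then show "span (insert (E n) (E ` {..<n})) \<subseteq> span (insert w (\<psi> ` {..<n}))"
        using E' by (intro span_minimal) auto
    qed
  qed
  ultimately show ?thesis by blast
qed

text \<open>The vectors are triangular with respect to the orthonormal sequence, so the spans agree
  at each stage. Density in the given Hilbert space is thus inherited from the sequence, without
  identifying that space with an abstract completion.\<close>

lemma gram_realization:
  fixes E :: "nat \<Rightarrow> 'h::real_inner" and N :: "nat \<Rightarrow> nat \<Rightarrow> real"
  assumes sym: "\<And>i j. N i j = N j i"
    and pos: "\<And>n c. \<exists>i<n. c i \<noteq> 0 \<Longrightarrow> quad_form N {..<n} c > 0"
    and E: "\<And>i j. E i \<bullet> E j = (if i = j then 1 else 0)"
  shows "\<exists>\<phi>. (\<forall>i j. \<phi> i \<bullet> \<phi> j = N i j) \<and> span (range \<phi>) = span (range E)"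
proof -
  define P where "P n \<psi> \<longleftrightarrow> (\<forall>i<n. \<forall>j<n. \<psi> i \<bullet> \<psi> j = N i j) \<and>
    span (\<psi> ` {..<n}) = span (E ` {..<n})" for n and \<psi> :: "nat \<Rightarrow> 'h"
  have "\<exists>F. \<forall>n. P n (F n) \<and> (\<forall>i<n. F (Suc n) i = F n i)"
  proof (rule dependent_nat_choice)
    show "\<exists>\<psi>. P 0 \<psi>" by (simp add: P_def)
    fix \<psi> n assume \<psi>: "P n \<psi>"
    then obtain w where w: "\<forall>j<n. w \<bullet> \<psi> j = N n j" "w \<bullet> w = N n n"
      "span (insert w (\<psi> ` {..<n})) = span (insert (E n) (E ` {..<n}))"
      using gram_extend[OF sym pos E, of n \<psi>] unfolding P_def by blast
    define \<psi>' where "\<psi>' = \<psi>(n := w)"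
    have "\<psi>' i \<bullet> \<psi>' j = N i j" if "i < Suc n" "j < Suc n" for i j
      using that \<psi> w sym[of j n] sym[of i n] unfolding \<psi>'_def P_def
      by (auto simp: less_Suc_eq inner_commute)
    moreover have "\<psi>' ` {..<Suc n} = insert w (\<psi> ` {..<n})"
      by (auto simp: \<psi>'_def lessThan_Suc)
    ultimately have "P (Suc n) \<psi>'" using w(3) by (simp add: P_def lessThan_Suc)
    then show "\<exists>\<psi>'. P (Suc n) \<psi>' \<and> (\<forall>i<n. \<psi>' i = \<psi> i)"
      by (intro exI[of _ \<psi>']) (simp add: \<psi>'_def)
  qed
  then obtain F where F: "\<And>n. P n (F n)" "\<And>n i. i < n \<Longrightarrow> F (Suc n) i = F n i" by blast
  define \<phi> where "\<phi> i = F (Suc i) i" for i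
  have F\<phi>: "F n i = \<phi> i" if "i < n" for n i
    using that
  proof (induction n)
    case (Suc n)
    then show ?case using F(2)[of i n] by (cases "i = n") (auto simp: \<phi>_def)
  qed simp
  have "\<phi> i \<bullet> \<phi> j = N i j" for i j
  proof -
    define k where "k = Suc (max i j)"
    have k: "i < k" "j < k" by (auto simp: k_def)
    then have "F k i \<bullet> F k j = N i j" using F(1)[of k] unfolding P_def by blast
    then show ?thesis using F\<phi>[OF k(1)] F\<phi>[OF k(2)] by simp
  qed
  moreover have sp: "span (\<phi> ` {..<n}) = span (E ` {..<n})" for n
  proof -
    have "\<phi> ` {..<n} = F n ` {..<n}" using F\<phi> by auto
    then show ?thesis using F(1)[of n] by (simp add: P_def)
  qed
  have sub: "range f \<subseteq> span (range g)" if "\<And>n. span (f ` {..<n}) = span (g ` {..<n})" for f g :: "nat \<Rightarrow> 'h"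
  proof
    fix x assume "x \<in> range f"
    then obtain i where "x = f i" by blast
    then have "x \<in> span (f ` {..<Suc i})" by (auto intro: span_base)
    then have "x \<in> span (g ` {..<Suc i})" using that by simp
    then show "x \<in> span (range g)" using span_mono[of "g ` {..<Suc i}" "range g"] by blast
  qed
  have "span (range \<phi>) = span (range E)"
    using span_minimal[OF sub[OF sp] subspace_span] span_minimal[OF sub[OF sp[symmetric]] subspace_span]
    by blast
  ultimately show ?thesis by blast
qed

lemma hilbert_basis_sequence:
  assumes "\<exists>S :: 'h::{real_inner, banach} set. hilbert_basis S \<and> countable S \<and> infinite S"
  obtains E :: "nat \<Rightarrow> 'h::{real_inner, banach}" where "\<And>i j. E i \<bullet> E j = (if i = j then 1 else 0)"
    "closure (span (range E)) = UNIV"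
proof -
  obtain S :: "'h set" where S: "pairwise orthogonal S" "\<forall>x\<in>S. norm x = 1" "closure (span S) = UNIV"
    "countable S" "infinite S" using assms unfolding hilbert_basis_def by blast
  define E where "E = from_nat_into S"
  have bij: "bij_betw E UNIV S" unfolding E_def by (rule bij_betw_from_nat_into[OF S(4,5)])
  have ES: "E i \<in> S" for i using bij by (auto simp: bij_betw_def)
  show thesis
  proof (rule that[of E])
    show "E i \<bullet> E j = (if i = j then 1 else 0)" for i j
    proof (cases "i = j")
      case True
      have "norm (E i) = 1" using S(2) ES by blast
      then show ?thesis using True by (simp add: norm_eq_1)
    next
      case False
      then have "E i \<noteq> E j" using bij by (auto simp: bij_betw_def inj_on_def)
      then have "orthogonal (E i) (E j)" using S(1) ES by (auto simp: pairwise_def)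
      then show ?thesis using False by (simp add: orthogonal_def)
    qed
    show "closure (span (range E)) = UNIV" using S(3) bij by (simp add: bij_betw_def)
  qed
qed

text \<open>Tree metrics in multiplicative form: for \<open>\<kappa> = c ^ d\<close> the inequality
  \<open>four_point\<close> is the four-point condition of \<open>d\<close>. Several points of
  \<open>X\<close> may represent one vertex, namely when \<open>\<kappa> x y = 1\<close>.\<close>

locale tree_kernel =
  fixes X :: "'g set" and \<kappa> :: "'g \<Rightarrow> 'g \<Rightarrow> real" and e :: 'g
  assumes base: "e \<in> X"
    and sym: "x \<in> X \<Longrightarrow> y \<in> X \<Longrightarrow> \<kappa> x y = \<kappa> y x"
    and diag: "x \<in> X \<Longrightarrow> \<kappa> x x = 1"
    and nonneg: "x \<in> X \<Longrightarrow> y \<in> X \<Longrightarrow> \<kappa> x y \<ge> 0"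
    and four_point: "x \<in> X \<Longrightarrow> y \<in> X \<Longrightarrow> z \<in> X \<Longrightarrow> w \<in> X \<Longrightarrow>
      \<kappa> x y * \<kappa> w z \<le> max (\<kappa> x z * \<kappa> w y) (\<kappa> z y * \<kappa> w x)"
begin

lemma submult: "x \<in> X \<Longrightarrow> y \<in> X \<Longrightarrow> z \<in> X \<Longrightarrow> \<kappa> x y \<le> \<kappa> x z * \<kappa> z y"
  using four_point[of x y z z] diag[of z] sym[of x z] by (simp add: mult.commute)

lemma ge1: "x \<in> X \<Longrightarrow> y \<in> X \<Longrightarrow> \<kappa> x y \<ge> 1"
proof (rule ccontr)
  assume xy: "x \<in> X" "y \<in> X" "\<not> \<kappa> x y \<ge> 1"
  have "1 \<le> \<kappa> x y * \<kappa> x y" using submult[of x x y] diag sym xy by simp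
  moreover have "\<kappa> x y * \<kappa> x y \<le> \<kappa> x y * 1" by (rule mult_left_mono) (use xy nonneg in auto)
  ultimately show False using xy by simp
qed

lemma equiv_cong:
  assumes "x \<in> X" "y \<in> X" "z \<in> X" "\<kappa> x y = 1"
  shows "\<kappa> x z = \<kappa> y z"
  using submult[of x z y] submult[of y z x] sym[of x y] assms by simp

text \<open>If \<open>\<kappa> = c ^ d\<close> for a tree metric \<open>d\<close>, this is \<open>1 - c ^ (- 2 g)\<close> with the Gromov product \<open>g\<close> at
  the base point, so it inherits the ultrametric inequality of Gromov products.\<close>

definition nker :: "'g \<Rightarrow> 'g \<Rightarrow> real" where
  "nker x y = 1 - \<kappa> x y / (\<kappa> e x * \<kappa> e y)"

lemma pos: "x \<in> X \<Longrightarrow> y \<in> X \<Longrightarrow> \<kappa> x y > 0"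
  using ge1[of x y] by simp

lemma nker_sym: "x \<in> X \<Longrightarrow> y \<in> X \<Longrightarrow> nker x y = nker y x"
  by (simp add: nker_def sym[of x y] mult.commute)

lemma nker_nonneg: "x \<in> X \<Longrightarrow> y \<in> X \<Longrightarrow> nker x y \<ge> 0"
  using submult[of x y e] sym[of x e] base pos[of e x] pos[of e y] by (simp add: nker_def divide_le_eq_1)

lemma nker_ultra:
  assumes x: "x \<in> X" and y: "y \<in> X" and z: "z \<in> X"
  shows "min (nker x z) (nker z y) \<le> nker x y"
proof -
  have p: "\<kappa> e x > 0" "\<kappa> e y > 0" "\<kappa> e z > 0" using pos base x y z by auto
  let ?s = "\<lambda>x y. \<kappa> x y / (\<kappa> e x * \<kappa> e y)"
  have s: "?s x y = \<kappa> x y * \<kappa> e z / (\<kappa> e x * \<kappa> e y * \<kappa> e z)"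
    "?s x z = \<kappa> x z * \<kappa> e y / (\<kappa> e x * \<kappa> e y * \<kappa> e z)"
    "?s z y = \<kappa> z y * \<kappa> e x / (\<kappa> e x * \<kappa> e y * \<kappa> e z)" using p by simp_all
  have "\<kappa> x y * \<kappa> e z \<le> \<kappa> x z * \<kappa> e y \<or> \<kappa> x y * \<kappa> e z \<le> \<kappa> z y * \<kappa> e x"
    using four_point[OF x y z base] by (simp add: le_max_iff_disj)
  then have "?s x y \<le> ?s x z \<or> ?s x y \<le> ?s z y"
  proof
    assume "\<kappa> x y * \<kappa> e z \<le> \<kappa> x z * \<kappa> e y"
    then show ?thesis unfolding s by (intro disjI1 divide_right_mono) (use p in auto)
  next
    assume "\<kappa> x y * \<kappa> e z \<le> \<kappa> z y * \<kappa> e x"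
    then show ?thesis unfolding s by (intro disjI2 divide_right_mono) (use p in auto)
  qed
  then show ?thesis unfolding nker_def by linarith
qed

text \<open>The point that is farther from \<open>e\<close> has a diagonal value above the mixed
  one, because \<open>\<kappa> x y > 1\<close>.\<close>

lemma nker_distinct:
  assumes x: "x \<in> X" and y: "y \<in> X" and ne: "\<kappa> x y \<noteq> 1"
  shows "nker x y < max (nker x x) (nker y y)"
proof -
  have p: "\<kappa> e x > 0" "\<kappa> e y > 0" using pos base x y by auto
  have g: "\<kappa> x y > 1" using ge1[OF x y] ne by simp
  have "1 / (\<kappa> e x * \<kappa> e y) < \<kappa> x y / (\<kappa> e x * \<kappa> e y)" using g p by (intro divide_strict_right_mono) auto
  moreover have "1 / (\<kappa> e x * \<kappa> e x) \<le> 1 / (\<kappa> e x * \<kappa> e y) \<or> 1 / (\<kappa> e y * \<kappa> e y) \<le> 1 / (\<kappa> e x * \<kappa> e y)"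
  proof (cases "\<kappa> e x \<le> \<kappa> e y")
    case True
    then have "1 / (\<kappa> e y * \<kappa> e y) \<le> 1 / (\<kappa> e x * \<kappa> e y)"
      using p by (intro divide_left_mono mult_right_mono) auto
    then show ?thesis ..
  next
    case False
    then have "1 / (\<kappa> e x * \<kappa> e x) \<le> 1 / (\<kappa> e x * \<kappa> e y)"
      using p by (intro divide_left_mono mult_left_mono) auto
    then show ?thesis ..
  qed
  ultimately show ?thesis unfolding nker_def using diag x y by auto
qed

lemma nker_pos:
  assumes x: "x \<in> X" and ne: "\<kappa> x e \<noteq> 1"
  shows "nker x x > 0"
proof -
  have "\<kappa> e x > 1" using ge1[OF x base] ne sym[OF x base] by simp
  then have "1 / (\<kappa> e x * \<kappa> e x) < 1" using less_1_mult[of "\<kappa> e x" "\<kappa> e x"] by simp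
  then show ?thesis using diag x by (simp add: nker_def)
qed

lemma nker_eq_0: "x \<in> X \<Longrightarrow> y \<in> X \<Longrightarrow> \<kappa> x e = 1 \<Longrightarrow> nker x y = 0"
  using equiv_cong[of x e y] diag base pos[of e y] sym[of e x] by (simp add: nker_def)

text \<open>One representative of each vertex other than the base vertex receives a vector, and the
  base vertex goes to 0. On these vertices the kernel is strictly positive definite by
  \<open>ultrametric_kernel_pos\<close>; unboundedness makes them infinite in number, matching an
  infinite orthonormal sequence.\<close>

theorem hyperbolic_embedding:
  fixes code :: "'g \<Rightarrow> nat"
  assumes H: "\<exists>S :: 'h::{real_inner, banach} set. hilbert_basis S \<and> countable S \<and> infinite S"
    and code: "\<And>x y. x \<in> X \<Longrightarrow> y \<in> X \<Longrightarrow> code x = code y \<Longrightarrow> \<kappa> x y = 1"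
    and unbounded: "\<And>r. \<exists>x\<in>X. \<kappa> e x > r"
  shows "\<exists>\<psi> :: 'g \<Rightarrow> 'h. (\<forall>x\<in>X. \<forall>y\<in>X. \<psi> x \<bullet> \<psi> y = nker x y) \<and> closure (span (\<psi> ` X)) = UNIV"
proof -
  obtain E :: "nat \<Rightarrow> 'h" where E: "\<And>i j. E i \<bullet> E j = (if i = j then 1 else 0)"
    "closure (span (range E)) = UNIV" using hilbert_basis_sequence[OF H] by blast
  \<comment> \<open>Points of the same vertex give the same predicate and hence literally the same
    choice, so \<open>rp\<close> picks one point per vertex.\<close>
  define rp where "rp x = (SOME y. y \<in> X \<and> \<kappa> x y = 1)" for x
  have rp: "rp x \<in> X" "\<kappa> x (rp x) = 1" if "x \<in> X" for x
    using someI[of "\<lambda>y. y \<in> X \<and> \<kappa> x y = 1" x] diag[OF that] that unfolding rp_def by auto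
  have rp_eq: "rp x = rp y \<longleftrightarrow> \<kappa> x y = 1" if x: "x \<in> X" and y: "y \<in> X" for x y
  proof
    assume "rp x = rp y"
    then show "\<kappa> x y = 1" using rp[OF x] rp[OF y] equiv_cong[of x "rp x" y] sym[of y "rp y"] x y by simp
  next
    assume "\<kappa> x y = 1"
    then have "(\<lambda>z. z \<in> X \<and> \<kappa> x z = 1) = (\<lambda>z. z \<in> X \<and> \<kappa> y z = 1)"
      using equiv_cong[OF x y] by fastforce
    then show "rp x = rp y" by (simp add: rp_def)
  qed
  define S where "S = {rp x | x. x \<in> X \<and> \<kappa> x e \<noteq> 1}"
  have SX: "S \<subseteq> X" using rp by (auto simp: S_def)
  have Sne: "\<kappa> x e \<noteq> 1" if xS: "x \<in> S" for x
  proof -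
    obtain a where a: "x = rp a" "a \<in> X" "\<kappa> a e \<noteq> 1" using xS by (auto simp: S_def)
    then show ?thesis using equiv_cong[OF a(2) rp(1)[OF a(2)] base rp(2)[OF a(2)]] by simp
  qed
  have Sdist: "\<kappa> x y \<noteq> 1" if S: "x \<in> S" "y \<in> S" and ne: "x \<noteq> y" for x y
  proof
    assume 1: "\<kappa> x y = 1"
    obtain a b where ab: "x = rp a" "y = rp b" "a \<in> X" "b \<in> X" using S by (auto simp: S_def)
    have "\<kappa> a b = \<kappa> x b" using equiv_cong[of a x b] rp[OF ab(3)] ab by simp
    also have "\<dots> = \<kappa> y b" using equiv_cong[of x y b] 1 S SX ab by auto
    also have "\<dots> = 1" using rp[OF ab(4)] sym[of b y] ab by simp
    finally show False using rp_eq[OF ab(3,4)] ne ab by simp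
  qed
  have "countable S"
  proof -
    have "S \<subseteq> range (\<lambda>k. rp (SOME x. x \<in> X \<and> code x = k))"
    proof
      fix s assume "s \<in> S"
      then obtain x where x: "s = rp x" "x \<in> X" by (auto simp: S_def)
      let ?y = "SOME y. y \<in> X \<and> code y = code x"
      have "?y \<in> X \<and> code ?y = code x" by (rule someI[of _ x]) (simp add: x)
      then have "rp ?y = s" using rp_eq[of ?y x] code[of ?y x] x by simp
      then show "s \<in> range (\<lambda>k. rp (SOME x. x \<in> X \<and> code x = k))" by blast
    qed
    then show ?thesis by (rule countable_subset) simp
  qed
  moreover have "infinite S"
  proof
    assume fin: "finite S"
    define r where "r = Max (insert 1 (\<kappa> e ` S))"
    obtain x where x: "x \<in> X" "\<kappa> e x > r" using unbounded by blast
    have "r \<ge> 1" unfolding r_def using fin by (intro Max_ge) auto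
    then have "rp x \<in> S" using x sym[OF x(1) base] by (auto simp: S_def)
    then have "\<kappa> e (rp x) \<le> r" unfolding r_def using fin by (intro Max_ge) auto
    moreover have "\<kappa> e (rp x) = \<kappa> e x"
      using equiv_cong[of x "rp x" e] rp[OF x(1)] x base sym[of e x] sym[of e "rp x"] by simp
    ultimately show False using x by simp
  qed
  ultimately have bij: "bij_betw (from_nat_into S) UNIV S" by (rule bij_betw_from_nat_into)
  define s where "s = from_nat_into S"
  have s: "s i \<in> S" "s i \<in> X" for i using bij SX by (auto simp: s_def bij_betw_def)
  have sinj: "inj s" using bij by (simp add: s_def bij_betw_def)
  have "\<exists>\<phi>. (\<forall>i j. \<phi> i \<bullet> \<phi> j = nker (s i) (s j)) \<and> span (range \<phi>) = span (range E)"
  proof (rule gram_realization[OF _ _ E(1)])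
    show "nker (s i) (s j) = nker (s j) (s i)" for i j by (rule nker_sym) (rule s)+
    fix n :: nat and c :: "nat \<Rightarrow> real" assume c: "\<exists>i<n. c i \<noteq> 0"
    have "quad_form (\<lambda>i j. nker (s i) (s j)) {..<n} c \<ge> 0 \<and>
      (quad_form (\<lambda>i j. nker (s i) (s j)) {..<n} c = 0 \<longrightarrow> (\<forall>i\<in>{..<n}. nker (s i) (s i) > 0 \<longrightarrow> c i = 0))"
    proof (rule ultrametric_kernel_pos)
      show "nker (s i) (s j) < max (nker (s i) (s i)) (nker (s j) (s j))" if "i \<noteq> j" for i j
      proof -
        have "s i \<noteq> s j" using that sinj by (auto simp: inj_def)
        then show ?thesis using nker_distinct[OF s(2) s(2) Sdist[OF s(1) s(1)]] by blast
      qed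
    qed (auto intro: nker_sym nker_nonneg nker_ultra s)
    moreover have "nker (s i) (s i) > 0" for i by (rule nker_pos[OF s(2) Sne[OF s(1)]])
    ultimately have "quad_form (\<lambda>i j. nker (s i) (s j)) {..<n} c \<noteq> 0" using c by auto
    then show "quad_form (\<lambda>i j. nker (s i) (s j)) {..<n} c > 0"
      using \<open>_ \<and> _\<close> by linarith
  qed
  then obtain \<phi> where \<phi>: "\<And>i j. \<phi> i \<bullet> \<phi> j = nker (s i) (s j)" "span (range \<phi>) = span (range E)" by blast
  define \<psi> where "\<psi> x = (if \<kappa> x e = 1 then 0 else \<phi> (inv_into UNIV s (rp x)))" for x
  have inv_s: "s (inv_into UNIV s (rp x)) = rp x" if "x \<in> X" "\<kappa> x e \<noteq> 1" for x
  proof -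
    have "rp x \<in> S" using that by (auto simp: S_def)
    then have "rp x \<in> range s" using bij by (simp add: s_def bij_betw_def)
    then show ?thesis by (rule f_inv_into_f)
  qed
  have nrp: "nker (rp x) (rp y) = nker x y" if x: "x \<in> X" and y: "y \<in> X" for x y
  proof -
    have c: "\<kappa> (rp x) z = \<kappa> x z" if "x \<in> X" "z \<in> X" for x z
      using equiv_cong[of x "rp x" z] rp[OF that(1)] that by simp
    have "\<kappa> (rp x) (rp y) = \<kappa> x y" using c[OF x rp(1)[OF y]] c[OF y x] sym[of x "rp y"] sym[of x y] rp x y by simp
    moreover have "\<kappa> e (rp z) = \<kappa> e z" if "z \<in> X" for z
      using c[OF that base] sym[of e z] sym[of e "rp z"] rp that base by simp
    ultimately show ?thesis using x y by (simp add: nker_def)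
  qed
  have "\<psi> x \<bullet> \<psi> y = nker x y" if x: "x \<in> X" and y: "y \<in> X" for x y
  proof -
    consider "\<kappa> x e = 1" | "\<kappa> y e = 1" | "\<kappa> x e \<noteq> 1" "\<kappa> y e \<noteq> 1" by blast
    then show ?thesis
    proof cases
      case 1
      then show ?thesis using nker_eq_0[OF x y] by (simp add: \<psi>_def)
    next
      case 2
      then show ?thesis using nker_eq_0[OF y x] nker_sym[OF x y] by (simp add: \<psi>_def)
    next
      case 3
      then show ?thesis using \<phi>(1) inv_s x y nrp by (simp add: \<psi>_def)
    qed
  qed
  moreover have "closure (span (\<psi> ` X)) = UNIV"
  proof -
    have "\<phi> i \<in> \<psi> ` X" for i
    proof -
      obtain x where x: "s i = rp x" "x \<in> X" "\<kappa> x e \<noteq> 1" using s(1)[of i] by (auto simp: S_def)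
      have "\<phi> i = \<psi> x" using x inv_f_f[OF sinj, of i] by (simp add: \<psi>_def)
      then show ?thesis using x(2) by (rule image_eqI)
    qed
    then have "span (range \<phi>) \<subseteq> span (\<psi> ` X)" by (intro span_mono) blast
    then have "closure (span (range E)) \<subseteq> closure (span (\<psi> ` X))" unfolding \<phi>(2) by (rule closure_mono)
    then show ?thesis using E(2) by auto
  qed
  ultimately show ?thesis by blast
qed

end

section \<open>Extension of isometries of the form\<close>

lemma hform_inner: "hform X Y = X \<bullet> (fst Y, - snd Y)"
  by (simp add: hform_def inner_prod_def)

lemma hform_le_norm: "\<bar>hform X Y\<bar> \<le> norm X * norm Y"
proof -
  have "norm (fst Y, - snd Y) = norm Y" by (cases Y) (simp add: norm_Pair)
  then show ?thesis using Cauchy_Schwarz_ineq2[of X "(fst Y, - snd Y)"] by (simp add: hform_inner)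
qed

lemma hform_commute: "hform X Y = hform Y X"
  by (simp add: hform_def inner_commute mult.commute)

lemma hform_add: "hform (X + Y) Z = hform X Z + hform Y Z" "hform Z (X + Y) = hform Z X + hform Z Y"
  by (simp_all add: hform_def inner_add_left inner_add_right algebra_simps)

lemma hform_diff: "hform (X - Y) Z = hform X Z - hform Y Z" "hform Z (X - Y) = hform Z X - hform Z Y"
  by (simp_all add: hform_def inner_diff_left inner_diff_right algebra_simps)

lemma hform_scale: "hform (a *\<^sub>R X) Z = a * hform X Z" "hform Z (a *\<^sub>R X) = a * hform Z X"
  by (simp_all add: hform_def algebra_simps)

lemma hform_zero [simp]: "hform 0 Z = 0" "hform Z 0 = 0"
  by (simp_all add: hform_def)

lemma continuous_on_hform [continuous_intros]:
  "continuous_on S f \<Longrightarrow> continuous_on S g \<Longrightarrow> continuous_on S (\<lambda>x. hform (f x) (g x))"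
  unfolding hform_def by (intro continuous_intros)

text \<open>Reversing the sign of the form on the complement of \<open>p\<close> gives a positive
  definite form, equivalent to the norm. It is expressed by the form and \<open>p\<close> alone, so
  a form isometry whose effect on one such vector is known is automatically bounded.\<close>

lemma hform_reference_norm:
  fixes p :: "real \<times> 'h::real_inner"
  assumes p: "hform p p = 1"
  shows "\<exists>C>0. \<forall>Y. (norm Y)\<^sup>2 \<le> C * (2 * (hform Y p)\<^sup>2 - hform Y Y)"
proof -
  define z u where "z = fst p" and "u = snd p"
  have z: "z * z = 1 + (norm u)\<^sup>2"
    using p by (simp add: hform_def z_def u_def dot_square_norm)
  have z0: "z \<noteq> 0"
  proof
    assume "z = 0"
    then show False using z zero_le_power2[of "norm u"] by simp
  qed
  \<comment> \<open>A factor 2 comes from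
    \<open>(a + b)\<^sup>2 \<le> 2 * a\<^sup>2 + 2 * b\<^sup>2\<close>. On the complement of
    \<open>p\<close> the first coordinate is bounded by the norm of the second, and the square of
    that norm by \<open>z * z\<close> times minus the form, whence the 4.\<close>
  define C where "C = 2 * (norm p)\<^sup>2 + 4 * (z * z)"
  have zz: "z * z > 0" using z0 by (metis not_real_square_gt_zero)
  have "C > 0" unfolding C_def using zz by (intro add_nonneg_pos) auto
  moreover have "(norm Y)\<^sup>2 \<le> C * (2 * (hform Y p)\<^sup>2 - hform Y Y)" for Y
  proof -
    define a Y' where "a = hform Y p" and "Y' = Y - a *\<^sub>R p"
    have Y: "Y = a *\<^sub>R p + Y'" by (simp add: Y'_def)
    have orth: "hform Y' p = 0" by (simp add: Y'_def hform_diff hform_scale p a_def)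
    have form: "2 * (hform Y p)\<^sup>2 - hform Y Y = a\<^sup>2 - hform Y' Y'"
    proof -
      have "hform Y Y = a\<^sup>2 + hform Y' Y'"
        unfolding Y using orth hform_commute[of p Y']
        by (simp add: hform_add hform_scale p power2_eq_square)
      then show ?thesis by (simp add: a_def)
    qed
    define w v where "w = fst Y'" and "v = snd Y'"
    have "w * z = u \<bullet> v" using orth by (simp add: hform_def w_def v_def z_def u_def inner_commute)
    then have "(w * z)\<^sup>2 \<le> (norm u)\<^sup>2 * (norm v)\<^sup>2"
      using Cauchy_Schwarz_ineq[of u v] by (simp add: dot_square_norm)
    then have wz: "w\<^sup>2 * (z * z) \<le> (z * z - 1) * (norm v)\<^sup>2"
      unfolding z by (simp add: power_mult_distrib power2_eq_square[of z] z)
    then have "w\<^sup>2 * (z * z) \<le> (norm v)\<^sup>2 * (z * z)"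
      by (rule order_trans) (simp add: algebra_simps)
    then have wv: "w\<^sup>2 \<le> (norm v)\<^sup>2" by (rule mult_right_le_imp_le[OF _ zz])
    have neg: "- hform Y' Y' = (norm v)\<^sup>2 - w\<^sup>2"
      by (simp add: hform_def w_def v_def dot_square_norm power2_eq_square)
    have v_le: "(norm v)\<^sup>2 \<le> (z * z) * (- hform Y' Y')"
      using wz unfolding neg by (simp add: algebra_simps)
    have nY': "(norm Y')\<^sup>2 = w\<^sup>2 + (norm v)\<^sup>2"
      by (cases Y') (simp add: norm_Pair w_def v_def)
    have "(norm Y)\<^sup>2 \<le> 2 * (norm (a *\<^sub>R p))\<^sup>2 + 2 * (norm Y')\<^sup>2"
    proof -
      have "norm Y \<le> norm (a *\<^sub>R p) + norm Y'" unfolding Y by (rule norm_triangle_ineq)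
      then have "(norm Y)\<^sup>2 \<le> (norm (a *\<^sub>R p) + norm Y')\<^sup>2" by (rule power_mono) simp
      also have "\<dots> \<le> 2 * (norm (a *\<^sub>R p))\<^sup>2 + 2 * (norm Y')\<^sup>2"
        using zero_le_power2[of "norm (a *\<^sub>R p) - norm Y'"] by (simp add: power2_eq_square algebra_simps)
      finally show ?thesis .
    qed
    also have "(norm (a *\<^sub>R p))\<^sup>2 = a\<^sup>2 * (norm p)\<^sup>2" by (simp add: power_mult_distrib)
    also have "2 * (a\<^sup>2 * (norm p)\<^sup>2) + 2 * (norm Y')\<^sup>2 \<le> 2 * (a\<^sup>2 * (norm p)\<^sup>2) + 4 * (z * z) * (- hform Y' Y')"
      using nY' wv v_le by simp
    also have "\<dots> \<le> C * (a\<^sup>2 - hform Y' Y')"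
    proof -
      have h: "0 \<le> - hform Y' Y'" using neg wv by simp
      have "0 \<le> 2 * (norm p)\<^sup>2 * (- hform Y' Y')" using h by (intro mult_nonneg_nonneg) auto
      moreover have "0 \<le> 4 * (z * z) * a\<^sup>2" using zz by simp
      ultimately show ?thesis by (simp add: C_def algebra_simps)
    qed
    finally show ?thesis by (simp add: form)
  qed
  ultimately show ?thesis by blast
qed

text \<open>The bound turns a Cauchy sequence of first components into one of second components, so
  the domain of the closed relation is closed.\<close>

lemma closed_graph_total:
  fixes G :: "('a::real_normed_vector \<times> 'b::banach) set"
  assumes G: "subspace G" "closed G" and K: "\<And>x y. (x, y) \<in> G \<Longrightarrow> norm y \<le> K * norm x"
    and dense: "closure (fst ` G) = UNIV"
  shows "\<exists>y. (x, y) \<in> G"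
proof -
  have "x \<in> closure (fst ` G)" using dense by simp
  then obtain X where X: "\<And>n. X n \<in> fst ` G" "X \<longlonglongrightarrow> x" by (auto simp: closure_sequential)
  then have "\<forall>n. \<exists>y. (X n, y) \<in> G" by force
  then obtain Y where Y: "\<And>n. (X n, Y n) \<in> G" by metis
  have bd: "norm (Y m - Y n) \<le> (\<bar>K\<bar> + 1) * norm (X m - X n)" for m n
  proof -
    have "(X m - X n, Y m - Y n) \<in> G" using subspace_diff[OF G(1) Y Y, of m n] by simp
    then have "norm (Y m - Y n) \<le> K * norm (X m - X n)" by (rule K)
    also have "\<dots> \<le> (\<bar>K\<bar> + 1) * norm (X m - X n)" by (intro mult_right_mono) auto
    finally show ?thesis .
  qed
  have "Cauchy Y"
  proof (rule CauchyI)
    fix e :: real assume e: "e > 0"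
    have K1: "\<bar>K\<bar> + 1 > 0" by simp
    have "Cauchy X" using X(2) by (rule LIMSEQ_imp_Cauchy)
    then obtain M where M: "\<forall>m\<ge>M. \<forall>n\<ge>M. norm (X m - X n) < e / (\<bar>K\<bar> + 1)"
      using CauchyD[of X "e / (\<bar>K\<bar> + 1)"] divide_pos_pos[OF e K1] by blast
    have "norm (Y m - Y n) < e" if "m \<ge> M" "n \<ge> M" for m n
    proof -
      have "norm (X m - X n) < e / (\<bar>K\<bar> + 1)" using M that by blast
      then have "(\<bar>K\<bar> + 1) * norm (X m - X n) < e" using K1 by (simp add: pos_less_divide_eq mult.commute)
      then show ?thesis using bd[of m n] by linarith
    qed
    then show "\<exists>M. \<forall>m\<ge>M. \<forall>n\<ge>M. norm (Y m - Y n) < e" by blast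
  qed
  then obtain y where "Y \<longlonglongrightarrow> y" using Cauchy_convergent_iff convergent_def by blast
  then have "(\<lambda>n. (X n, Y n)) \<longlonglongrightarrow> (x, y)" using X(2) by (intro tendsto_Pair)
  then have "(x, y) \<in> G" by (rule closed_sequentially[OF G(2), rotated]) (rule Y)
  then show ?thesis by blast
qed

lemma subspace_closure_normed:
  fixes S :: "'a::real_normed_vector set"
  assumes "subspace S"
  shows "subspace (closure S)"
  unfolding subspace_def
proof (intro conjI ballI allI)
  show "0 \<in> closure S" using subspace_0[OF assms] closure_subset by blast
next
  fix x y assume "x \<in> closure S" "y \<in> closure S"
  then obtain f g where f: "\<forall>n. f n \<in> S" "f \<longlonglongrightarrow> x" and g: "\<forall>n. g n \<in> S" "g \<longlonglongrightarrow> y"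
    unfolding closure_sequential by blast
  have "(\<lambda>n. f n + g n) \<longlonglongrightarrow> x + y" by (rule tendsto_add[OF f(2) g(2)])
  moreover have "\<forall>n. f n + g n \<in> S" using f g subspace_add[OF assms] by blast
  ultimately show "x + y \<in> closure S" unfolding closure_sequential by (intro exI[of _ "\<lambda>n. f n + g n"]) simp
next
  fix c x assume "x \<in> closure S"
  then obtain f where f: "\<forall>n. f n \<in> S" "f \<longlonglongrightarrow> x" unfolding closure_sequential by blast
  have "(\<lambda>n. c *\<^sub>R f n) \<longlonglongrightarrow> c *\<^sub>R x" by (rule tendsto_scaleR[OF tendsto_const f(2)])
  moreover have "\<forall>n. c *\<^sub>R f n \<in> S" using f subspace_scale[OF assms] by blast
  ultimately show "c *\<^sub>R x \<in> closure S" unfolding closure_sequential by (intro exI[of _ "\<lambda>n. c *\<^sub>R f n"]) simp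
qed

text \<open>The closure of the span of the pairs \<open>(f i, f' i)\<close> preserves the form, and
  the pair at \<open>i0\<close> supplies reference vectors, so \<open>hform_reference_norm\<close>
  bounds it in both directions. A closed linear relation bounded in this sense, with dense domain
  and dense range, is the graph of an invertible operator.\<close>

lemma form_isometry_extension:
  fixes f f' :: "'i \<Rightarrow> real \<times> 'h::{real_inner, banach}"
  assumes form: "\<And>i j. i \<in> I \<Longrightarrow> j \<in> I \<Longrightarrow> hform (f i) (f j) = hform (f' i) (f' j)"
    and tot: "closure (span (f ` I)) = UNIV" "closure (span (f' ` I)) = UNIV"
    and i0: "i0 \<in> I" "hform (f i0) (f i0) = 1"
  shows "\<exists>T\<in>O_form. \<forall>i\<in>I. T (f i) = f' i"
proof -
  define A where "A = (\<lambda>i. (f i, f' i)) ` I"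
  define G where "G = closure (span A)"
  have G: "subspace G" "closed G" unfolding G_def by (auto intro: subspace_closure_normed)
  have Gmin: "G \<subseteq> S" if "A \<subseteq> S" "subspace S" "closed S" for S
    unfolding G_def using that by (intro closure_minimal span_minimal)
  have sub: "subspace {p. hform (fst p) (fst q) = hform (snd p) (snd q)}"
    "closed {p. hform (fst p) (fst q) = hform (snd p) (snd q)}" for q :: "(real \<times> 'h) \<times> (real \<times> 'h)"
    by (auto simp: subspace_def hform_add hform_scale intro!: closed_Collect_eq continuous_intros)
  have 1: "hform (fst p) (fst q) = hform (snd p) (snd q)" if "p \<in> G" "q \<in> A" for p q
  proof -
    have "A \<subseteq> {p. hform (fst p) (fst q) = hform (snd p) (snd q)}" using that(2) form by (auto simp: A_def)
    from Gmin[OF this sub] show ?thesis using that(1) by blast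
  qed
  have form2: "hform (fst p) (fst q) = hform (snd p) (snd q)" if "p \<in> G" "q \<in> G" for p q
  proof -
    have "A \<subseteq> {q. hform (fst q) (fst p) = hform (snd q) (snd p)}"
      using 1[OF that(1)] hform_commute[of "fst p"] hform_commute[of "snd p"] by simp blast
    from Gmin[OF this sub] have "hform (fst q) (fst p) = hform (snd q) (snd p)" using that(2) by blast
    then show ?thesis using hform_commute[of "fst p"] hform_commute[of "snd p"] by simp
  qed
  have AG: "(f i, f' i) \<in> G" if "i \<in> I" for i
    unfolding G_def A_def using that closure_subset span_superset by fast
  have bound: "\<exists>K. \<forall>x y. (x, y) \<in> H \<longrightarrow> norm y \<le> K * norm x"
    if H: "\<And>x y. (x, y) \<in> H \<Longrightarrow> hform x x = hform y y \<and> hform x p = hform y p'" and p': "hform p' p' = 1"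
    for H and p p' :: "real \<times> 'h"
  proof -
    obtain C where C: "C > 0" "\<And>Y. (norm Y)\<^sup>2 \<le> C * (2 * (hform Y p')\<^sup>2 - hform Y Y)"
      using hform_reference_norm[OF p'] by blast
    define K where "K = sqrt (C * (2 * (norm p)\<^sup>2 + 1))"
    have "norm y \<le> K * norm x" if "(x, y) \<in> H" for x y
    proof -
      have "(norm y)\<^sup>2 \<le> C * (2 * (hform x p)\<^sup>2 - hform x x)" using C(2)[of y] H[OF that] by simp
      also have "\<dots> \<le> C * (2 * (norm x * norm p)\<^sup>2 + norm x * norm x)"
      proof (rule mult_left_mono)
        have "(hform x p)\<^sup>2 \<le> (norm x * norm p)\<^sup>2"
          using hform_le_norm[of x p] by (simp add: abs_le_square_iff[symmetric])
        moreover have "- hform x x \<le> norm x * norm x" using hform_le_norm[of x x] by linarith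
        ultimately show "2 * (hform x p)\<^sup>2 - hform x x \<le> 2 * (norm x * norm p)\<^sup>2 + norm x * norm x" by linarith
      qed (use C in simp)
      also have "\<dots> = (K * norm x)\<^sup>2"
        using C(1) by (simp add: K_def power_mult_distrib algebra_simps power2_eq_square[of "norm x"] real_sqrt_pow2)
      finally show ?thesis by (rule power2_le_imp_le) (use C(1) in \<open>simp add: K_def\<close>)
    qed
    then show ?thesis by blast
  qed
  have f0: "hform (f' i0) (f' i0) = 1" using form[OF i0(1) i0(1)] i0(2) by simp
  have f2: "hform x x = hform y y \<and> hform x (f i0) = hform y (f' i0)" if "(x, y) \<in> G" for x y
    using form2[OF that that] form2[OF that AG[OF i0(1)]] by simp
  obtain K where K: "\<And>x y. (x, y) \<in> G \<Longrightarrow> norm y \<le> K * norm x"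
    using bound[OF f2 f0] by blast
  define G' where "G' = (\<lambda>p. (snd p, fst p)) -` G"
  have f2': "hform x x = hform y y \<and> hform x (f' i0) = hform y (f i0)" if "(x, y) \<in> G'" for x y
    using f2[of y x] that by (simp add: G'_def)
  obtain K' where K': "\<And>x y. (x, y) \<in> G' \<Longrightarrow> norm y \<le> K' * norm x"
    using bound[OF f2' i0(2)] by blast
  have G': "subspace G'" "closed G'"
  proof -
    have "linear (\<lambda>p :: (real \<times> 'h) \<times> (real \<times> 'h). (snd p, fst p))" by (rule linearI) auto
    then show "subspace G'" unfolding G'_def using G(1) by (rule linear_subspace_vimage)
    show "closed G'" unfolding G'_def using G(2)
      by (intro closed_vimage) (auto intro!: continuous_intros)
  qed
  have fstG: "span (f ` I) \<subseteq> fst ` G"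
  proof (rule span_minimal)
    show "f ` I \<subseteq> fst ` G" using AG by force
    show "subspace (fst ` G)" by (rule linear_subspace_image[OF linear_fst G(1)])
  qed
  have sndG: "span (f' ` I) \<subseteq> fst ` G'"
  proof (rule span_minimal)
    show "f' ` I \<subseteq> fst ` G'"
    proof
      fix y assume "y \<in> f' ` I"
      then obtain i where i: "y = f' i" "i \<in> I" by blast
      then have "(y, f i) \<in> G'" using AG by (simp add: G'_def)
      then show "y \<in> fst ` G'" by force
    qed
    show "subspace (fst ` G')" by (rule linear_subspace_image[OF linear_fst G'(1)])
  qed
  have ex: "\<exists>y. (x, y) \<in> G" for x
    using closure_mono[OF fstG] tot(1) by (intro closed_graph_total[OF G K]) auto
  have ex': "\<exists>x. (x, y) \<in> G" for y
  proof -
    have "\<exists>x. (y, x) \<in> G'"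
      using closure_mono[OF sndG] tot(2) by (intro closed_graph_total[OF G' K']) auto
    then show ?thesis by (simp add: G'_def)
  qed
  have uniq: "y = y'" if "(x, y) \<in> G" "(x, y') \<in> G" for x y y'
    using K[of 0 "y - y'"] subspace_diff[OF G(1) that] by simp
  have uniq': "x = x'" if "(x, y) \<in> G" "(x', y) \<in> G" for x x' y
    using K'[of 0 "x - x'"] subspace_diff[OF G(1) that] by (simp add: G'_def)
  define T where "T x = (THE y. (x, y) \<in> G)" for x
  have TG: "(x, T x) \<in> G" for x
    unfolding T_def using ex[of x] uniq by (metis theI)
  have Teq: "T x = y" if "(x, y) \<in> G" for x y using uniq[OF TG that] .
  have "linear T"
  proof (rule linearI)
    show "T (x + y) = T x + T y" for x y using subspace_add[OF G(1) TG TG, of x y] by (intro Teq) simp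
    show "T (c *\<^sub>R x) = c *\<^sub>R T x" for c x using subspace_scale[OF G(1) TG, of c x] by (intro Teq) simp
  qed
  then have "bounded_linear T"
    using K[OF TG] by (intro bounded_linear_intro[where K = K]) (auto simp: linear_add linear_cmul mult.commute)
  moreover have "bij T"
  proof (rule bijI)
    show "inj T" by (rule injI) (metis TG uniq')
    show "surj T" unfolding surj_def using ex' Teq by metis
  qed
  moreover have "hform (T X) (T Y) = hform X Y" for X Y using form2[OF TG TG, of X Y] by simp
  ultimately have "T \<in> O_form" by (simp add: O_form_def del: split_paired_All)
  moreover have "\<forall>i\<in>I. T (f i) = f' i" using Teq AG by blast
  ultimately show ?thesis by blast
qed

section \<open>Operators preserving the form and the isometries they induce\<close>

lemma O_formD:
  assumes "T \<in> O_form"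
  shows "bounded_linear T" "linear T" "bij T" "hform (T X) (T Y) = hform X Y"
  using assms by (auto simp: O_form_def bounded_linear.linear simp del: split_paired_All)

lemma O_form_comp: "S \<in> O_form \<Longrightarrow> T \<in> O_form \<Longrightarrow> S \<circ> T \<in> O_form"
  using bounded_linear_compose[of S T]
  by (simp add: O_form_def bij_comp comp_def[of S T, symmetric] del: split_paired_All)

lemma O_form_total_eq:
  fixes S T :: "real \<times> 'h::real_inner \<Rightarrow> real \<times> 'h"
  assumes S: "S \<in> O_form" and T: "T \<in> O_form" and tot: "closure (span A) = UNIV"
    and eq: "\<And>x. x \<in> A \<Longrightarrow> S x = T x"
  shows "S = T"
proof
  fix x
  note bl = O_formD(1)[OF S] O_formD(1)[OF T]
  have "closed {x. S x = T x}"
    by (intro closed_Collect_eq linear_continuous_on bl)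
  moreover have "subspace {x. S x = T x}"
    using O_formD(2)[OF S] O_formD(2)[OF T] by (auto simp: subspace_def linear_add linear_cmul linear_0)
  ultimately have "closure (span A) \<subseteq> {x. S x = T x}"
    using eq by (intro closure_minimal span_minimal) auto
  then show "S x = T x" using tot by auto
qed

text \<open>The restriction is there because elements of the isometry group are
  \<open>undefined\<close> outside the hyperbolic space.\<close>

definition induced :: "(real \<times> 'h::real_inner \<Rightarrow> real \<times> 'h) \<Rightarrow> (real \<times> 'h) set \<Rightarrow> (real \<times> 'h) set" where
  "induced T = restrict (image T) (hyp_space TYPE('h))"

lemma image_hyp_space:
  fixes T :: "real \<times> 'h::real_inner \<Rightarrow> real \<times> 'h"
  assumes T: "linear T" "\<And>X. hform (T X) (T X) = hform X X" and x: "x \<in> hyp_space TYPE('h)"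
  shows "T ` x \<in> hyp_space TYPE('h)"
proof -
  obtain X where X: "x = span {X}" "hform X X > 0" using x by (auto simp: hyp_space_def)
  then have "T ` x = span {T X}" using linear_span_image[OF T(1), of "{X}"] by simp
  moreover have "hform (T X) (T X) > 0" using X(2) T(2)[of X] by simp
  ultimately show ?thesis unfolding hyp_space_def by blast
qed

lemma induced_in_isometries:
  fixes T :: "real \<times> 'h::real_inner \<Rightarrow> real \<times> 'h"
  assumes T: "linear T" "bij T" "\<And>X Y. hform (T X) (T Y) = hform X Y"
  shows "induced T \<in> hyp_isometries TYPE('h)"
proof -
  let ?S = "hyp_space TYPE('h)"
  have maps: "T ` x \<in> ?S" if "x \<in> ?S" for x
    using image_hyp_space[OF T(1) T(3) that] .
  define U where "U = inv_into UNIV T"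
  have TU: "T (U x) = x" and UT: "U (T x) = x" for x
    using T(2) by (simp_all add: U_def bij_is_surj surj_f_inv_f bij_is_inj)
  have U: "linear U" "\<And>X. hform (U X) (U X) = hform X X"
  proof -
    show "linear U"
    proof (rule linearI)
      show "U (x + y) = U x + U y" for x y
        using UT[of "U x + U y"] by (simp add: linear_add[OF T(1)] TU)
      show "U (c *\<^sub>R x) = c *\<^sub>R U x" for c x
        using UT[of "c *\<^sub>R U x"] by (simp add: linear_cmul[OF T(1)] TU)
    qed
    show "hform (U X) (U X) = hform X X" for X using T(3)[of "U X" "U X"] TU by simp
  qed
  have maps': "U ` x \<in> ?S" if "x \<in> ?S" for x
    using image_hyp_space[OF U that] .
  have "bij_betw (induced T) ?S ?S"
  proof (rule bij_betw_byWitness[where f' = "image U"])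
    show "\<forall>x\<in>?S. U ` induced T x = x" by (simp add: induced_def image_image UT)
    show "\<forall>x\<in>?S. induced T (U ` x) = x" using maps' by (simp add: induced_def image_image TU)
    show "induced T ` ?S \<subseteq> ?S" using maps by (auto simp: induced_def)
    show "image U ` ?S \<subseteq> ?S" using maps' by auto
  qed
  then have "induced T \<in> Bij ?S" by (simp add: Bij_def induced_def)
  moreover have "hdist (induced T x) (induced T y) = hdist x y" if x: "x \<in> ?S" and y: "y \<in> ?S" for x y
  proof -
    obtain X Y where X: "x = span {X}" "hform X X > 0" and Y: "y = span {Y}" "hform Y Y > 0"
      using x y by (auto simp: hyp_space_def)
    have "induced T x = span {T X}" "induced T y = span {T Y}"
      using x y linear_span_image[OF T(1), of "{X}"] linear_span_image[OF T(1), of "{Y}"]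
      by (simp_all add: induced_def X(1) Y(1))
    then show ?thesis using X Y T(3) by (simp add: hdist_span)
  qed
  ultimately show ?thesis by (simp add: hyp_isometries_def)
qed

lemma induced_comp:
  fixes S T :: "real \<times> 'h::real_inner \<Rightarrow> real \<times> 'h"
  assumes S: "linear S" "bij S" "\<And>X Y. hform (S X) (S Y) = hform X Y"
    and T: "linear T" "bij T" "\<And>X Y. hform (T X) (T Y) = hform X Y"
  shows "induced (S \<circ> T) = induced S \<otimes>\<^bsub>Is TYPE('h)\<^esub> induced T"
proof -
  have "induced S \<in> Bij (hyp_space TYPE('h))" "induced T \<in> Bij (hyp_space TYPE('h))"
    using induced_in_isometries[OF S] induced_in_isometries[OF T] by (simp_all add: hyp_isometries_def)
  then have "induced S \<otimes>\<^bsub>Is TYPE('h)\<^esub> induced T = compose (hyp_space TYPE('h)) (induced S) (induced T)"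
    by (simp add: Is_def BijGroup_def)
  also have "\<dots> = induced (S \<circ> T)"
    using image_hyp_space[OF T(1) T(3)] by (auto simp: compose_def induced_def fun_eq_iff image_comp)
  finally show ?thesis ..
qed

lemma lifts_induced: "T \<in> O_form \<Longrightarrow> lifts T (induced T)"
  by (simp add: lifts_def induced_def)

section \<open>The representation of a group acting on a tree\<close>

lemma norm_sum_orthogonal_le:
  fixes f :: "'i \<Rightarrow> 'h::real_inner"
  assumes "finite A" "\<And>i j. i \<in> A \<Longrightarrow> j \<in> A \<Longrightarrow> i \<noteq> j \<Longrightarrow> f i \<bullet> f j = 0" "\<And>i. i \<in> A \<Longrightarrow> f i \<bullet> f i \<le> 1"
  shows "norm (\<Sum>i\<in>A. f i) \<le> sqrt (card A)"
proof -
  have "(norm (\<Sum>i\<in>A. f i))\<^sup>2 = (\<Sum>i\<in>A. (norm (f i))\<^sup>2)"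
    by (rule norm_sum_Pythagorean) (use assms in \<open>auto simp: pairwise_def orthogonal_def\<close>)
  also have "\<dots> \<le> (\<Sum>i\<in>A. 1)" by (rule sum_mono) (use assms(3) in \<open>simp add: power2_norm_eq_inner\<close>)
  finally have "(norm (\<Sum>i\<in>A. f i))\<^sup>2 \<le> card A" by simp
  then show ?thesis by (rule real_le_rsqrt)
qed

text \<open>The families \<open>u\<close> and \<open>l\<close> stabilize the base vertex. In
  \<open>spread\<close>, the value \<open>(\<kappa> e g)\<^sup>2\<close> is the largest possible
  one: the paths from \<open>e\<close> to the two vertices share no segment, and the embedded
  vectors are orthogonal. The vertex of \<open>g\<close> is spread out either by \<open>u\<close>
  or, after any \<open>u k\<close>, by \<open>l\<close>.\<close>

locale tree_group = tree_kernel \<Gamma> \<kappa> e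
  for \<Gamma> :: "'g set" and \<kappa> and e +
  fixes mul :: "'g \<Rightarrow> 'g \<Rightarrow> 'g" (infixl "\<star>" 70) and inverse_of :: "'g \<Rightarrow> 'g" and u l :: "nat \<Rightarrow> 'g"
  assumes closed: "x \<in> \<Gamma> \<Longrightarrow> y \<in> \<Gamma> \<Longrightarrow> x \<star> y \<in> \<Gamma>" "x \<in> \<Gamma> \<Longrightarrow> inverse_of x \<in> \<Gamma>" "u i \<in> \<Gamma>" "l i \<in> \<Gamma>"
    and assoc: "x \<star> y \<star> z = x \<star> (y \<star> z)"
    and one: "e \<star> x = x" "x \<star> e = x"
    and inv: "x \<in> \<Gamma> \<Longrightarrow> inverse_of x \<star> x = e" "x \<in> \<Gamma> \<Longrightarrow> x \<star> inverse_of x = e"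
    and invariant: "s \<in> \<Gamma> \<Longrightarrow> x \<in> \<Gamma> \<Longrightarrow> y \<in> \<Gamma> \<Longrightarrow> \<kappa> (s \<star> x) (s \<star> y) = \<kappa> x y"
    and ul1: "\<kappa> e (u i) = 1" "\<kappa> e (l i) = 1"
    and spread: "g \<in> \<Gamma> \<Longrightarrow>
      (\<forall>i j. i \<noteq> j \<longrightarrow> \<kappa> (u i \<star> g) (u j \<star> g) = (\<kappa> e g)\<^sup>2) \<or>
      (\<forall>k i j. i \<noteq> j \<longrightarrow> \<kappa> (l i \<star> (u k \<star> g)) (l j \<star> (u k \<star> g)) = (\<kappa> e g)\<^sup>2)"
begin

lemma stab_norm: "k \<in> \<Gamma> \<Longrightarrow> \<kappa> e k = 1 \<Longrightarrow> g \<in> \<Gamma> \<Longrightarrow> \<kappa> e (k \<star> g) = \<kappa> e g"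
  using equiv_cong[of e k "k \<star> g"] invariant[of k e g] base closed one by simp

lemma stab_mult: "k \<in> \<Gamma> \<Longrightarrow> \<kappa> e k = 1 \<Longrightarrow> g \<in> \<Gamma> \<Longrightarrow> \<kappa> e g = 1 \<Longrightarrow> \<kappa> e (k \<star> g) = 1"
  using stab_norm by simp

text \<open>Vertices become vectors whose form values are \<open>\<kappa>\<close>; the group
  permutes them and so acts by form isometries. Averages over the products
  \<open>l i \<star> u j\<close> fix (1, 0) and tend to 0 pointwise on its complement, so a nonzero
  closed invariant subspace contains (1, 0) and with it all vertices. The clause on elements with
  equal action on the vertices later disposes of signs.\<close>

theorem irreducible_representation:
  fixes code :: "'g \<Rightarrow> nat"
  assumes H: "\<exists>S :: 'h::{real_inner, banach} set. hilbert_basis S \<and> countable S \<and> infinite S"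
    and code: "\<And>x y. x \<in> \<Gamma> \<Longrightarrow> y \<in> \<Gamma> \<Longrightarrow> code x = code y \<Longrightarrow> \<kappa> x y = 1"
    and unbounded: "\<And>r. \<exists>x\<in>\<Gamma>. \<kappa> e x > r"
  shows "\<exists>R :: 'g \<Rightarrow> real \<times> 'h \<Rightarrow> real \<times> 'h.
    (\<forall>s\<in>\<Gamma>. R s \<in> O_form) \<and> (\<forall>s\<in>\<Gamma>. \<forall>t\<in>\<Gamma>. R (s \<star> t) = R s \<circ> R t) \<and>
    (\<forall>s\<in>\<Gamma>. \<forall>t\<in>\<Gamma>. \<kappa> s t = 1 \<longrightarrow> R s (1, 0) = R t (1, 0)) \<and>
    (\<forall>s\<in>\<Gamma>. \<forall>t\<in>\<Gamma>. (\<forall>g\<in>\<Gamma>. \<kappa> (s \<star> g) (t \<star> g) = 1) \<longrightarrow> R s = R t) \<and>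
    (\<forall>W. subspace W \<and> closed W \<and> (\<forall>s\<in>\<Gamma>. R s ` W \<subseteq> W) \<longrightarrow> W = {0} \<or> W = UNIV)"
proof -
  obtain \<psi> :: "'g \<Rightarrow> 'h" where \<psi>: "\<And>x y. x \<in> \<Gamma> \<Longrightarrow> y \<in> \<Gamma> \<Longrightarrow> \<psi> x \<bullet> \<psi> y = nker x y"
    "closure (span (\<psi> ` \<Gamma>)) = UNIV"
    using hyperbolic_embedding[OF H code unbounded] by blast
  have psi0: "\<psi> x = 0" if "x \<in> \<Gamma>" "\<kappa> e x = 1" for x
    using \<psi>(1)[OF that(1) that(1)] diag[OF that(1)] that(2) by (simp add: nker_def)
  have psi_le1: "\<psi> x \<bullet> \<psi> x \<le> 1" if "x \<in> \<Gamma>" for x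
    using \<psi>(1)[OF that that] diag[OF that] by (simp add: nker_def)
  \<comment> \<open>The point (1, \<open>\<psi> x\<close>) of the projective ball model, scaled by
    \<open>\<kappa> e x\<close> onto the hyperboloid.\<close>
  define f where "f x = \<kappa> e x *\<^sub>R (1 :: real, \<psi> x)" for x
  have f_e: "f x = (1, 0)" if "x \<in> \<Gamma>" "\<kappa> e x = 1" for x
    using psi0[OF that] that by (simp add: f_def)
  have form: "hform (f x) (f y) = \<kappa> x y" if x: "x \<in> \<Gamma>" and y: "y \<in> \<Gamma>" for x y
  proof -
    have p: "\<kappa> e x > 0" "\<kappa> e y > 0" using pos base x y by auto
    have "hform (f x) (f y) = \<kappa> e x * \<kappa> e y * (1 - \<psi> x \<bullet> \<psi> y)"
      by (simp add: f_def hform_def algebra_simps)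
    then show ?thesis using p \<psi>(1)[OF x y] by (simp add: nker_def)
  qed
  have psif: "(0, \<psi> x) = (1 / \<kappa> e x) *\<^sub>R f x - f e" if "x \<in> \<Gamma>" for x
    using pos[OF base that] psi0[OF base diag[OF base]] diag[OF base] by (simp add: f_def)
  have fdense: "closure (span (f ` \<Gamma>)) = UNIV"
  proof -
    let ?C = "closure (span (f ` \<Gamma>))"
    have C: "subspace ?C" by (intro subspace_closure_normed subspace_span)
    have fC: "f x \<in> ?C" if "x \<in> \<Gamma>" for x
      by (rule subsetD[OF closure_subset], rule span_base, rule imageI, rule that)
    have "closure (span (\<psi> ` \<Gamma>)) \<subseteq> (\<lambda>y. (0, y)) -` ?C"
    proof (intro closure_minimal span_minimal)
      show "\<psi> ` \<Gamma> \<subseteq> (\<lambda>y. (0, y)) -` ?C"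
      proof
        fix z assume "z \<in> \<psi> ` \<Gamma>"
        then obtain x where x: "z = \<psi> x" "x \<in> \<Gamma>" by blast
        have "(0, \<psi> x) \<in> ?C" unfolding psif[OF x(2)]
          by (intro subspace_diff[OF C] subspace_scale[OF C] fC x base)
        then show "z \<in> (\<lambda>y. (0, y)) -` ?C" using x by simp
      qed
      have "linear (\<lambda>y :: 'h. (0 :: real, y))" by (rule linearI) auto
      then show "subspace ((\<lambda>y. (0, y)) -` ?C)" using C by (rule linear_subspace_vimage)
      show "closed ((\<lambda>y. (0, y)) -` ?C)" by (intro closed_vimage continuous_intros) simp
    qed
    then have 0: "(0, y) \<in> ?C" for y using \<psi>(2) by auto
    have "(c, y) \<in> ?C" for c y
    proof -
      have "(c, y) = c *\<^sub>R f e + (0, y)" using f_e[OF base diag[OF base]] by simp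
      then show ?thesis by (metis 0 C base fC subspace_add subspace_scale)
    qed
    then show ?thesis by auto
  qed
  have trans: "(\<lambda>x. f (s \<star> x)) ` \<Gamma> = f ` \<Gamma>" if s: "s \<in> \<Gamma>" for s
  proof
    show "(\<lambda>x. f (s \<star> x)) ` \<Gamma> \<subseteq> f ` \<Gamma>" using closed(1) s by blast
    show "f ` \<Gamma> \<subseteq> (\<lambda>x. f (s \<star> x)) ` \<Gamma>"
    proof
      fix z assume "z \<in> f ` \<Gamma>"
      then obtain x where x: "z = f x" "x \<in> \<Gamma>" by blast
      have "z = f (s \<star> (inverse_of s \<star> x))" using x s inv one by (simp flip: assoc)
      then show "z \<in> (\<lambda>x. f (s \<star> x)) ` \<Gamma>" using closed s x by blast
    qed
  qed
  have "\<exists>T\<in>O_form. \<forall>x\<in>\<Gamma>. T (f x) = f (s \<star> x)" if s: "s \<in> \<Gamma>" for s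
  proof (rule form_isometry_extension[OF _ fdense _ base])
    show "hform (f x) (f y) = hform (f (s \<star> x)) (f (s \<star> y))" if "x \<in> \<Gamma>" "y \<in> \<Gamma>" for x y
      using that s form closed(1) invariant by simp
    show "closure (span ((\<lambda>x. f (s \<star> x)) ` \<Gamma>)) = UNIV" using trans[OF s] fdense by simp
    show "hform (f e) (f e) = 1" using form[OF base base] diag[OF base] by simp
  qed
  then have "\<forall>s. \<exists>T. s \<in> \<Gamma> \<longrightarrow> T \<in> O_form \<and> (\<forall>x\<in>\<Gamma>. T (f x) = f (s \<star> x))" by blast
  from choice[OF this] obtain R where R0: "\<forall>s. s \<in> \<Gamma> \<longrightarrow> R s \<in> O_form \<and> (\<forall>x\<in>\<Gamma>. R s (f x) = f (s \<star> x))" ..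
  have R: "R s \<in> O_form" and Rf: "x \<in> \<Gamma> \<Longrightarrow> R s (f x) = f (s \<star> x)" if "s \<in> \<Gamma>" for s x
    using R0 that by auto
  have Rlin: "linear (R s)" and Rform: "hform (R s X) (R s Y) = hform X Y" if "s \<in> \<Gamma>" for s X Y
    using O_formD[OF R[OF that]] by auto
  have Rcomp: "R (s \<star> t) = R s \<circ> R t" if s: "s \<in> \<Gamma>" and t: "t \<in> \<Gamma>" for s t
  proof (rule O_form_total_eq[OF R O_form_comp[OF R R] fdense])
    show "s \<star> t \<in> \<Gamma>" "s \<in> \<Gamma>" "t \<in> \<Gamma>" using s t closed by auto
    fix z assume "z \<in> f ` \<Gamma>"
    then obtain x where x: "z = f x" "x \<in> \<Gamma>" by blast
    show "R (s \<star> t) z = (R s \<circ> R t) z" using x s t closed by (simp add: Rf assoc)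
  qed
  have f_eq: "f x = f y" if x: "x \<in> \<Gamma>" and y: "y \<in> \<Gamma>" and xy: "\<kappa> x y = 1" for x y
  proof -
    have "\<kappa> e x = \<kappa> e y" using equiv_cong[OF x y base xy] sym x y base by simp
    moreover have "\<psi> x = \<psi> y"
    proof -
      have n: "nker x x = nker x y" "nker y y = nker x y"
        using calculation diag x y xy by (simp_all add: nker_def)
      have "(\<psi> x - \<psi> y) \<bullet> (\<psi> x - \<psi> y) = nker x x - 2 * nker x y + nker y y"
        using \<psi>(1) x y by (simp add: inner_diff_left inner_diff_right nker_sym[OF y x])
      also have "\<dots> = 0" unfolding n by simp
      finally show ?thesis by simp
    qed
    ultimately show ?thesis by (simp add: f_def)
  qed
  have Re: "R s (1, 0) = f s" if "s \<in> \<Gamma>" for s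
    using Rf[OF that base] f_e[OF base diag[OF base]] one by simp

  \<comment> \<open>An element stabilizing the base vertex fixes (1, 0) and hence preserves its
    complement, where it acts isometrically by \<open>U\<close>.\<close>
  define U where "U k Y = snd (R k (0, Y))" for k Y
  have RU: "R k (c, Y) = (c, U k Y)" if k: "k \<in> \<Gamma>" "\<kappa> e k = 1" for k c Y
  proof -
    have R10: "R k (1, 0) = (1, 0)" using Re[OF k(1)] f_e[OF k] by simp
    have "hform (R k (0, Y)) (R k (1, 0)) = hform (0, Y) (1, 0)" by (rule Rform[OF k(1)])
    then have "fst (R k (0, Y)) = 0" by (simp add: R10 hform_def)
    then have "R k (0, Y) = (0, U k Y)" by (simp add: U_def prod_eq_iff)
    moreover have "R k (c, Y) = c *\<^sub>R R k (1, 0) + R k (0, Y)"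
      by (simp add: linear_add[OF Rlin[OF k(1)], symmetric] linear_cmul[OF Rlin[OF k(1)], symmetric])
    ultimately show ?thesis by (simp add: R10)
  qed
  have Ulin: "linear (U k)" if k: "k \<in> \<Gamma>" for k
  proof (rule linearI)
    show "U k (x + y) = U k x + U k y" for x y
      using linear_add[OF Rlin[OF k], of "(0, x)" "(0, y)"] by (simp add: U_def)
    show "U k (c *\<^sub>R x) = c *\<^sub>R U k x" for c x
      using linear_cmul[OF Rlin[OF k], of c "(0, x)"] by (simp add: U_def)
  qed
  have Unorm: "norm (U k Y) = norm Y" if k: "k \<in> \<Gamma>" "\<kappa> e k = 1" for k Y
  proof -
    have "hform (R k (0, Y)) (R k (0, Y)) = hform (0, Y) (0, Y)" by (rule Rform[OF k(1)])
    then have "U k Y \<bullet> U k Y = Y \<bullet> Y" by (simp add: RU[OF k] hform_def)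
    then show ?thesis by (simp add: norm_eq)
  qed
  have U\<psi>: "U k (\<psi> g) = \<psi> (k \<star> g)" if k: "k \<in> \<Gamma>" "\<kappa> e k = 1" and g: "g \<in> \<Gamma>" for k g
  proof -
    have kg: "k \<star> g \<in> \<Gamma>" using closed k g by simp
    have "R k (0, \<psi> g) = (1 / \<kappa> e g) *\<^sub>R f (k \<star> g) - f (k \<star> e)"
      unfolding psif[OF g] by (simp add: linear_diff[OF Rlin[OF k(1)]] linear_cmul[OF Rlin[OF k(1)]] Rf k(1) g base)
    also have "\<dots> = (0, \<psi> (k \<star> g))"
      unfolding psif[OF kg] using stab_norm[OF k g] one f_e[OF k] f_e[OF base diag[OF base]] by simp
    finally show ?thesis by (simp add: U_def)
  qed

  have ul: "l i \<star> u j \<in> \<Gamma>" "\<kappa> e (l i \<star> u j) = 1" for i j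
    using closed ul1 stab_mult by auto
  have Ucomp: "U (l i \<star> u j) Y = U (l i) (U (u j) Y)" for i j Y
  proof -
    have "(0, U (l i \<star> u j) Y) = R (l i \<star> u j) (0, Y)" by (rule RU[OF ul, symmetric])
    also have "\<dots> = R (l i) (R (u j) (0, Y))" by (simp add: Rcomp[OF closed(4,3)])
    also have "\<dots> = (0, U (l i) (U (u j) Y))"
      by (simp only: RU[OF closed(3) ul1(1)] RU[OF closed(4) ul1(2)])
    finally show ?thesis by simp
  qed
  define A where "A n Y = (1 / (real n)\<^sup>2) *\<^sub>R (\<Sum>i<n. \<Sum>j<n. U (l i \<star> u j) Y)" for n Y
  have Alin: "linear (A n)" for n
  proof (rule linearI)
    show "A n (x + y) = A n x + A n y" for x y
      by (simp add: A_def linear_add[OF Ulin[OF ul(1)]] sum.distrib scaleR_add_right)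
    show "A n (c *\<^sub>R x) = c *\<^sub>R A n x" for c x
      by (simp only: A_def linear_cmul[OF Ulin[OF ul(1)]] flip: scaleR_sum_right) (simp add: mult.commute)
  qed
  have Anorm: "norm (A n Y) \<le> norm Y" for n Y
  proof -
    have "norm (\<Sum>i<n. \<Sum>j<n. U (l i \<star> u j) Y) \<le> (\<Sum>i<n. \<Sum>j<n. norm Y)"
      by (intro sum_norm_le) (simp add: Unorm[OF ul])
    then have "norm (\<Sum>i<n. \<Sum>j<n. U (l i \<star> u j) Y) \<le> (real n)\<^sup>2 * norm Y"
      by (simp add: power2_eq_square)
    then show ?thesis by (cases "n = 0") (simp_all add: A_def divide_le_eq mult.commute)
  qed
  have orth: "\<psi> x \<bullet> \<psi> y = 0" if "x \<in> \<Gamma>" "y \<in> \<Gamma>" "\<kappa> e x = r" "\<kappa> e y = r" "\<kappa> x y = r\<^sup>2" for x y r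
    using that pos[OF base, of x] by (simp add: \<psi>(1) nker_def power2_eq_square)
  \<comment> \<open>By \<open>spread\<close>, the double sum can be arranged into \<open>n\<close>
    sums of \<open>n\<close> pairwise orthogonal vectors of norm at most 1, so it has norm at most
    \<open>n * sqrt n\<close> instead of \<open>n * n\<close>.\<close>
  have A\<psi>: "norm (A n (\<psi> g)) \<le> 1 / sqrt (real n)" if g: "g \<in> \<Gamma>" and n: "n > 0" for n g
  proof -
    have ug: "u j \<star> g \<in> \<Gamma>" "\<kappa> e (u j \<star> g) = \<kappa> e g" for j
      using closed g stab_norm[OF closed(3) ul1(1) g] by auto
    have lug: "l i \<star> (u j \<star> g) \<in> \<Gamma>" "\<kappa> e (l i \<star> (u j \<star> g)) = \<kappa> e g" for i j
      using closed ug stab_norm[OF closed(4) ul1(2) ug(1)] by auto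
    have Uul: "U (l i \<star> u j) (\<psi> g) = \<psi> (l i \<star> (u j \<star> g))" for i j
      using U\<psi>[OF ul g] by (simp add: assoc)
    have "norm (\<Sum>i<n. \<Sum>j<n. U (l i \<star> u j) (\<psi> g)) \<le> real n * sqrt (real n)"
      using spread[OF g]
    proof
      assume s: "\<forall>i j. i \<noteq> j \<longrightarrow> \<kappa> (u i \<star> g) (u j \<star> g) = (\<kappa> e g)\<^sup>2"
      have "norm (\<Sum>j<n. \<psi> (u j \<star> g)) \<le> sqrt (card {..<n})"
      proof (rule norm_sum_orthogonal_le)
        show "\<psi> (u i \<star> g) \<bullet> \<psi> (u j \<star> g) = 0" if "i \<noteq> j" for i j
          by (rule orth[OF ug(1) ug(1) ug(2) ug(2)]) (use s that in simp)
        show "\<psi> (u i \<star> g) \<bullet> \<psi> (u i \<star> g) \<le> 1" for i by (rule psi_le1[OF ug(1)])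
      qed simp
      then have b: "norm (\<Sum>j<n. \<psi> (u j \<star> g)) \<le> sqrt (real n)" by simp
      have "norm (\<Sum>j<n. U (l i \<star> u j) (\<psi> g)) \<le> sqrt (real n)" for i
      proof -
        have "(\<Sum>j<n. U (l i \<star> u j) (\<psi> g)) = U (l i) (\<Sum>j<n. \<psi> (u j \<star> g))"
          by (simp add: Ucomp U\<psi>[OF closed(3) ul1(1) g] linear_sum[OF Ulin[OF closed(4)]])
        then show ?thesis using b by (simp add: Unorm[OF closed(4) ul1(2)])
      qed
      then have "norm (\<Sum>i<n. \<Sum>j<n. U (l i \<star> u j) (\<psi> g)) \<le> (\<Sum>i<n. sqrt (real n))"
        by (intro sum_norm_le)
      then show ?thesis by simp
    next
      assume s: "\<forall>k i j. i \<noteq> j \<longrightarrow> \<kappa> (l i \<star> (u k \<star> g)) (l j \<star> (u k \<star> g)) = (\<kappa> e g)\<^sup>2"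
      have b: "norm (\<Sum>i<n. \<psi> (l i \<star> (u k \<star> g))) \<le> sqrt (card {..<n})" for k
      proof (rule norm_sum_orthogonal_le)
        show "\<psi> (l i \<star> (u k \<star> g)) \<bullet> \<psi> (l j \<star> (u k \<star> g)) = 0" if "i \<noteq> j" for i j
          by (rule orth[OF lug(1) lug(1) lug(2) lug(2)]) (use s that in simp)
        show "\<psi> (l i \<star> (u k \<star> g)) \<bullet> \<psi> (l i \<star> (u k \<star> g)) \<le> 1" for i by (rule psi_le1[OF lug(1)])
      qed simp
      have "norm (\<Sum>j<n. \<Sum>i<n. U (l i \<star> u j) (\<psi> g)) \<le> (\<Sum>j<n. sqrt (real n))"
        unfolding Uul by (intro sum_norm_le) (use b in simp)
      then show ?thesis by (subst sum.swap) simp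
    qed
    then have "norm (A n (\<psi> g)) \<le> (1 / (real n)\<^sup>2) * (real n * sqrt (real n))"
      unfolding A_def by (simp add: divide_right_mono)
    also have "\<dots> = sqrt (real n) / real n" using n by (simp add: power2_eq_square)
    also have "\<dots> = 1 / sqrt (real n)"
      using n by (simp add: field_simps)
    finally show ?thesis .
  qed
  \<comment> \<open>Convergence on the vertex vectors passes to the closed span because all averages
    are linear contractions.\<close>
  have A0: "(\<lambda>n. A n Y) \<longlonglongrightarrow> 0" for Y
  proof -
    let ?Z = "{Y. (\<lambda>n. A n Y) \<longlonglongrightarrow> 0}"
    have "closure (span (\<psi> ` \<Gamma>)) \<subseteq> ?Z"
    proof (intro closure_minimal span_minimal)
      show "\<psi> ` \<Gamma> \<subseteq> ?Z"
      proof
        fix z assume "z \<in> \<psi> ` \<Gamma>"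
        then obtain g where g: "z = \<psi> g" "g \<in> \<Gamma>" by blast
        have "(\<lambda>n. 1 / sqrt (real n)) \<longlonglongrightarrow> 0" by real_asymp
        then have "(\<lambda>n. A n (\<psi> g)) \<longlonglongrightarrow> 0"
          by (rule Lim_null_comparison[rotated])
             (use A\<psi>[OF g(2)] in \<open>auto simp: eventually_sequentially intro!: exI[of _ 1]\<close>)
        then show "z \<in> ?Z" using g by simp
      qed
      show "subspace ?Z"
        unfolding subspace_def
      proof (intro conjI ballI allI)
        show "0 \<in> ?Z" by (simp add: linear_0[OF Alin])
        show "x + y \<in> ?Z" if "x \<in> ?Z" "y \<in> ?Z" for x y
          using tendsto_add[of "\<lambda>n. A n x" 0 sequentially "\<lambda>n. A n y" 0] that by (simp add: linear_add[OF Alin])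
        show "c *\<^sub>R x \<in> ?Z" if "x \<in> ?Z" for c x
          using tendsto_scaleR[OF tendsto_const[of c], of "\<lambda>n. A n x" 0] that by (simp add: linear_cmul[OF Alin])
      qed
      show "closed ?Z"
        unfolding closed_limpt islimpt_approachable
      proof (intro allI impI)
        fix Y assume Y: "\<forall>r>0. \<exists>Y'\<in>?Z. Y' \<noteq> Y \<and> dist Y' Y < r"
        have "(\<lambda>n. A n Y) \<longlonglongrightarrow> 0"
        proof (rule LIMSEQ_I)
          fix r :: real assume r: "r > 0"
          then obtain Y' where Y': "(\<lambda>n. A n Y') \<longlonglongrightarrow> 0" "dist Y' Y < r / 2"
            using Y[rule_format, of "r / 2"] by auto
          obtain N where N: "\<forall>n\<ge>N. norm (A n Y' - 0) < r / 2"
            using LIMSEQ_D[OF Y'(1), of "r / 2"] r by auto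
          have "norm (A n Y - 0) < r" if "n \<ge> N" for n
          proof -
            have "A n Y = A n Y' + A n (Y - Y')" by (simp add: linear_add[OF Alin, symmetric])
            then have "norm (A n Y) \<le> norm (A n Y') + norm (A n (Y - Y'))" by (metis norm_triangle_ineq)
            also have "\<dots> < r / 2 + r / 2"
              using N that Anorm[of n "Y - Y'"] Y'(2) by (intro add_less_le_mono) (auto simp: dist_norm norm_minus_commute)
            finally show ?thesis by simp
          qed
          then show "\<exists>N. \<forall>n\<ge>N. norm (A n Y - 0) < r" by blast
        qed
        then show "Y \<in> ?Z" by simp
      qed
    qed
    then show ?thesis using \<psi>(2) by blast
  qed

  have irr: "W = {0} \<or> W = UNIV" if W: "subspace W" "closed W" and inv_W: "\<And>s. s \<in> \<Gamma> \<Longrightarrow> R s ` W \<subseteq> W" for W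
  proof (rule disjCI)
    assume "W \<noteq> UNIV"
    show "W = {0}"
    proof (rule ccontr)
      assume "W \<noteq> {0}"
      then obtain X where X: "X \<in> W" "X \<noteq> 0" using subspace_0[OF W(1)] by blast
      have "\<exists>g\<in>\<Gamma>. hform X (f g) \<noteq> 0"
      proof (rule ccontr)
        assume c: "\<not> (\<exists>g\<in>\<Gamma>. hform X (f g) \<noteq> 0)"
        have "closure (span (f ` \<Gamma>)) \<subseteq> {Z. hform X Z = 0}"
        proof (intro closure_minimal span_minimal)
          show "f ` \<Gamma> \<subseteq> {Z. hform X Z = 0}" using c by auto
          show "subspace {Z. hform X Z = 0}" by (simp add: subspace_def hform_add hform_scale)
          show "closed {Z. hform X Z = 0}" by (intro closed_Collect_eq continuous_intros)
        qed
        \<comment> \<open>The sign change in the second component turns the form into the inner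
          product, so this says \<open>X \<bullet> X = 0\<close>.\<close>
        then have "hform X (fst X, - snd X) = 0" using fdense by blast
        then have "X \<bullet> X = 0" by (simp add: hform_inner)
        then show False using X by simp
      qed
      then obtain g where g: "g \<in> \<Gamma>" "hform X (f g) \<noteq> 0" by blast
      \<comment> \<open>Moving the vertex of \<open>g\<close> to the base vertex makes the first
        coordinate nonzero. The averages keep this coordinate and let the other component tend to
        0.\<close>
      define X' where "X' = R (inverse_of g) X"
      have ig: "inverse_of g \<in> \<Gamma>" using closed g by simp
      have X'W: "X' \<in> W" using inv_W[OF ig] X by (auto simp: X'_def)
      have "R (inverse_of g) (f g) = (1, 0)"
        using Rf[OF ig g(1)] inv(1)[OF g(1)] f_e[OF base diag[OF base]] by simp
      then have "hform X' (1, 0) \<noteq> 0" using Rform[OF ig, of X "f g"] g(2) by (simp add: X'_def)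
      then have c: "fst X' \<noteq> 0" by (simp add: hform_def)
      have avg: "(fst X', A n (snd X')) \<in> W" if "n > 0" for n
      proof -
        have "(\<Sum>i<n. \<Sum>j<n. R (l i \<star> u j) X') \<in> W"
          using inv_W[OF ul(1)] X'W by (intro subspace_sum[OF W(1)]) blast
        moreover have "R (l i \<star> u j) X' = (fst X', U (l i \<star> u j) (snd X'))" for i j
          using RU[OF ul, of i j "fst X'" "snd X'"] by simp
        moreover have "(\<Sum>i\<in>I. (c i :: real, d i :: 'h)) = (sum c I, sum d I)" for c d and I :: "nat set"
          by (simp add: prod_eq_iff fst_sum snd_sum)
        ultimately have "(real n * (real n * fst X'), \<Sum>i<n. \<Sum>j<n. U (l i \<star> u j) (snd X')) \<in> W" by simp
        from subspace_scale[OF W(1) this, of "1 / (real n)\<^sup>2"]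
        show ?thesis using that by (simp add: A_def power2_eq_square)
      qed
      have "(\<lambda>n. (fst X', A (Suc n) (snd X'))) \<longlonglongrightarrow> (fst X', 0)"
        by (intro tendsto_Pair tendsto_const LIMSEQ_Suc[OF A0])
      then have "(fst X', 0) \<in> W"
        by (rule closed_sequentially[OF W(2), rotated]) (rule avg, simp)
      from subspace_scale[OF W(1) this, of "1 / fst X'"] c have "(1, 0) \<in> W" by simp
      then have "f s \<in> W" if "s \<in> \<Gamma>" for s using inv_W[OF that] Re[OF that] by (metis image_subset_iff)
      then have "closure (span (f ` \<Gamma>)) \<subseteq> W" using W by (intro closure_minimal span_minimal) auto
      then show False using fdense \<open>W \<noteq> UNIV\<close> by auto
    qed
  qed
  show ?thesis
  proof (intro exI[of _ R] conjI ballI impI allI)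
    show "R s \<in> O_form" if "s \<in> \<Gamma>" for s by (rule R[OF that])
    show "R (s \<star> t) = R s \<circ> R t" if "s \<in> \<Gamma>" "t \<in> \<Gamma>" for s t by (rule Rcomp[OF that])
    show "R s (1, 0) = R t (1, 0)" if "s \<in> \<Gamma>" "t \<in> \<Gamma>" "\<kappa> s t = 1" for s t
      using Re f_eq that by simp
    show "R s = R t" if st: "s \<in> \<Gamma>" "t \<in> \<Gamma>" "\<forall>g\<in>\<Gamma>. \<kappa> (s \<star> g) (t \<star> g) = 1" for s t
    proof (rule O_form_total_eq[OF R[OF st(1)] R[OF st(2)] fdense])
      fix z assume "z \<in> f ` \<Gamma>"
      then obtain x where x: "z = f x" "x \<in> \<Gamma>" by blast
      show "R s z = R t z" using x st f_eq[OF closed(1) closed(1)] by (simp add: Rf)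
    qed
    show "W = {0} \<or> W = UNIV" if "subspace W \<and> closed W \<and> (\<forall>s\<in>\<Gamma>. R s ` W \<subseteq> W)" for W
      using irr that by blast
  qed
qed

end

section \<open>Matrices over a valued field\<close>

type_synonym mat2 = "complex \<times> complex \<times> complex \<times> complex"

fun mmul :: "mat2 \<Rightarrow> mat2 \<Rightarrow> mat2" where
  "mmul (a, b, c, d) (a', b', c', d') = (a * a' + b * c', a * b' + b * d', c * a' + d * c', c * b' + d * d')"

fun mdet :: "mat2 \<Rightarrow> complex" where
  "mdet (a, b, c, d) = a * d - b * c"

fun mneg :: "mat2 \<Rightarrow> mat2" where
  "mneg (a, b, c, d) = (- a, - b, - c, - d)"

definition mone :: mat2 where
  "mone = (1, 0, 0, 1)"

text \<open>This is the inverse only if the determinant is \<open>1\<close> or \<open>-1\<close>.\<close>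

fun minv :: "mat2 \<Rightarrow> mat2" where
  "minv (a, b, c, d) = (let e = a * d - b * c in (e * d, - e * b, - e * c, e * a))"

fun mcol :: "mat2 \<Rightarrow> bool \<Rightarrow> complex \<times> complex" where
  "mcol (a, b, c, d) i = (if i then (a, c) else (b, d))"

definition cdet :: "complex \<times> complex \<Rightarrow> complex \<times> complex \<Rightarrow> complex" where
  "cdet p q = fst p * snd q - snd p * fst q"

lemma mmul_assoc: "mmul (mmul g h) k = mmul g (mmul h k)"
  by (cases g; cases h; cases k) (simp add: algebra_simps)

lemma mmul_one [simp]: "mmul mone g = g" "mmul g mone = g"
  by (cases g; simp add: mone_def)+

lemma mdet_mmul: "mdet (mmul g h) = mdet g * mdet h"
  by (cases g; cases h) (simp add: algebra_simps)

lemma mmul_minv: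
  assumes "mdet g = 1 \<or> mdet g = -1"
  shows "mmul (minv g) g = mone" "mmul g (minv g) = mone"
proof -
  obtain a b c d where g: "g = (a, b, c, d)" by (cases g)
  define e where "e = a * d - b * c"
  have "e = 1 \<or> e = -1" using assms g by (simp add: e_def)
  then have "e * e = 1" by auto
  then have e: "e * (a * d - b * c) = 1" by (simp add: e_def)
  have m: "minv g = (e * d, - e * b, - e * c, e * a)" unfolding g e_def minv.simps Let_def by (rule refl)
  show "mmul (minv g) g = mone" "mmul g (minv g) = mone"
    using e unfolding m unfolding g mone_def by (simp_all add: algebra_simps)
qed

lemma plucker: "cdet p q * cdet r s = cdet p r * cdet q s + cdet r q * cdet p s"
  by (simp add: cdet_def algebra_simps)

lemma cdet_flip: "cdet p q = - cdet q p"
  by (simp add: cdet_def)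

lemma cdet_mmul: "cdet (mcol (mmul s g) i) (mcol (mmul s h) j) = mdet s * cdet (mcol g i) (mcol h j)"
  by (cases s; cases g; cases h; cases i; cases j) (simp_all add: cdet_def algebra_simps)

section \<open>The kernel of matrices over the valued field\<close>

context valued_complex
begin

lemma v1: "v 1 = 1"
  using vnat[of 1] by simp

lemma vneg: "v (- x) = v x"
proof -
  have "v (-1) * v (-1) = 1" using vmult[of "-1" "-1"] v1 by simp
  then have "v (-1) = 1" using vpos[of "-1"] by (auto simp: square_eq_1_iff)
  then show ?thesis using vmult[of "-1" x] by simp
qed

lemma vnonneg: "v x \<ge> 0"
  using vpos[of x] by (cases "x = 0") auto

lemma vpow: "v (x ^ n) = v x ^ n"
  by (induction n) (simp_all add: v1 vmult)

lemma vadd_le: "v x \<le> B \<Longrightarrow> v y \<le> B \<Longrightarrow> v (x + y) \<le> B"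
  using vadd[of x y] by auto

lemma vadd_eq:
  assumes "v y < v x"
  shows "v (x + y) = v x"
proof (rule antisym)
  show "v (x + y) \<le> v x" using assms by (intro vadd_le) auto
  have "v x \<le> max (v (x + y)) (v (- y))" using vadd[of "x + y" "- y"] by simp
  then show "v x \<le> v (x + y)" using assms by (simp add: vneg)
qed

text \<open>This is the maximum of the values of the entries of \<open>g\<inverse> h\<close>, up to the value of the determinant of
  \<open>g\<close>.  The ultrametric Ptolemy inequality \<open>mker_four_point\<close> is the Pluecker relation of columns.\<close>

definition mker :: "mat2 \<Rightarrow> mat2 \<Rightarrow> real" where
  "mker g h = Max (range (\<lambda>(i, j). v (cdet (mcol g i) (mcol h j))))"

lemma mker_ge: "v (cdet (mcol g i) (mcol h j)) \<le> mker g h"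
  unfolding mker_def by (rule Max_ge) (auto intro!: image_eqI[of _ _ "(i, j)"])

lemma mker_attained: "\<exists>i j. mker g h = v (cdet (mcol g i) (mcol h j))"
proof -
  have "mker g h \<in> range (\<lambda>(i, j). v (cdet (mcol g i) (mcol h j)))"
    unfolding mker_def by (rule Max_in) auto
  then show ?thesis by auto
qed

lemma mker_le: "(\<And>i j. v (cdet (mcol g i) (mcol h j)) \<le> B) \<Longrightarrow> mker g h \<le> B"
  using mker_attained[of g h] by auto

lemma mker_nonneg: "mker g h \<ge> 0"
  using mker_attained[of g h] vnonneg by auto

lemma mker_sym: "mker g h = mker h g"
proof -
  have "mker g h \<le> mker h g" for g h
  proof (rule mker_le)
    fix i j
    show "v (cdet (mcol g i) (mcol h j)) \<le> mker h g"
      unfolding cdet_flip[of "mcol g i"] vneg by (rule mker_ge)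
  qed
  then show ?thesis using order_antisym by blast
qed

lemma mker_diag: "mker g g = v (mdet g)"
proof (rule antisym)
  show "mker g g \<le> v (mdet g)"
  proof (rule mker_le)
    fix i j
    show "v (cdet (mcol g i) (mcol g j)) \<le> v (mdet g)"
      using vneg[of "mdet g"] vnonneg[of "mdet g"]
      by (cases g; cases i; cases j) (simp_all add: cdet_def algebra_simps)
  qed
  have "cdet (mcol g True) (mcol g False) = mdet g" by (cases g) (simp add: cdet_def)
  then show "v (mdet g) \<le> mker g g" using mker_ge by metis
qed

lemma mker_invariant: "mker (mmul s g) (mmul s h) = v (mdet s) * mker g h"
proof (rule antisym)
  show "mker (mmul s g) (mmul s h) \<le> v (mdet s) * mker g h"
    by (rule mker_le) (simp add: cdet_mmul vmult mult_left_mono mker_ge vnonneg)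
  obtain i j where "mker g h = v (cdet (mcol g i) (mcol h j))" using mker_attained by blast
  then have "v (mdet s) * mker g h = v (cdet (mcol (mmul s g) i) (mcol (mmul s h) j))"
    by (simp add: cdet_mmul vmult)
  then show "v (mdet s) * mker g h \<le> mker (mmul s g) (mmul s h)" using mker_ge by metis
qed

lemma mker_four_point: "mker x y * mker w z \<le> max (mker x z * mker w y) (mker z y * mker w x)"
proof -
  obtain i j where ij: "mker x y = v (cdet (mcol x i) (mcol y j))" using mker_attained by blast
  obtain k m where km: "mker z w = v (cdet (mcol z k) (mcol w m))" using mker_attained by blast
  have "mker x y * mker w z = v (cdet (mcol x i) (mcol y j) * cdet (mcol z k) (mcol w m))"
    using ij km mker_sym[of w z] by (simp add: vmult)
  also have "\<dots> \<le> max (v (cdet (mcol x i) (mcol z k) * cdet (mcol y j) (mcol w m)))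
      (v (cdet (mcol z k) (mcol y j) * cdet (mcol x i) (mcol w m)))"
    by (subst plucker[of "mcol x i" "mcol y j"]) (rule vadd)
  also have "\<dots> \<le> max (mker x z * mker y w) (mker z y * mker x w)"
    unfolding vmult by (intro max.mono mult_mono mker_ge vnonneg mker_nonneg)
  finally show ?thesis by (simp add: mker_sym[of w])
qed

lemma mker_one: "mker mone (a, b, c, d) = max (max (v a) (v b)) (max (v c) (v d))"
proof (rule antisym)
  show "mker mone (a, b, c, d) \<le> max (max (v a) (v b)) (max (v c) (v d))"
  proof (rule mker_le)
    fix i j
    show "v (cdet (mcol mone i) (mcol (a, b, c, d) j)) \<le> max (max (v a) (v b)) (max (v c) (v d))"
      by (cases i; cases j) (auto simp: mone_def cdet_def vneg)
  qed
  have "v a \<le> mker mone (a, b, c, d)" using mker_ge[of mone False "(a, b, c, d)" True]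
    by (simp add: mone_def cdet_def vneg)
  moreover have "v b \<le> mker mone (a, b, c, d)" using mker_ge[of mone False "(a, b, c, d)" False]
    by (simp add: mone_def cdet_def vneg)
  moreover have "v c \<le> mker mone (a, b, c, d)" using mker_ge[of mone True "(a, b, c, d)" True]
    by (simp add: mone_def cdet_def)
  moreover have "v d \<le> mker mone (a, b, c, d)" using mker_ge[of mone True "(a, b, c, d)" False]
    by (simp add: mone_def cdet_def)
  ultimately show "max (max (v a) (v b)) (max (v c) (v d)) \<le> mker mone (a, b, c, d)" by simp
qed

text \<open>An element of prescribed value rescales a ball to radius 1, where its centre can be
  rounded into the countable set \<open>D\<close> by \<open>vnear\<close>.\<close>

definition vrep :: "real \<Rightarrow> complex" where
  "vrep r = (SOME x. v x = r)"

definition vnear :: "complex \<Rightarrow> complex" where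
  "vnear x = (SOME d. d \<in> D \<and> v (x - d) \<le> 1)"

lemma vrep: "v (vrep (v x)) = v x"
  unfolding vrep_def by (rule someI[of _ x]) simp

lemma vnear: "vnear x \<in> D" "v (x - vnear x) \<le> 1"
  using someI_ex[of "\<lambda>d. d \<in> D \<and> v (x - d) \<le> 1"] D(2)[of x] unfolding vnear_def by blast+

text \<open>The point fixed by the integral matrices corresponds to the unit ball; its image under a matrix
  is the ball with centre the larger ratio of the entries of a column and with radius the inverse
  square of the value of the lower entry, and \<open>mball\<close> records the ball.\<close>

fun mball :: "mat2 \<Rightarrow> bool \<times> real \<times> complex" where
  "mball (a, b, c, d) = (if v c \<le> v d then (True, v d, vnear ((vrep (v d))\<^sup>2 * (b / d)))
     else (False, v c, vnear ((vrep (v c))\<^sup>2 * (a / c))))"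

text \<open>\<open>p\<close> and \<open>p'\<close> are the columns with the larger lower entries.
  Equal rounded centres mean that the centres differ by at most the common radius, the inverse
  square of \<open>v (snd p)\<close>, and this bounds \<open>cdet p p'\<close>. The other three
  bounds follow by the Pluecker relation, as both matrices have determinants of value 1 and the
  remaining lower entries are no larger.\<close>

lemma same_ball:
  assumes "snd p \<noteq> 0" "v (snd p') = v (snd p)" "v (snd q) \<le> v (snd p)" "v (snd q') \<le> v (snd p)"
    and q: "v (cdet q p) = 1" "v (cdet q' p') = 1"
    and near: "vnear ((vrep (v (snd p)))\<^sup>2 * (fst p / snd p)) = vnear ((vrep (v (snd p)))\<^sup>2 * (fst p' / snd p'))"
  shows "v (cdet p p') \<le> 1 \<and> v (cdet q p') \<le> 1 \<and> v (cdet p q') \<le> 1 \<and> v (cdet q q') \<le> 1"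
proof -
  define r where "r = v (snd p)"
  have r: "r > 0" using vpos assms(1) by (simp add: r_def)
  have p0: "snd p' \<noteq> 0" using r assms(2) v0 unfolding r_def by (metis less_irrefl)
  let ?w = "(vrep (v (snd p)))\<^sup>2"
  have vw: "v ?w = r\<^sup>2" by (simp add: vpow vrep r_def)
  have "v (?w * (fst p / snd p) - ?w * (fst p' / snd p')) \<le> 1"
  proof -
    have "?w * (fst p / snd p) - ?w * (fst p' / snd p') =
        (?w * (fst p / snd p) - vnear (?w * (fst p / snd p))) +
        - (?w * (fst p' / snd p') - vnear (?w * (fst p' / snd p')))" using near by simp
    then show ?thesis using vadd_le vnear(2) vneg by metis
  qed
  then have "r\<^sup>2 * v (fst p / snd p - fst p' / snd p') \<le> 1"
    by (simp only: right_diff_distrib[symmetric] vmult vw)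
  moreover have "cdet p p' = snd p * snd p' * (fst p / snd p - fst p' / snd p')"
    using assms(1) p0 by (simp add: cdet_def field_simps)
  ultimately have pp: "v (cdet p p') \<le> 1" using assms(2) by (simp add: vmult power2_eq_square r_def)
  have le: "v (cdet y z) \<le> 1"
    if "snd x \<noteq> 0" "v (snd x) = r" "v (snd y) \<le> r" "v (snd z) \<le> r" "v (cdet y x) = 1" "v (cdet x z) \<le> 1" for x y z
  proof -
    \<comment> \<open>The Pluecker relation with (1, 0) as fourth vector, whose determinants with
      the others are their lower entries.\<close>
    have "cdet y z * snd x = snd y * cdet x z + cdet y x * snd z" by (simp add: cdet_def algebra_simps)
    then have "v (cdet y z) * r = v (snd y * cdet x z + cdet y x * snd z)"
      by (simp only: vmult[symmetric] that(2)[symmetric])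
    also have "\<dots> \<le> r"
    proof (rule vadd_le)
      have "v (snd y) * v (cdet x z) \<le> r * 1" using that r by (intro mult_mono) (auto simp: vnonneg)
      then show "v (snd y * cdet x z) \<le> r" by (simp add: vmult)
    qed (use that in \<open>simp add: vmult\<close>)
    finally show ?thesis using r by simp
  qed
  have qp: "v (cdet q p') \<le> 1" using le[of p q p'] assms pp by (simp add: r_def)
  have "v (cdet q' p) \<le> 1" using le[of p' q' p] assms pp p0 cdet_flip[of p' p] vneg by (simp add: r_def)
  then have pq: "v (cdet p q') \<le> 1" using cdet_flip[of p q'] vneg by simp
  then have "v (cdet q q') \<le> 1" using le[of p q q'] assms by (simp add: r_def)
  then show ?thesis using pp qp pq by blast
qed

text \<open>As a tree kernel is at least 1, matrices with the same ball represent the same vertex;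
  so balls serve as countable codes.\<close>

lemma mker_le_1_if_mball_eq:
  assumes "v (mdet g) = 1" "v (mdet h) = 1" "mball g = mball h"
  shows "mker g h \<le> 1"
proof -
  obtain a b c d where g: "g = (a, b, c, d)" by (cases g)
  obtain a' b' c' d' where h: "h = (a', b', c', d')" by (cases h)
  have dets: "v (cdet (a, c) (b, d)) = 1" "v (cdet (b, d) (a, c)) = 1"
    "v (cdet (a', c') (b', d')) = 1" "v (cdet (b', d') (a', c')) = 1"
    using assms(1,2) vneg[of "a * d - b * c"] vneg[of "a' * d' - b' * c'"] unfolding g h
    by (simp_all add: cdet_def algebra_simps)
  have nz: "\<not> (c = 0 \<and> d = 0)" using assms(1) g by auto
  have "\<forall>i j. v (cdet (mcol g i) (mcol h j)) \<le> 1"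
  proof (cases "v c \<le> v d")
    case True
    then have T: "v c' \<le> v d'" "v d = v d'"
      "vnear ((vrep (v d))\<^sup>2 * (b / d)) = vnear ((vrep (v d'))\<^sup>2 * (b' / d'))"
      using assms(3) unfolding g h by (auto split: if_splits)
    have "d \<noteq> 0"
    proof
      assume "d = 0"
      then have "v c \<le> 0" using True by simp
      then show False using nz \<open>d = 0\<close> vpos[of c] by fastforce
    qed
    then have "v (cdet (b, d) (b', d')) \<le> 1 \<and> v (cdet (a, c) (b', d')) \<le> 1 \<and>
      v (cdet (b, d) (a', c')) \<le> 1 \<and> v (cdet (a, c) (a', c')) \<le> 1"
      using True T dets by (intro same_ball) auto
    then show ?thesis unfolding g h by auto
  next
    case False
    then have T: "\<not> v c' \<le> v d'" "v c = v c'"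
      "vnear ((vrep (v c))\<^sup>2 * (a / c)) = vnear ((vrep (v c'))\<^sup>2 * (a' / c'))"
      using assms(3) unfolding g h by (auto split: if_splits)
    have "c \<noteq> 0" using False vnonneg[of d] by auto
    then have "v (cdet (a, c) (a', c')) \<le> 1 \<and> v (cdet (b, d) (a', c')) \<le> 1 \<and>
      v (cdet (a, c) (b', d')) \<le> 1 \<and> v (cdet (b, d) (b', d')) \<le> 1"
      using False T dets by (intro same_ball) auto
    then show ?thesis unfolding g h by auto
  qed
  then show ?thesis by (intro mker_le) blast
qed

end

section \<open>Integral shears and the groups to be represented\<close>

definition upper :: "nat \<Rightarrow> mat2" where "upper n = (1, of_nat n, 0, 1)"

definition lower :: "nat \<Rightarrow> mat2" where "lower n = (1, 0, of_nat n, 1)"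

text \<open>The determinants 1 and -1 have value 1, so left multiplication preserves the kernel. The
  real diagonal matrices provide vertices arbitrarily far from the base vertex.\<close>

locale matrix_group =
  fixes \<Gamma> :: "mat2 set"
  assumes mone: "mone \<in> \<Gamma>" and mmul: "g \<in> \<Gamma> \<Longrightarrow> h \<in> \<Gamma> \<Longrightarrow> mmul g h \<in> \<Gamma>"
    and minv: "g \<in> \<Gamma> \<Longrightarrow> minv g \<in> \<Gamma>" and mdet: "g \<in> \<Gamma> \<Longrightarrow> mdet g = 1 \<or> mdet g = -1"
    and upper: "upper n \<in> \<Gamma>" and lower: "lower n \<in> \<Gamma>"
    and mdiag: "t \<noteq> 0 \<Longrightarrow> (complex_of_real t, 0, 0, complex_of_real (inverse t)) \<in> \<Gamma>"

lemma upper_add: "upper (i + j) = mmul (upper i) (upper j)"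
  and lower_add: "lower (i + j) = mmul (lower i) (lower j)"
  by (simp_all add: upper_def lower_def)

context valued_complex
begin

text \<open>A group of real matrices needs large values on the reals. Since \<open>\<i>\<close>
  squares to -1, it has value 1, so a bound by 1 on the reals would extend to all complex
  numbers.\<close>

lemma real_vbig: "\<exists>t :: real. v (of_real t) > 1"
proof (rule ccontr)
  assume "\<not> ?thesis"
  then have r: "v (of_real t) \<le> 1" for t by (simp add: not_less)
  obtain x where x: "v x > 1" using vbig by blast
  have "v \<i> ^ 2 = 1" using vpow[of \<i> 2] vneg[of 1] v1 by simp
  then have "v \<i> = 1" using vnonneg[of \<i>] by (simp add: power2_eq_1_iff)
  then have "v (of_real (Re x) + \<i> * of_real (Im x)) \<le> 1" by (intro vadd_le) (simp_all add: vmult r)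
  then show False using x by (simp flip: complex_eq)
qed

text \<open>\<open>mker\<close> satisfies the axioms of \<open>tree_group\<close> with the upper and
  lower integral shears as the two families. Which family spreads a vertex depends on the row that
  contains an entry of largest value.\<close>

theorem matrix_group_representation:
  assumes \<Gamma>: "matrix_group \<Gamma>"
    and H: "\<exists>S :: 'h::{real_inner, banach} set. hilbert_basis S \<and> countable S \<and> infinite S"
  shows "\<exists>R :: mat2 \<Rightarrow> real \<times> 'h \<Rightarrow> real \<times> 'h.
    (\<forall>s\<in>\<Gamma>. R s \<in> O_form) \<and> (\<forall>s\<in>\<Gamma>. \<forall>t\<in>\<Gamma>. R (mmul s t) = R s \<circ> R t) \<and>
    countable {R s (1, 0) | s. s \<in> \<Gamma>} \<and> (\<forall>s\<in>\<Gamma>. mneg s \<in> \<Gamma> \<longrightarrow> R (mneg s) = R s) \<and>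
    (\<forall>W. subspace W \<and> closed W \<and> (\<forall>s\<in>\<Gamma>. R s ` W \<subseteq> W) \<longrightarrow> W = {0} \<or> W = UNIV)"
proof -
  interpret G: matrix_group \<Gamma> by (rule \<Gamma>)
  have vdet: "v (mdet g) = 1" if "g \<in> \<Gamma>" for g
    using G.mdet[OF that] v1 vneg[of 1] by auto
  interpret K: tree_kernel \<Gamma> mker mone
  proof unfold_locales
    show "mone \<in> \<Gamma>" by (rule G.mone)
    show "mker x y = mker y x" for x y by (rule mker_sym)
    show "mker x x = 1" if "x \<in> \<Gamma>" for x using mker_diag vdet[OF that] by simp
    show "0 \<le> mker x y" for x y by (rule mker_nonneg)
    show "mker x y * mker w z \<le> max (mker x z * mker w y) (mker z y * mker w x)" for x y z w
      by (rule mker_four_point)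
  qed
  have inv: "mker (mmul s g) (mmul s h) = mker g h" if "s \<in> \<Gamma>" for s g h
    using mker_invariant vdet[OF that] by simp
  have ul1: "mker mone (upper n) = 1" "mker mone (lower n) = 1" for n
    unfolding upper_def lower_def mker_one using vnat[of n] v1 by (cases "n = 0"; simp)+
  have stab: "mker mone (mmul k g) = mker mone g" if "k \<in> \<Gamma>" "mker mone k = 1" "g \<in> \<Gamma>" for k g
    using K.equiv_cong[of mone k "mmul k g"] inv[of k mone g] G.mone G.mmul that by simp
  have le2: "mker g (mmul k g) \<le> (mker mone g)\<^sup>2" if "k \<in> \<Gamma>" "mker mone k = 1" "g \<in> \<Gamma>" for k g
    using K.submult[of g "mmul k g" mone] stab[OF that] G.mone G.mmul that mker_sym[of g mone]
    by (simp add: power2_eq_square)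
  \<comment> \<open>The determinant of a column with its own shear is minus \<open>n\<close> times
    the square of its lower entry. As \<open>n\<close> has value 1, it attains the upper bound
    \<open>le2\<close> when this entry has the largest value.\<close>
  have up: "mker g (mmul (upper n) g) = (mker mone g)\<^sup>2"
    if g: "g \<in> \<Gamma>" and n: "n > 0" and i: "v (snd (mcol g i)) = mker mone g" for g n i
  proof (rule antisym)
    show "mker g (mmul (upper n) g) \<le> (mker mone g)\<^sup>2" by (rule le2[OF G.upper ul1(1) g])
    have "cdet (mcol g i) (mcol (mmul (upper n) g) i) = - of_nat n * (snd (mcol g i))\<^sup>2"
      by (cases g; cases i) (simp_all add: upper_def cdet_def power2_eq_square algebra_simps)
    then have "v (cdet (mcol g i) (mcol (mmul (upper n) g) i)) = (mker mone g)\<^sup>2"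
      by (simp add: vneg vmult vpow vnat n i)
    then show "(mker mone g)\<^sup>2 \<le> mker g (mmul (upper n) g)" using mker_ge by metis
  qed
  have low: "mker g (mmul (lower n) g) = (mker mone g)\<^sup>2"
    if g: "g \<in> \<Gamma>" and n: "n > 0" and i: "v (fst (mcol g i)) = mker mone g" for g n i
  proof (rule antisym)
    show "mker g (mmul (lower n) g) \<le> (mker mone g)\<^sup>2" by (rule le2[OF G.lower ul1(2) g])
    have "cdet (mcol g i) (mcol (mmul (lower n) g) i) = of_nat n * (fst (mcol g i))\<^sup>2"
      by (cases g; cases i) (simp_all add: lower_def cdet_def power2_eq_square algebra_simps)
    then have "v (cdet (mcol g i) (mcol (mmul (lower n) g) i)) = (mker mone g)\<^sup>2"
      by (simp add: vneg vmult vpow vnat n i)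
    then show "(mker mone g)\<^sup>2 \<le> mker g (mmul (lower n) g)" using mker_ge by metis
  qed
  have pairs: "mker (mmul (w i) g) (mmul (w j) g) = (mker mone g)\<^sup>2"
    if w: "\<And>i. w i \<in> \<Gamma>" "\<And>i j. w (i + j) = mmul (w i) (w j)"
      and s: "\<And>n. n > 0 \<Longrightarrow> mker g (mmul (w n) g) = (mker mone g)\<^sup>2" and ij: "i \<noteq> j" for w g and i j :: nat
  proof -
    have *: "mker (mmul (w i) g) (mmul (w j) g) = (mker mone g)\<^sup>2" if "i < j" for i j
    proof -
      have "w j = mmul (w i) (w (j - i))" using w(2)[of i "j - i"] that by simp
      then have "mker (mmul (w i) g) (mmul (w j) g) = mker (mmul (w i) g) (mmul (w i) (mmul (w (j - i)) g))"
        by (simp add: mmul_assoc)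
      also have "\<dots> = mker g (mmul (w (j - i)) g)" by (rule inv[OF w(1)])
      finally show ?thesis using s that by simp
    qed
    show ?thesis using ij *[of i j] *[of j i] mker_sym[of "mmul (w i) g"] by (cases "i < j") auto
  qed
  have spread: "(\<forall>i j. i \<noteq> j \<longrightarrow> mker (mmul (upper i) g) (mmul (upper j) g) = (mker mone g)\<^sup>2) \<or>
      (\<forall>k i j. i \<noteq> j \<longrightarrow> mker (mmul (lower i) (mmul (upper k) g)) (mmul (lower j) (mmul (upper k) g)) = (mker mone g)\<^sup>2)"
    if g: "g \<in> \<Gamma>" for g
  proof (cases "\<exists>i. v (snd (mcol g i)) = mker mone g")
    case True
    then obtain i where i: "v (snd (mcol g i)) = mker mone g" by blast
    show ?thesis using pairs[OF G.upper upper_add up[OF g _ i]] by blast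
  next
    case False
    obtain a b c d where gd: "g = (a, b, c, d)" by (cases g)
    have ne: "v c \<noteq> mker mone g" "v d \<noteq> mker mone g"
      using False gd by (metis (full_types) mcol.simps snd_conv)+
    \<comment> \<open>The largest entries now lie in the top row only. Adding a multiple of the
      strictly smaller bottom row leaves their value unchanged, so the lower shears spread the
      vertex after every \<open>upper k\<close>.\<close>
    have lt: "v c < mker mone g" "v d < mker mone g" using ne unfolding gd mker_one by auto
    have "v a = mker mone g \<or> v b = mker mone g" using ne unfolding gd mker_one by (auto simp: max_def split: if_splits)
    then have ex: "\<exists>i. v (fst (mcol (mmul (upper k) g) i)) = mker mone (mmul (upper k) g)" for k
    proof
      have vk: "v (of_nat k * y) \<le> v y" for y using vnat[of k] vnonneg[of y] by (cases "k = 0") (simp_all add: vmult)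
      have m: "mker mone (mmul (upper k) g) = mker mone g" by (rule stab[OF G.upper ul1(1) g])
      show ?thesis if a: "v a = mker mone g"
      proof (rule exI[of _ True])
        have "v (a + of_nat k * c) = v a" by (rule vadd_eq) (use vk[of c] lt a in linarith)
        then show "v (fst (mcol (mmul (upper k) g) True)) = mker mone (mmul (upper k) g)"
          unfolding m using a by (simp add: gd upper_def)
      qed
      show ?thesis if b: "v b = mker mone g"
      proof (rule exI[of _ False])
        have "v (b + of_nat k * d) = v b" by (rule vadd_eq) (use vk[of d] lt b in linarith)
        then show "v (fst (mcol (mmul (upper k) g) False)) = mker mone (mmul (upper k) g)"
          unfolding m using b by (simp add: gd upper_def)
      qed
    qed
    have "mker (mmul (lower i) (mmul (upper k) g)) (mmul (lower j) (mmul (upper k) g)) = (mker mone g)\<^sup>2"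
      if "i \<noteq> j" for i j k
    proof -
      obtain m where m: "v (fst (mcol (mmul (upper k) g) m)) = mker mone (mmul (upper k) g)" using ex by blast
      have ug: "mmul (upper k) g \<in> \<Gamma>" by (intro G.mmul G.upper g)
      show ?thesis
        using pairs[OF G.lower lower_add low[OF ug _ m] that] stab[OF G.upper ul1(1) g] by simp
    qed
    then show ?thesis by blast
  qed
  interpret T: tree_group \<Gamma> mker mone mmul minv upper lower
  proof unfold_locales
    show "mmul (minv x) x = mone" "mmul x (minv x) = mone" if "x \<in> \<Gamma>" for x
      using mmul_minv[OF G.mdet[OF that]] by auto
    show "mker (mmul s x) (mmul s y) = mker x y" if "s \<in> \<Gamma>" for s x y by (rule inv[OF that])
  qed (use G.mmul G.minv G.upper G.lower mmul_assoc ul1 spread in auto)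
  define B where "B = (UNIV :: bool set) \<times> range v \<times> D"
  have cB: "countable B" unfolding B_def using vcount D(1) by (intro countable_SIGMA) auto
  have mB: "mball g \<in> B" for g by (cases g) (auto simp: B_def vnear)
  define code where "code g = to_nat_on B (mball g)" for g
  have code: "mker g h = 1" if "g \<in> \<Gamma>" "h \<in> \<Gamma>" "code g = code h" for g h
  proof -
    have "mball g = mball h" using that(3) inj_on_to_nat_on[OF cB] mB unfolding code_def inj_on_def by blast
    then have "mker g h \<le> 1" by (intro mker_le_1_if_mball_eq vdet that)
    then show ?thesis using K.ge1[OF that(1,2)] by simp
  qed
  have unb: "\<exists>x\<in>\<Gamma>. mker mone x > r" for r
  proof -
    obtain t where t: "v (of_real t) > 1" using real_vbig by blast
    obtain n where n: "r < v (of_real t) ^ n" using real_arch_pow[OF t] by blast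
    let ?x = "(complex_of_real (t ^ n), 0, 0, complex_of_real (inverse (t ^ n)))"
    have "t \<noteq> 0" using t by auto
    then have "?x \<in> \<Gamma>" by (intro G.mdiag) simp
    moreover have "v (of_real (t ^ n)) \<le> mker mone ?x" unfolding mker_one by simp
    then have "mker mone ?x > r" using n by (simp add: vpow)
    ultimately show ?thesis by blast
  qed
  obtain R :: "mat2 \<Rightarrow> real \<times> 'h \<Rightarrow> real \<times> 'h" where
    R0: "(\<forall>s\<in>\<Gamma>. R s \<in> O_form) \<and> (\<forall>s\<in>\<Gamma>. \<forall>t\<in>\<Gamma>. R (mmul s t) = R s \<circ> R t) \<and>
      (\<forall>s\<in>\<Gamma>. \<forall>t\<in>\<Gamma>. mker s t = 1 \<longrightarrow> R s (1, 0) = R t (1, 0)) \<and>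
      (\<forall>s\<in>\<Gamma>. \<forall>t\<in>\<Gamma>. (\<forall>g\<in>\<Gamma>. mker (mmul s g) (mmul t g) = 1) \<longrightarrow> R s = R t) \<and>
      (\<forall>W. subspace W \<and> closed W \<and> (\<forall>s\<in>\<Gamma>. R s ` W \<subseteq> W) \<longrightarrow> W = {0} \<or> W = UNIV)"
    by (rule exE, rule T.irreducible_representation[where code = code, OF H], erule (2) code, rule unb, rule that)
  note R = R0[THEN conjunct1] R0[THEN conjunct2, THEN conjunct1]
    R0[THEN conjunct2, THEN conjunct2, THEN conjunct1]
    R0[THEN conjunct2, THEN conjunct2, THEN conjunct2, THEN conjunct1]
    R0[THEN conjunct2, THEN conjunct2, THEN conjunct2, THEN conjunct2]
  have cnt: "countable {R s (1, 0) | s. s \<in> \<Gamma>}"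
  proof -
    have "{R s (1, 0) | s. s \<in> \<Gamma>} \<subseteq> (\<lambda>k. R (SOME s. s \<in> \<Gamma> \<and> code s = k) (1, 0)) ` UNIV"
    proof
      fix z assume "z \<in> {R s (1, 0) | s. s \<in> \<Gamma>}"
      then obtain s where s: "z = R s (1, 0)" "s \<in> \<Gamma>" by blast
      let ?t = "SOME t. t \<in> \<Gamma> \<and> code t = code s"
      have t: "?t \<in> \<Gamma> \<and> code ?t = code s" by (rule someI[of _ s]) (simp add: s)
      then have "z = R ?t (1, 0)" using R(3) code[of ?t s] s by simp
      then show "z \<in> (\<lambda>k. R (SOME s. s \<in> \<Gamma> \<and> code s = k) (1, 0)) ` UNIV" by blast
    qed
    then show ?thesis by (rule countable_subset) simp
  qed
  \<comment> \<open>The columns of a product change at most by a sign, which the absolute value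
    ignores; so \<open>s\<close> and \<open>mneg s\<close> move every vertex alike.\<close>
  have neg: "R (mneg s) = R s" if s: "s \<in> \<Gamma>" "mneg s \<in> \<Gamma>" for s
  proof -
    have "mker (mmul (mneg s) g) (mmul s g) = 1" if g: "g \<in> \<Gamma>" for g
    proof -
      have c: "cdet (mcol (mmul (mneg s) g) i) q = - cdet (mcol (mmul s g) i) q" for i q
        by (cases s; cases g; cases i) (simp_all add: cdet_def algebra_simps)
      have "mker (mmul (mneg s) g) (mmul s g) = mker (mmul s g) (mmul s g)"
        unfolding mker_def c vneg ..
      then show ?thesis using K.diag[OF G.mmul[OF s(1) g]] by simp
    qed
    then show ?thesis using R(4) s by blast
  qed
  have neg': "\<forall>s\<in>\<Gamma>. mneg s \<in> \<Gamma> \<longrightarrow> R (mneg s) = R s" using neg by blast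
  show ?thesis by (intro exI[of _ R] conjI R(1,2,5) cnt neg')
qed

end

section \<open>The isometry groups of the hyperbolic plane and space\<close>

text \<open>\<open>A\<close> identifies matrices at most up to sign, and \<open>R\<close> does not
  see signs, so the matrix representation descends along \<open>A\<close>. A subspace invariant
  under all lifts is in particular invariant under the operators \<open>R s\<close>.\<close>

theorem (in valued_complex) transfer_representation:
  fixes Grp :: "('x, 'm) monoid_scheme" and A :: "mat2 \<Rightarrow> 'x"
  assumes \<Gamma>: "matrix_group \<Gamma>" and neg: "\<And>g. g \<in> \<Gamma> \<Longrightarrow> mneg g \<in> \<Gamma>"
    and A: "A ` \<Gamma> = carrier Grp" "\<And>g h. g \<in> \<Gamma> \<Longrightarrow> h \<in> \<Gamma> \<Longrightarrow> A (mmul g h) = A g \<otimes>\<^bsub>Grp\<^esub> A h"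
      "\<And>g h. g \<in> \<Gamma> \<Longrightarrow> h \<in> \<Gamma> \<Longrightarrow> A g = A h \<Longrightarrow> h = g \<or> h = mneg g"
    and H: "\<exists>S :: 'h::{real_inner, banach} set. hilbert_basis S \<and> countable S \<and> infinite S"
  shows "\<exists>\<rho> \<in> hom Grp (Is TYPE('h)). irreducible_rep Grp \<rho> \<and>
    (\<exists>p \<in> hyp_space TYPE('h). countable {\<rho> g p | g. g \<in> carrier Grp})"
proof -
  interpret G: matrix_group \<Gamma> by (rule \<Gamma>)
  obtain R :: "mat2 \<Rightarrow> real \<times> 'h \<Rightarrow> real \<times> 'h" where
    R0: "(\<forall>s\<in>\<Gamma>. R s \<in> O_form) \<and> (\<forall>s\<in>\<Gamma>. \<forall>t\<in>\<Gamma>. R (mmul s t) = R s \<circ> R t) \<and>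
    countable {R s (1, 0) | s. s \<in> \<Gamma>} \<and> (\<forall>s\<in>\<Gamma>. mneg s \<in> \<Gamma> \<longrightarrow> R (mneg s) = R s) \<and>
    (\<forall>W. subspace W \<and> closed W \<and> (\<forall>s\<in>\<Gamma>. R s ` W \<subseteq> W) \<longrightarrow> W = {0} \<or> W = UNIV)"
    using matrix_group_representation[OF \<Gamma> H] ..
  then have RO: "\<And>s. s \<in> \<Gamma> \<Longrightarrow> R s \<in> O_form"
    and Rc: "\<And>s t. s \<in> \<Gamma> \<Longrightarrow> t \<in> \<Gamma> \<Longrightarrow> R (mmul s t) = R s \<circ> R t"
    and Rcnt: "countable {R s (1, 0) | s. s \<in> \<Gamma>}"
    and Rneg: "\<And>s. s \<in> \<Gamma> \<Longrightarrow> R (mneg s) = R s"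
    using neg by simp_all
  have Rirr: "W = {0} \<or> W = UNIV" if "subspace W" "closed W" "\<And>s. s \<in> \<Gamma> \<Longrightarrow> R s ` W \<subseteq> W" for W
    using R0 that by blast
  define \<rho> where "\<rho> f = induced (R (SOME g. g \<in> \<Gamma> \<and> A g = f))" for f
  have \<rho>A: "\<rho> (A g) = induced (R g)" if g: "g \<in> \<Gamma>" for g
  proof -
    let ?h = "SOME h. h \<in> \<Gamma> \<and> A h = A g"
    have h: "?h \<in> \<Gamma> \<and> A ?h = A g" by (rule someI[of _ g]) (simp add: g)
    from A(3)[OF g conjunct1[OF h] conjunct2[OF h, symmetric]] have "R ?h = R g"
    proof
      assume "?h = mneg g"
      then show ?thesis using Rneg[OF g] by (simp only:)
    qed (simp only:)
    then show ?thesis by (simp add: \<rho>_def)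
  qed
  have ex: "\<exists>g\<in>\<Gamma>. f = A g" if "f \<in> carrier Grp" for f using A(1) that by blast
  have iso: "induced (R g) \<in> carrier (Is TYPE('h))" if "g \<in> \<Gamma>" for g
    using induced_in_isometries[of "R g"] O_formD[OF RO[OF that]] by (simp add: Is_def del: split_paired_All)
  have "\<rho> \<in> hom Grp (Is TYPE('h))"
    unfolding hom_def
  proof (intro CollectI conjI ballI)
    show "\<rho> \<in> carrier Grp \<rightarrow> carrier (Is TYPE('h))"
    proof
      fix f assume "f \<in> carrier Grp"
      then obtain g where "g \<in> \<Gamma>" "f = A g" using ex by blast
      then show "\<rho> f \<in> carrier (Is TYPE('h))" using \<rho>A iso by simp
    qed
    fix f f' assume "f \<in> carrier Grp" "f' \<in> carrier Grp"
    then obtain g h where g: "g \<in> \<Gamma>" "f = A g" and h: "h \<in> \<Gamma>" "f' = A h" using ex by metis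
    have "\<rho> (f \<otimes>\<^bsub>Grp\<^esub> f') = induced (R g \<circ> R h)"
      using A(2)[OF g(1) h(1)] \<rho>A[OF G.mmul[OF g(1) h(1)]] Rc[OF g(1) h(1)] g h by simp
    also have "\<dots> = induced (R g) \<otimes>\<^bsub>Is TYPE('h)\<^esub> induced (R h)"
      by (rule induced_comp) (use O_formD[OF RO[OF g(1)]] O_formD[OF RO[OF h(1)]] in auto)
    finally show "\<rho> (f \<otimes>\<^bsub>Grp\<^esub> f') = \<rho> f \<otimes>\<^bsub>Is TYPE('h)\<^esub> \<rho> f'" using \<rho>A g h by simp
  qed
  moreover have "irreducible_rep Grp \<rho>"
    unfolding irreducible_rep_def
  proof (intro allI impI)
    fix W :: "(real \<times> 'h) set"
    assume W: "subspace W \<and> closed W \<and> (\<forall>g\<in>carrier Grp. \<forall>T. lifts T (\<rho> g) \<longrightarrow> T ` W \<subseteq> W)"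
    have "R s ` W \<subseteq> W" if s: "s \<in> \<Gamma>" for s
    proof -
      have "A s \<in> carrier Grp" using A(1) s by blast
      moreover have "lifts (R s) (\<rho> (A s))" using lifts_induced[OF RO[OF s]] \<rho>A[OF s] by simp
      ultimately show ?thesis using W by blast
    qed
    then show "W = {0} \<or> W = UNIV" using Rirr W by blast
  qed
  moreover have "span {(1, 0)} \<in> hyp_space TYPE('h)"
    unfolding hyp_space_def by (intro CollectI exI[of _ "(1, 0)"]) (simp add: hform_def)
  moreover have "countable {\<rho> g (span {(1, 0)}) | g. g \<in> carrier Grp}"
  proof (rule countable_subset)
    show "{\<rho> g (span {(1, 0)}) | g. g \<in> carrier Grp} \<subseteq> (\<lambda>X. span {X}) ` {R s (1, 0) | s. s \<in> \<Gamma>}"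
    proof
      fix z assume "z \<in> {\<rho> g (span {(1, 0)}) | g. g \<in> carrier Grp}"
      then obtain f where "z = \<rho> f (span {(1, 0)})" "f \<in> carrier Grp" by blast
      then obtain g where g: "g \<in> \<Gamma>" "z = \<rho> (A g) (span {(1, 0)})" using ex by blast
      have "z = R g ` span {(1, 0)}"
        using g(2) \<open>span {(1, 0)} \<in> hyp_space TYPE('h)\<close> by (simp add: \<rho>A[OF g(1)] induced_def)
      also have "\<dots> = span {R g (1, 0)}"
        using linear_span_image[OF O_formD(2)[OF RO[OF g(1)]], of "{(1, 0)}"] by simp
      finally show "z \<in> (\<lambda>X. span {X}) ` {R s (1, 0) | s. s \<in> \<Gamma>}" using g(1) by blast
    qed
    show "countable ((\<lambda>X. span {X}) ` {R s (1, 0) | s. s \<in> \<Gamma>})" using Rcnt by (rule countable_image)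
  qed
  ultimately show ?thesis by blast
qed

section \<open>Hermitian matrices as a model of hyperbolic space\<close>

fun mstar :: "mat2 \<Rightarrow> mat2" where
  "mstar (a, b, c, d) = (cnj a, cnj c, cnj b, cnj d)"

text \<open>The classical model of Minkowski space: the determinant of the Hermitian matrix is the
  form, so congruence by a matrix of determinant of modulus 1 preserves the form.\<close>

definition herm :: "real \<times> (real^3) \<Rightarrow> mat2" where
  "herm X = (of_real (fst X + snd X $ 3), Complex (snd X $ 1) (snd X $ 2),
    Complex (snd X $ 1) (- (snd X $ 2)), of_real (fst X - snd X $ 3))"

text \<open>Total and real linear on all matrices, but a two-sided inverse of \<open>herm\<close>
  only on Hermitian ones.\<close>

fun unherm :: "mat2 \<Rightarrow> real \<times> (real^3)" where
  "unherm (a, b, c, d) = ((Re a + Re d) / 2, vector [Re b, Im b, (Re a - Re d) / 2])"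

definition act3 :: "mat2 \<Rightarrow> real \<times> (real^3) \<Rightarrow> real \<times> (real^3)" where
  "act3 g X = unherm (mmul (mmul g (herm X)) (mstar g))"

lemma unherm_herm [simp]: "unherm (herm X) = X"
  by (cases X) (simp add: herm_def vec_eq_iff forall_3 vector_3)

lemma herm_unherm: "mstar M = M \<Longrightarrow> herm (unherm M) = M"
proof -
  assume M: "mstar M = M"
  obtain a b c d where m: "M = (a, b, c, d)" by (cases M)
  have "cnj a = a" "cnj b = c" "cnj d = d" using M by (simp_all add: m)
  then have "Im a = 0" "c = cnj b" "Im d = 0" by (auto simp: complex_eq_iff)
  then show ?thesis
    by (simp add: m herm_def vector_3 complex_eq_iff add_divide_distrib diff_divide_distrib)
qed

lemma mstar_mmul: "mstar (mmul g h) = mmul (mstar h) (mstar g)"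
  by (cases g; cases h) (simp add: algebra_simps)

lemma mstar_mstar [simp]: "mstar (mstar g) = g"
  by (cases g) simp

lemma mstar_herm [simp]: "mstar (herm X) = herm X"
  by (simp add: herm_def complex_eq_iff)

lemma mstar_mone [simp]: "mstar mone = mone"
  by (simp add: mone_def)

lemma mdet_mstar: "mdet (mstar g) = cnj (mdet g)"
  by (cases g) (simp add: algebra_simps)

lemma herm_act3: "herm (act3 g X) = mmul (mmul g (herm X)) (mstar g)"
  unfolding act3_def by (rule herm_unherm) (simp add: mstar_mmul mmul_assoc)

lemma act3_mmul: "act3 (mmul g h) X = act3 g (act3 h X)"
  by (subst (2) act3_def) (simp add: herm_act3, simp add: act3_def mstar_mmul mmul_assoc)

lemma act3_mone [simp]: "act3 mone X = X"
  by (simp add: act3_def)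

lemma mdet_herm: "mdet (herm X) = of_real (hform X X)"
  by (simp add: herm_def hform_def inner_vec_def sum_3 complex_eq_iff algebra_simps)

lemma mmul_add: "mmul g (x + y) = mmul g x + mmul g y" "mmul (x + y) g = mmul x g + mmul y g"
  by (cases g; cases x; cases y; simp add: algebra_simps)+

lemma mmul_scale: "mmul g (r *\<^sub>R x) = r *\<^sub>R mmul g x" "mmul (r *\<^sub>R x) g = r *\<^sub>R mmul x g"
  by (cases g; cases x; simp add: scaleR_add_right)+

lemma herm_add: "herm (X + Y) = herm X + herm Y"
  by (simp add: herm_def complex_eq_iff)

lemma herm_scale: "herm (r *\<^sub>R X) = r *\<^sub>R herm X"
  by (simp add: herm_def complex_eq_iff algebra_simps)

lemma unherm_add: "unherm (x + y) = unherm x + unherm y"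
  by (cases x; cases y) (simp add: vec_eq_iff forall_3 vector_3 field_simps)

lemma unherm_scale: "unherm (r *\<^sub>R x) = r *\<^sub>R unherm x"
  by (cases x) (simp add: vec_eq_iff forall_3 vector_3 field_simps)

lemma linear_act3: "linear (act3 g)"
  by (rule linearI)
     (simp_all add: act3_def herm_add herm_scale mmul_add mmul_scale unherm_add unherm_scale)

lemma hform_polar:
  fixes T :: "real \<times> 'a::real_inner \<Rightarrow> real \<times> 'b::real_inner"
  assumes T: "linear T" and q: "\<And>X. hform (T X) (T X) = hform X X"
  shows "hform (T X) (T Y) = hform X Y"
  using q[of "X + Y"] q[of X] q[of Y] hform_commute[of Y X] hform_commute[of "T Y" "T X"]
  by (simp add: linear_add[OF T] hform_add)

lemma hform_act3:
  assumes "mdet g = 1 \<or> mdet g = -1"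
  shows "hform (act3 g X) (act3 g Y) = hform X Y"
proof (rule hform_polar[OF linear_act3])
  fix X
  have "complex_of_real (hform (act3 g X) (act3 g X)) = mdet g * of_real (hform X X) * cnj (mdet g)"
    by (simp add: mdet_herm[symmetric] herm_act3 mdet_mmul mdet_mstar)
  also have "\<dots> = of_real (hform X X)" using assms by auto
  finally show "hform (act3 g X) (act3 g X) = hform X X" by (simp only: of_real_eq_iff)
qed

lemma act3_minv:
  assumes "mdet g = 1 \<or> mdet g = -1"
  shows "act3 (minv g) (act3 g X) = X" "act3 g (act3 (minv g) X) = X"
  using mmul_minv[OF assms] by (simp_all flip: act3_mmul)

lemma act3_O_form:
  assumes "mdet g = 1 \<or> mdet g = -1"
  shows "act3 g \<in> O_form"
proof -
  have "bij (act3 g)"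
    by (rule o_bij[of "act3 (minv g)"]) (use act3_minv[OF assms] in \<open>auto simp: fun_eq_iff\<close>)
  then show ?thesis
    using hform_act3[OF assms] linear_act3
    by (simp add: O_form_def linear_conv_bounded_linear del: split_paired_All)
qed

text \<open>For such \<open>X\<close> the matrix \<open>herm X\<close> is positive definite, so the
  diagonal entries of its transform are nonnegative. Half their sum is the first coordinate, which
  cannot vanish because the form stays positive.\<close>

lemma act3_sheet:
  assumes g: "mdet g = 1 \<or> mdet g = -1" and X: "hform X X > 0" "fst X > 0"
  shows "fst (act3 g X) > 0"
proof -
  define p q w where "p = fst X + snd X $ 3" and "q = fst X - snd X $ 3" and "w = Complex (snd X $ 1) (snd X $ 2)"
  have h: "herm X = (of_real p, w, cnj w, of_real q)"
    by (simp add: herm_def p_def q_def w_def complex_eq_iff)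
  have "complex_of_real (hform X X) = of_real p * of_real q - w * cnj w"
    using mdet_herm[of X] by (simp add: h)
  then have "complex_of_real (hform X X) = of_real (p * q - (cmod w)\<^sup>2)"
    by (simp add: complex_norm_square del: of_real_power)
  then have pq: "p * q - (cmod w)\<^sup>2 > 0" using X(1) by (simp only: of_real_eq_iff)
  then have "p * q > 0" using zero_le_power2[of "cmod w"] by linarith
  moreover have "p + q > 0" using X(2) by (simp add: p_def q_def)
  ultimately have p: "p > 0" by (auto simp: zero_less_mult_iff)
  have row: "Re ((a * of_real p + b * cnj w) * cnj a + (a * w + b * of_real q) * cnj b) \<ge> 0" for a b
  proof -
    define z where "z = (a * of_real p + b * cnj w) * cnj a + (a * w + b * of_real q) * cnj b"
    \<comment> \<open>Completing the square; the remainder is the determinant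
      \<open>p * q - (cmod w)\<^sup>2\<close> times the squared modulus of \<open>b\<close>.\<close>
    have "of_real p * z = (a * of_real p + b * cnj w) * cnj (a * of_real p + b * cnj w) +
        b * cnj b * (of_real p * of_real q - w * cnj w)"
      by (simp add: z_def algebra_simps)
    also have "\<dots> = of_real ((cmod (a * of_real p + b * cnj w))\<^sup>2 + (cmod b)\<^sup>2 * (p * q - (cmod w)\<^sup>2))"
      by (simp add: complex_norm_square del: of_real_power)
    finally have "Re (of_real p * z) =
        (cmod (a * of_real p + b * cnj w))\<^sup>2 + (cmod b)\<^sup>2 * (p * q - (cmod w)\<^sup>2)"
      by (simp only: Re_complex_of_real)
    moreover have "\<dots> \<ge> 0" using pq by (intro add_nonneg_nonneg mult_nonneg_nonneg) auto
    ultimately have "p * Re z \<ge> 0" by simp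
    then show ?thesis using p unfolding z_def[symmetric] by (simp add: zero_le_mult_iff)
  qed
  obtain a b c d where gd: "g = (a, b, c, d)" by (cases g)
  have "fst (act3 g X) \<ge> 0"
    using row[of a b] row[of c d] unfolding act3_def h gd by simp
  moreover have "fst (act3 g X) \<noteq> 0"
  proof
    assume "fst (act3 g X) = 0"
    then have "hform (act3 g X) (act3 g X) \<le> 0" by (simp add: hform_def)
    then show False using hform_act3[OF g] X(1) by simp
  qed
  ultimately show ?thesis by simp
qed

text \<open>The test vectors correspond to the identity, to diag(2, 1) and to the matrix with rows
  (2, 1) and (1, 2). The first two force \<open>h\<close> to be diagonal, the third makes its
  diagonal entries equal. All three have vanishing second coordinate, so the same test serves the
  plane.\<close>

lemma act3_scalar_matrix:
  assumes h: "mdet h = 1 \<or> mdet h = -1"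
    and 1: "act3 h (1, 0) = r1 *\<^sub>R (1, 0)"
    and 2: "act3 h (3 / 2, vector [0, 0, 1 / 2]) = r2 *\<^sub>R (3 / 2, vector [0, 0, 1 / 2])"
    and 3: "act3 h (2, vector [1, 0, 0]) = r3 *\<^sub>R (2, vector [1, 0, 0])"
  shows "\<exists>a. h = (a, 0, 0, a)"
proof -
  obtain a b c d where hd: "h = (a, b, c, d)" by (cases h)
  have H: "mmul (mmul h (herm X)) (mstar h) = r *\<^sub>R herm X" if "act3 h X = r *\<^sub>R X" for X r
    using herm_act3[of h X] that by (simp add: herm_scale)
  have h1: "herm (1, 0) = (1, 0, 0, 1)" "herm (3 / 2, vector [0, 0, 1 / 2]) = (2, 0, 0, 1)"
    "herm (2, vector [1, 0, 0]) = (2, 1, 1, 2)"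
    by (simp_all add: herm_def vector_3 complex_eq_iff)
  have e1: "a * cnj a + b * cnj b = of_real r1" "a * cnj c + b * cnj d = 0" "c * cnj c + d * cnj d = of_real r1"
    using H[OF 1] unfolding h1 hd by (simp_all add: scaleR_conv_of_real)
  have e2: "2 * (a * cnj a) + b * cnj b = 2 * of_real r2" "2 * (a * cnj c) + b * cnj d = 0"
    "2 * (c * cnj c) + d * cnj d = of_real r2"
    using H[OF 2] unfolding h1 hd by (simp_all add: scaleR_conv_of_real mult.assoc mult.commute mult.left_commute)
  have ac: "a * cnj c = 0" using e1(2) e2(2) by algebra
  have bd: "b * cnj d = 0" using e1(2) unfolding ac by simp
  have c0: "c = 0"
  proof (rule ccontr)
    assume c: "c \<noteq> 0"
    then have a: "a = 0" using ac by simp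
    then have "b \<noteq> 0" using h hd by auto
    then have d: "d = 0" using bd by simp
    \<comment> \<open>An antidiagonal \<open>h\<close> would exchange the diagonal entries 2 and 1
      while scaling both by the same factor, against proportionality to diag(2, 1).\<close>
    have "b * cnj b = of_real r1" "c * cnj c = of_real r1" "b * cnj b = 2 * of_real r2" "2 * (c * cnj c) = of_real r2"
      using e1 e2 a d by simp_all
    then have "c * cnj c = 2 * (2 * (c * cnj c))" by simp
    moreover have "x = 0" if "x = 2 * (2 * x)" for x :: complex using that by (auto simp: complex_eq_iff)
    ultimately have "c * cnj c = 0" by blast
    then show False using c by simp
  qed
  then have "d \<noteq> 0" using h hd by auto
  then have b0: "b = 0" using bd by simp
  have "2 * (a * cnj a) = 2 * of_real r3" "a * cnj d = of_real r3"
    using H[OF 3] unfolding h1 hd c0 b0 by (simp_all add: scaleR_conv_of_real mult.assoc mult.commute mult.left_commute)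
  then have "a * cnj a = a * cnj d" by simp
  moreover have "a \<noteq> 0" using h hd b0 by auto
  ultimately have "a = d" by simp
  then show ?thesis using hd b0 c0 by blast
qed

text \<open>The matrix is the lower triangular Cholesky factor of \<open>herm Y\<close>. It is real
  when the second coordinate vanishes, as the plane requires.\<close>

lemma act3_transitive:
  assumes Y: "hform Y Y = 1" "fst Y > 0"
  shows "\<exists>a b c d. mdet (a, b, c, d) = 1 \<and> act3 (a, b, c, d) (1, 0) = Y \<and>
    (snd Y $ 2 = 0 \<longrightarrow> Im a = 0 \<and> Im b = 0 \<and> Im c = 0 \<and> Im d = 0)"
proof -
  define p q w where "p = fst Y + snd Y $ 3" and "q = fst Y - snd Y $ 3" and "w = Complex (snd Y $ 1) (snd Y $ 2)"
  have h: "herm Y = (of_real p, w, cnj w, of_real q)"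
    by (simp add: herm_def p_def q_def w_def complex_eq_iff)
  have "complex_of_real p * of_real q - w * cnj w = 1"
    using mdet_herm[of Y] Y(1) by (simp add: h)
  then have "complex_of_real (p * q - (cmod w)\<^sup>2) = of_real 1"
    by (simp add: complex_norm_square del: of_real_power)
  then have pq: "p * q = 1 + (cmod w)\<^sup>2" by (simp only: of_real_eq_iff)
  then have "p * q > 0" using zero_le_power2[of "cmod w"] by linarith
  moreover have "p + q > 0" using Y(2) by (simp add: p_def q_def)
  ultimately have p: "p > 0" by (auto simp: zero_less_mult_iff)
  define s where "s = sqrt p"
  have s: "s > 0" "s * s = p" using p by (simp_all add: s_def)
  define g where "g = (complex_of_real s, 0 :: complex, cnj w / of_real s, 1 / complex_of_real s)"
  have "mmul (mmul g mone) (mstar g) = herm Y"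
  proof -
    have ss: "complex_of_real s * of_real s = of_real p" using s(2) by (metis of_real_mult)
    have "cnj w / of_real s * (w / of_real s) + 1 / of_real s * (1 / of_real s) = (1 + w * cnj w) / of_real p"
      unfolding ss[symmetric] by (simp add: add_divide_distrib mult.commute)
    also have "1 + w * cnj w = of_real (p * q)"
      unfolding pq by (simp add: complex_norm_square del: of_real_power)
    also have "of_real (p * q) / of_real p = complex_of_real q" using p by simp
    finally show ?thesis using s ss by (simp add: g_def h)
  qed
  moreover have "herm (1, 0) = mone" by (simp add: herm_def mone_def complex_eq_iff)
  ultimately have "act3 g (1, 0) = Y" by (simp add: act3_def)
  moreover have "mdet g = 1" using s by (simp add: g_def)
  moreover have "snd Y $ 2 = 0 \<longrightarrow> Im (cnj w / of_real s) = 0" by (simp add: w_def Im_divide_of_real)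
  ultimately show ?thesis unfolding g_def
    by (intro exI[of _ "complex_of_real s"] exI[of _ "0 :: complex"] exI[of _ "cnj w / of_real s"]
        exI[of _ "1 / complex_of_real s"]) simp
qed

text \<open>A special unitary matrix with half-angle entries: \<open>a\<close> is the cosine and the
  modulus of \<open>c\<close> the sine of half the angle between the third axis and
  \<open>u\<close>. It can be taken real when the second coordinate of \<open>u\<close>
  vanishes.\<close>

lemma act3_rotate_axis:
  assumes u: "norm (u :: real^3) = 1"
  shows "\<exists>a b c d. mdet (a, b, c, d) = 1 \<and> act3 (a, b, c, d) (1, 0) = (1, 0) \<and>
    act3 (a, b, c, d) (0, vector [0, 0, 1]) = (0, u) \<and>
    (u $ 2 = 0 \<longrightarrow> Im a = 0 \<and> Im b = 0 \<and> Im c = 0 \<and> Im d = 0)"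
proof -
  define w where "w = Complex (u $ 1) (u $ 2)"
  have uu: "(u $ 1)\<^sup>2 + (u $ 2)\<^sup>2 + (u $ 3)\<^sup>2 = 1"
    using u by (simp add: norm_eq_1 inner_vec_def sum_3 power2_eq_square)
  have "\<exists>(a :: real) c. a\<^sup>2 + (cmod c)\<^sup>2 = 1 \<and> a\<^sup>2 - (cmod c)\<^sup>2 = u $ 3 \<and> 2 * of_real a * cnj c = w \<and>
    (u $ 2 = 0 \<longrightarrow> Im c = 0)"
  proof (cases "u $ 3 = -1")
    case True
    then have "(u $ 1)\<^sup>2 + (u $ 2)\<^sup>2 = 0" using uu by simp
    then have "u $ 1 = 0" "u $ 2 = 0" by (simp_all add: sum_power2_eq_zero_iff)
    then have "w = 0" by (simp add: w_def complex_eq_iff)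
    \<comment> \<open>At the antipode of the axis \<open>a\<close> is 0, and the general formula for
      \<open>c\<close> would divide by it.\<close>
    then show ?thesis using True by (intro exI[of _ 0] exI[of _ 1]) simp
  next
    case False
    have "(u $ 3)\<^sup>2 \<le> 1" using uu by (metis add_increasing zero_le_power2 add_nonneg_nonneg order_refl)
    then have "u $ 3 \<ge> -1" by (simp add: abs_square_le_1 abs_le_iff)
    with False have u3: "1 + u $ 3 > 0" by simp
    define a where "a = sqrt ((1 + u $ 3) / 2)"
    have a: "a > 0" "a\<^sup>2 = (1 + u $ 3) / 2" using u3 by (simp_all add: a_def)
    define c where "c = cnj w / (2 * of_real a)"
    have "cmod c = cmod w / (2 * a)" using a(1) by (simp add: c_def norm_divide norm_mult)
    then have "(cmod c)\<^sup>2 = (cmod w)\<^sup>2 / (4 * a\<^sup>2)" by (simp add: power_divide power_mult_distrib)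
    also have "(cmod w)\<^sup>2 = (1 - u $ 3) * (1 + u $ 3)"
      using uu by (simp add: w_def cmod_power2) (simp add: algebra_simps power2_eq_square)
    also have "4 * a\<^sup>2 = 2 * (1 + u $ 3)" using a(2) by simp
    also have "(1 - u $ 3) * (1 + u $ 3) / (2 * (1 + u $ 3)) = (1 - u $ 3) / 2"
      using u3 by (intro nonzero_mult_divide_mult_cancel_right) simp
    finally have "(cmod c)\<^sup>2 = (1 - u $ 3) / 2" .
    moreover have "2 * of_real a * cnj c = w" using a(1) by (simp add: c_def)
    moreover have "u $ 2 = 0 \<longrightarrow> Im c = 0"
      using Im_divide_of_real[of "cnj w" "2 * a"] by (simp add: c_def w_def)
    ultimately show ?thesis using a(2) by (intro exI[of _ a] exI[of _ c]) (simp add: field_simps)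
  qed
  then obtain a :: real and c where ac: "a\<^sup>2 + (cmod c)\<^sup>2 = 1" "a\<^sup>2 - (cmod c)\<^sup>2 = u $ 3"
    "2 * of_real a * cnj c = w" "u $ 2 = 0 \<longrightarrow> Im c = 0" by blast
  have cc: "c * cnj c = of_real ((cmod c)\<^sup>2)" by (simp add: complex_norm_square del: of_real_power)
  have aa: "complex_of_real a * of_real a + c * cnj c = 1"
    unfolding cc using ac(1) by (simp add: power2_eq_square flip: of_real_mult of_real_add)
  have ab: "complex_of_real a * of_real a - c * cnj c = of_real (u $ 3)"
    unfolding cc using ac(2) by (simp add: power2_eq_square flip: of_real_mult of_real_diff)
  define g where "g = (complex_of_real a, - cnj c, c, complex_of_real a)"
  have "mmul (mmul g (1, 0, 0, 1)) (mstar g) = (1, 0, 0, 1)"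
    using aa by (simp add: g_def algebra_simps)
  moreover have "herm (1, 0) = (1, 0, 0, 1)" by (simp add: herm_def complex_eq_iff)
  ultimately have 1: "act3 g (1, 0) = (1, 0)" unfolding act3_def by (metis unherm_herm)
  have "mmul (mmul g (1, 0, 0, -1)) (mstar g) = (of_real (u $ 3), w, cnj w, - of_real (u $ 3))"
    using ab ac(3)[symmetric] by (simp add: g_def algebra_simps)
  moreover have "herm (0, u) = (of_real (u $ 3), w, cnj w, - of_real (u $ 3))"
    by (simp add: herm_def w_def complex_eq_iff)
  moreover have "herm (0, vector [0, 0, 1]) = (1, 0, 0, -1)" by (simp add: herm_def vector_3 complex_eq_iff)
  ultimately have 2: "act3 g (0, vector [0, 0, 1]) = (0, u)" unfolding act3_def by (metis unherm_herm)
  have "mdet g = 1" using aa by (simp add: g_def mult.commute)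
  then show ?thesis using 1 2 ac(4) unfolding g_def
    by (intro exI[of _ "complex_of_real a"] exI[of _ "- cnj c"] exI[of _ c] exI[of _ "complex_of_real a"]) simp
qed

text \<open>Congruence by the diagonal matrix with entries \<open>z\<close> and \<open>cnj z\<close>
  multiplies the upper off-diagonal entry by \<open>z * z\<close>, so a square root of
  \<open>w\<close> is taken.\<close>

lemma act3_rotate_about_axis:
  assumes w: "cmod w = 1"
  shows "\<exists>g. mdet g = 1 \<and> act3 g (1, 0) = (1, 0) \<and> act3 g (0, vector [0, 0, 1]) = (0, vector [0, 0, 1]) \<and>
    act3 g (0, vector [1, 0, 0]) = (0, vector [Re w, Im w, 0])"
proof -
  define z where "z = csqrt w"
  have zz: "z * z = w" by (simp add: z_def flip: power2_eq_square)
  then have "cmod z * cmod z = 1" using w by (metis norm_mult)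
  then have "(cmod z)\<^sup>2 = 1" by (simp add: power2_eq_square)
  then have zc: "z * cnj z = 1" by (metis complex_norm_square of_real_1)
  define g where "g = (z, 0 :: complex, 0 :: complex, cnj z)"
  have zc': "cnj z * z = 1" "cnj z * cnj z = cnj w" using zc zz by (simp_all add: mult.commute flip: complex_cnj_mult)
  have "herm (1, 0) = (1, 0, 0, 1)" "herm (0, vector [0, 0, 1]) = (1, 0, 0, -1)"
    "herm (0, vector [1, 0, 0]) = (0, 1, 1, 0)" "herm (0, vector [Re w, Im w, 0]) = (0, w, cnj w, 0)"
    by (simp_all add: herm_def vector_3 complex_eq_iff)
  moreover have "mmul (mmul g (1, 0, 0, 1)) (mstar g) = (1, 0, 0, 1)"
    "mmul (mmul g (1, 0, 0, -1)) (mstar g) = (1, 0, 0, -1)"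
    "mmul (mmul g (0, 1, 1, 0)) (mstar g) = (0, w, cnj w, 0)"
    using zc zc' zz by (simp_all add: g_def)
  ultimately have "act3 g (1, 0) = (1, 0)" "act3 g (0, vector [0, 0, 1]) = (0, vector [0, 0, 1])"
    "act3 g (0, vector [1, 0, 0]) = (0, vector [Re w, Im w, 0])"
    unfolding act3_def by (metis unherm_herm)+
  moreover have "mdet g = 1" using zc by (simp add: g_def)
  ultimately show ?thesis by blast
qed

text \<open>By the theorem of Cayley and Hamilton, \<open>g\<close> or \<open>- g\<close> is the square of \<open>(g + 1) / sqrt (trace g + 2)\<close>,
  up to the corresponding sign.\<close>

lemma lift_det_act3_pos:
  assumes g: "mdet g = 1"
  shows "lift_det (act3 g) > 0"
proof -
  have sq: "lift_det (act3 (mmul h h)) > 0" if h: "mdet h = 1" for h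
  proof -
    have comp: "act3 (mmul g h) = act3 g \<circ> act3 h" for g h by (simp add: fun_eq_iff act3_mmul)
    have id: "act3 mone = id" by (simp add: fun_eq_iff)
    have "lift_det (act3 h) * lift_det (act3 (minv h)) = lift_det (act3 (mmul h (minv h)))"
      by (simp add: comp lift_det_comp linear_act3)
    also have "\<dots> = 1" using mmul_minv[of h] h by (simp add: id lift_det_id)
    finally have "lift_det (act3 h) \<noteq> 0" by auto
    then have "lift_det (act3 h) * lift_det (act3 h) > 0" by (metis not_real_square_gt_zero)
    then show ?thesis by (simp add: comp lift_det_comp linear_act3)
  qed
  have root: "\<exists>h. mdet h = 1 \<and> mmul h h = k" if k: "mdet k = 1" "fst k + snd (snd (snd k)) \<noteq> -2" for k
  proof -
    obtain a b c d where kd: "k = (a, b, c, d)" by (cases k)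
    define t where "t = a + d + 2"
    have t0: "t \<noteq> 0"
    proof
      assume "t = 0"
      then have "a + d = -2" by (simp add: t_def eq_neg_iff_add_eq_0)
      then show False using k(2) by (simp add: kd)
    qed
    define r where "r = csqrt t"
    have r: "r * r = t" "r \<noteq> 0" using t0 by (auto simp: r_def simp flip: power2_eq_square)
    have det: "a * d - b * c = 1" using k(1) kd by simp
    define h where "h = ((a + 1) / r, b / r, c / r, (d + 1) / r)"
    have "mdet h = ((a + 1) * (d + 1) - b * c) / t"
      using r by (simp add: h_def flip: diff_divide_distrib)
    also have "(a + 1) * (d + 1) - b * c = t" using det by (simp add: t_def algebra_simps)
    finally have "mdet h = 1" using t0 by simp
    moreover have "mmul h h = k"
    proof -
      have "(a + 1) * (a + 1) + b * c = a * t" "(a + 1) * b + b * (d + 1) = b * t"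
        "c * (a + 1) + (d + 1) * c = c * t" "c * b + (d + 1) * (d + 1) = d * t"
        using det by (simp_all add: t_def algebra_simps)
      moreover have "x / r * (y / r) + z / r * (w / r) = (x * y + z * w) / t" for x y z w
        by (simp add: add_divide_distrib flip: r(1))
      ultimately show ?thesis using t0 by (simp add: h_def kd)
    qed
    ultimately show ?thesis by blast
  qed
  have pos: "lift_det (act3 k) > 0" if "mdet k = 1" "fst k + snd (snd (snd k)) \<noteq> -2" for k
    using root[OF that] sq by blast
  have neg: "act3 (mneg g) = act3 g"
  proof
    fix X
    have "mneg g = - g" "mstar (mneg g) = - mstar g" by (cases g, simp)+
    moreover have "mmul (mmul (- g) h) (- k) = mmul (mmul g h) k" for h k by (cases g; cases h; cases k) (simp add: algebra_simps)
    ultimately show "act3 (mneg g) X = act3 g X" by (simp add: act3_def)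
  qed
  show ?thesis
  proof (cases "fst g + snd (snd (snd g)) = -2")
    case True
    have "mdet (mneg g) = 1" using g by (cases g) simp
    moreover have "fst (mneg g) + snd (snd (snd (mneg g))) \<noteq> -2"
      using True by (cases g) (simp flip: neg_equal_iff_equal[of "_ + _" "- 2"])
    ultimately show ?thesis using pos[of "mneg g"] neg by simp
  qed (use pos g in blast)
qed

lemma mmul_scalar_minv:
  assumes g: "mdet g = 1 \<or> mdet g = -1" and a: "a = 1 \<or> a = -1" and e: "mmul (minv g) h = (a, 0, 0, a)"
  shows "h = g \<or> h = mneg g"
proof -
  have "h = mmul g (mmul (minv g) h)" using mmul_minv[OF g] by (simp flip: mmul_assoc)
  also have "\<dots> = mmul g (a, 0, 0, a)" by (simp add: e)
  also have "\<dots> = g \<or> \<dots> = mneg g" using a by (cases g) auto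
  finally show ?thesis .
qed

lemma mdet_minv: "mdet g = 1 \<or> mdet g = -1 \<Longrightarrow> mdet (minv g) = mdet g"
proof -
  assume g: "mdet g = 1 \<or> mdet g = -1"
  have "mdet (minv g) * mdet g = 1" using mmul_minv(1)[OF g] mdet_mmul[of "minv g" g] by (simp add: mone_def)
  then have "mdet (minv g) * mdet g * mdet g = mdet g" by simp
  moreover have "mdet g * mdet g = 1" using g by auto
  ultimately show ?thesis by (simp add: mult.assoc)
qed

lemma fixes_line_eq:
  assumes T: "linear T" and "T ` span {X} = U ` span {X}" "linear U"
  shows "\<exists>r. T (r *\<^sub>R X) = U X"
proof -
  have "U X \<in> T ` span {X}" unfolding assms(2) by (intro imageI span_base) simp
  then show ?thesis by (auto simp: span_singleton)
qed

section \<open>Orientation-preserving isometries of space as complex matrices\<close>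

definition SL2C :: "mat2 set" where
  "SL2C = {g. mdet g = 1}"

lemma matrix_group_SL2C: "matrix_group SL2C"
proof
  show "minv g \<in> SL2C" if "g \<in> SL2C" for g
    using that mdet_minv[of g] by (simp add: SL2C_def)
qed (auto simp: SL2C_def mone_def mdet_mmul upper_def lower_def)

lemma act3_induced_inj:
  assumes g: "g \<in> SL2C" and h: "h \<in> SL2C" and eq: "induced (act3 g) = induced (act3 h)"
  shows "h = g \<or> h = mneg g"
proof -
  have d: "mdet g = 1 \<or> mdet g = -1" using g by (simp add: SL2C_def)
  have line: "\<exists>r. act3 (mmul (minv g) h) X = r *\<^sub>R X" if X: "hform X X > 0" for X
  proof -
    have x: "span {X} \<in> hyp_space TYPE(real^3)" using X unfolding hyp_space_def by blast
    then have "act3 g ` span {X} = act3 h ` span {X}" using fun_cong[OF eq, of "span {X}"] by (simp add: induced_def)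
    then obtain r where "act3 g (r *\<^sub>R X) = act3 h X"
      using fixes_line_eq[OF linear_act3 _ linear_act3] by blast
    then have "act3 (mmul (minv g) h) X = r *\<^sub>R X" using act3_minv(1)[OF d, of "r *\<^sub>R X"] by (simp add: act3_mmul)
    then show ?thesis ..
  qed
  have dk: "mdet (mmul (minv g) h) = 1" using g h mdet_minv[OF d] by (simp add: SL2C_def mdet_mmul)
  have p: "hform (1, 0) (1, 0 :: real^3) > 0"
    "hform (3 / 2, vector [0, 0, 1 / 2]) (3 / 2, vector [0, 0, 1 / 2] :: real^3) > 0"
    "hform (2, vector [1, 0, 0]) (2, vector [1, 0, 0] :: real^3) > 0"
    by (simp_all add: hform_def inner_vec_def sum_3 vector_3)
  obtain a where a: "mmul (minv g) h = (a, 0, 0, a)"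
    using act3_scalar_matrix[of "mmul (minv g) h"] line[OF p(1)] line[OF p(2)] line[OF p(3)] dk by blast
  then have "a * a = 1" using dk by simp
  then have "a = 1 \<or> a = -1" by (simp add: square_eq_1_iff)
  then show ?thesis using mmul_scalar_minv[OF d _ a] by blast
qed

text \<open>Orthogonality leaves only a sign on the second axis undetermined, and the minus sign is
  a reflection of determinant -1.\<close>

lemma form_isometry_fixing_three:
  fixes T :: "real \<times> (real^3) \<Rightarrow> real \<times> (real^3)"
  assumes T: "T \<in> O_form" and det: "lift_det T > 0"
    and f0: "T (1, 0) = (1, 0)" and f1: "T (0, vector [1, 0, 0]) = (0, vector [1, 0, 0])"
    and f3: "T (0, vector [0, 0, 1]) = (0, vector [0, 0, 1])"
  shows "T = id"
proof -
  note lin = O_formD(2)[OF T] and fm = O_formD(4)[OF T]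
  define Y where "Y = T (0, vector [0, 1, 0])"
  have "hform Y (T (1, 0)) = 0" "hform Y (T (0, vector [1, 0, 0])) = 0" "hform Y (T (0, vector [0, 0, 1])) = 0"
    "hform Y Y = -1"
    unfolding Y_def fm by (simp_all add: hform_def inner_vec_def sum_3 vector_3)
  then have Y: "fst Y = 0" "snd Y $ 1 = 0" "snd Y $ 3 = 0" "snd Y $ 2 * snd Y $ 2 = 1"
    unfolding f0 f1 f3 by (simp_all add: hform_def inner_vec_def sum_3 vector_3)
  define e where "e = snd Y $ 2"
  have e: "e = 1 \<or> e = -1" using Y(4) by (simp add: e_def square_eq_1_iff)
  have Ye: "Y = (0, vector [0, e, 0])"
    using Y by (simp add: prod_eq_iff vec_eq_iff forall_3 vector_3 e_def)
  have TX: "T X = (fst X, vector [snd X $ 1, e * snd X $ 2, snd X $ 3])" for X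
  proof -
    have "X = fst X *\<^sub>R (1, 0) + (snd X $ 1 *\<^sub>R (0, vector [1, 0, 0]) + (snd X $ 2 *\<^sub>R (0, vector [0, 1, 0]) +
        snd X $ 3 *\<^sub>R (0, vector [0, 0, 1])))"
      by (simp add: prod_eq_iff vec_eq_iff forall_3 vector_3)
    then have "T X = T (fst X *\<^sub>R (1, 0) + (snd X $ 1 *\<^sub>R (0, vector [1, 0, 0]) +
        (snd X $ 2 *\<^sub>R (0, vector [0, 1, 0]) + snd X $ 3 *\<^sub>R (0, vector [0, 0, 1]))))" by simp
    also have "\<dots> = fst X *\<^sub>R (1, 0) + (snd X $ 1 *\<^sub>R (0, vector [1, 0, 0]) + (snd X $ 2 *\<^sub>R Y +
        snd X $ 3 *\<^sub>R (0, vector [0, 0, 1])))"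
      by (simp only: linear_add[OF lin] linear_cmul[OF lin] f0 f1 f3 Y_def)
    also have "\<dots> = (fst X, vector [snd X $ 1, e * snd X $ 2, snd X $ 3])"
      by (simp add: Ye prod_eq_iff vec_eq_iff forall_3 vector_3)
    finally show ?thesis .
  qed
  have "e = 1"
  proof (rule ccontr)
    assume "e \<noteq> 1"
    then have em: "e = -1" using e by simp
    define M where "M = matrix (to_coords \<circ> T \<circ> of_coords)"
    have M: "M $ i $ j = (case i of None \<Rightarrow> if j = None then 1 else 0
        | Some k \<Rightarrow> if j = Some k then (if k = 2 then -1 else 1) else 0)" for i j
    proof -
      have three: "k = 1 \<or> k = 2 \<or> k = 3" for k :: 3 by (rule exhaust_3)
      show ?thesis
      proof (cases i)
        case None
        then show ?thesis
          by (auto simp: M_def matrix_def to_coords_def of_coords_def TX axis_def)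
      next
        case (Some k)
        then show ?thesis using three[of k]
          by (auto simp: M_def matrix_def to_coords_def of_coords_def TX axis_def em vector_3)
      qed
    qed
    have "det M = prod (\<lambda>i. M $ i $ i) UNIV"
    proof (rule det_diagonal)
      show "M $ i $ j = 0" if "i \<noteq> j" for i j using that by (cases i; cases j) (auto simp: M)
    qed
    also have "\<dots> = (\<Prod>k\<in>UNIV. M $ Some k $ Some k)"
      unfolding UNIV_option_conv by (subst prod.insert) (auto simp: M prod.reindex)
    also have "\<dots> = -1"
      by (simp add: M UNIV_3)
    finally show False using det by (simp add: lift_det_def M_def)
  qed
  then show ?thesis by (auto simp: fun_eq_iff TX prod_eq_iff vec_eq_iff forall_3 vector_3)
qed

text \<open>\<open>T\<close> is undone in three stages: by a matrix moving (1, 0) to its image, by a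
  rotation correcting the third axis, and by a rotation about that axis correcting the first one.
  Every correction keeps the determinant positive, so \<open>form_isometry_fixing_three\<close>
  leaves only the identity.\<close>

lemma SL2C_surjective:
  assumes T: "T \<in> O_form" "preserves_sheet T" "lift_det T > 0"
  shows "\<exists>g\<in>SL2C. T = act3 g"
proof -
  have O: "act3 g \<in> O_form" if "g \<in> SL2C" for g using act3_O_form[of g] that by (simp add: SL2C_def)
  have inv: "minv g \<in> SL2C" if "g \<in> SL2C" for g using matrix_group.minv[OF matrix_group_SL2C that] .
  have inv': "act3 (minv g) (act3 g X) = X" "act3 g (act3 (minv g) X) = X" if "g \<in> SL2C" for g X
    using act3_minv[of g X] that by (simp_all add: SL2C_def)
  have step: "act3 (minv g) \<circ> S \<in> O_form \<and> lift_det (act3 (minv g) \<circ> S) > 0"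
    if "g \<in> SL2C" "S \<in> O_form \<and> lift_det S > 0" for g S
  proof
    show "act3 (minv g) \<circ> S \<in> O_form" using O_form_comp[OF O[OF inv[OF that(1)]]] that(2) by blast
    have "lift_det (act3 (minv g) \<circ> S) = lift_det (act3 (minv g)) * lift_det S"
      using that(2) O_formD(2) by (intro lift_det_comp linear_act3) blast
    then show "lift_det (act3 (minv g) \<circ> S) > 0"
      using that inv[OF that(1)] lift_det_act3_pos[of "minv g"] by (simp add: SL2C_def)
  qed
  have fm: "hform (S X) (S Y) = hform X Y" if "S \<in> O_form \<and> lift_det S > 0" for S X Y
    using O_formD(4) that by blast
  have "hform (1, 0) (1, 0 :: real^3) = 1" by (simp add: hform_def)
  then have "hform (T (1, 0)) (T (1, 0)) = 1" "fst (T (1, 0)) > 0"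
    using O_formD(4)[OF T(1)] T(2) by (simp_all add: preserves_sheet_def del: split_paired_All)
  from act3_transitive[OF this] obtain g1 where g1: "g1 \<in> SL2C" "act3 g1 (1, 0) = T (1, 0)"
    unfolding SL2C_def by blast
  define T1 where "T1 = act3 (minv g1) \<circ> T"
  have T1: "T1 \<in> O_form \<and> lift_det T1 > 0" unfolding T1_def using step[OF g1(1)] T by blast
  have T1_0: "T1 (1, 0) = (1, 0)" using inv'(1)[OF g1(1), of "(1, 0)"] g1(2) by (simp add: T1_def)
  have sph: "\<exists>u. S (0, x) = (0, u) \<and> norm u = 1"
    if S: "S \<in> O_form \<and> lift_det S > 0" "S (1, 0) = (1, 0)" and x: "norm x = 1" for S and x :: "real^3"
  proof -
    have "hform (S (0, x)) (1, 0) = 0" using fm[OF S(1), of "(0, x)" "(1, 0)"] S(2) by (simp add: hform_def)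
    then have f: "fst (S (0, x)) = 0" by (simp add: hform_def)
    have "hform (S (0, x)) (S (0, x)) = -1" using fm[OF S(1), of "(0, x)" "(0, x)"] x by (simp add: hform_def norm_eq_1)
    then have "norm (snd (S (0, x))) = 1" using f by (simp add: hform_def norm_eq_1)
    then show ?thesis using f by (intro exI[of _ "snd (S (0, x))"]) (simp add: prod_eq_iff)
  qed
  have n: "norm (vector [0, 0, 1] :: real^3) = 1" "norm (vector [1, 0, 0] :: real^3) = 1"
    by (simp_all add: norm_eq_1 inner_vec_def sum_3 vector_3)
  obtain u where u: "T1 (0, vector [0, 0, 1]) = (0, u)" "norm u = 1" using sph[OF T1 T1_0 n(1)] by blast
  from act3_rotate_axis[OF u(2)] obtain g2 where g2: "g2 \<in> SL2C" "act3 g2 (1, 0) = (1, 0)"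
    "act3 g2 (0, vector [0, 0, 1]) = (0, u)" unfolding SL2C_def by blast
  define T2 where "T2 = act3 (minv g2) \<circ> T1"
  have T2: "T2 \<in> O_form \<and> lift_det T2 > 0" unfolding T2_def using step[OF g2(1) T1] .
  have T2_0: "T2 (1, 0) = (1, 0)" using inv'(1)[OF g2(1), of "(1, 0)"] g2(2) T1_0 by (simp add: T2_def)
  have T2_3: "T2 (0, vector [0, 0, 1]) = (0, vector [0, 0, 1])"
    using inv'(1)[OF g2(1), of "(0, vector [0, 0, 1])"] g2(3) u(1) by (simp add: T2_def)
  obtain x where x: "T2 (0, vector [1, 0, 0]) = (0, x)" "norm x = 1" using sph[OF T2 T2_0 n(2)] by blast
  have "hform (T2 (0, vector [1, 0, 0])) (T2 (0, vector [0, 0, 1])) = 0"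
    unfolding fm[OF T2] by (simp add: hform_def inner_vec_def sum_3 vector_3)
  then have x3: "x $ 3 = 0" unfolding x(1) T2_3 by (simp add: hform_def inner_vec_def sum_3 vector_3)
  have "cmod (Complex (x $ 1) (x $ 2)) = 1"
    using x(2) x3 by (simp add: cmod_def norm_eq_1 inner_vec_def sum_3 power2_eq_square)
  from act3_rotate_about_axis[OF this] obtain g3 where g3: "g3 \<in> SL2C" "act3 g3 (1, 0) = (1, 0)"
    "act3 g3 (0, vector [0, 0, 1]) = (0, vector [0, 0, 1])"
    "act3 g3 (0, vector [1, 0, 0]) = (0, vector [x $ 1, x $ 2, 0])" unfolding SL2C_def by auto
  have xv: "vector [x $ 1, x $ 2, 0] = x" using x3 by (simp add: vec_eq_iff forall_3 vector_3)
  define T3 where "T3 = act3 (minv g3) \<circ> T2"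
  have T3: "T3 \<in> O_form \<and> lift_det T3 > 0" unfolding T3_def using step[OF g3(1) T2] .
  have "T3 (1, 0) = (1, 0)" using inv'(1)[OF g3(1), of "(1, 0)"] g3(2) T2_0 by (simp add: T3_def)
  moreover have "T3 (0, vector [0, 0, 1]) = (0, vector [0, 0, 1])"
    using inv'(1)[OF g3(1), of "(0, vector [0, 0, 1])"] g3(3) T2_3 by (simp add: T3_def)
  moreover have "T3 (0, vector [1, 0, 0]) = (0, vector [1, 0, 0])"
    using inv'(1)[OF g3(1), of "(0, vector [1, 0, 0])"] g3(4) x(1) xv by (simp add: T3_def)
  ultimately have "T3 = id" using form_isometry_fixing_three T3 by blast
  then have "act3 (minv g3) (act3 (minv g2) (act3 (minv g1) (T X))) = X" for X
  proof -
    have "T3 X = X" using \<open>T3 = id\<close> by simp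
    then show ?thesis unfolding T3_def T2_def T1_def comp_apply .
  qed
  then have "T X = act3 g1 (act3 g2 (act3 g3 X))" for X
    using inv'(2) g1(1) g2(1) g3(1) by metis
  then have "T = act3 (mmul g1 (mmul g2 g3))" by (simp add: fun_eq_iff act3_mmul)
  moreover have "mmul g1 (mmul g2 g3) \<in> SL2C" using g1 g2 g3 by (simp add: SL2C_def mdet_mmul)
  ultimately show ?thesis by blast
qed

lemma induced_act3_image: "(\<lambda>g. induced (act3 g)) ` SL2C = carrier (Is_plus TYPE(real^3))"
proof
  have O: "act3 g \<in> O_form" if "g \<in> SL2C" for g using act3_O_form[of g] that by (simp add: SL2C_def)
  show "(\<lambda>g. induced (act3 g)) ` SL2C \<subseteq> carrier (Is_plus TYPE(real^3))"
  proof
    fix f assume "f \<in> (\<lambda>g. induced (act3 g)) ` SL2C"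
    then obtain g where g: "g \<in> SL2C" "f = induced (act3 g)" by blast
    have "preserves_sheet (act3 g)" unfolding preserves_sheet_def
      using act3_sheet[of g] g(1) by (auto simp: SL2C_def)
    then have "orientation_preserving f" unfolding orientation_preserving_def
      using lifts_induced[OF O[OF g(1)]] lift_det_act3_pos[of g] g by (auto simp: SL2C_def)
    moreover have "f \<in> hyp_isometries TYPE(real^3)"
      unfolding g(2) using O_formD[OF O[OF g(1)]] by (intro induced_in_isometries) auto
    ultimately show "f \<in> carrier (Is_plus TYPE(real^3))" by (simp add: Is_plus_def)
  qed
  show "carrier (Is_plus TYPE(real^3)) \<subseteq> (\<lambda>g. induced (act3 g)) ` SL2C"
  proof
    fix f assume f: "f \<in> carrier (Is_plus TYPE(real^3))"
    then obtain T where T: "lifts T f" "preserves_sheet T" "lift_det T > 0"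
      by (auto simp: Is_plus_def orientation_preserving_def)
    then have "T \<in> O_form" by (simp add: lifts_def)
    then obtain g where g: "g \<in> SL2C" "T = act3 g" using SL2C_surjective T(2,3) by blast
    have "f \<in> extensional (hyp_space TYPE(real^3))"
      using f by (simp add: Is_plus_def hyp_isometries_def Bij_def)
    then have "f = induced T"
      unfolding induced_def using T(1) by (intro extensionalityI[of _ "hyp_space TYPE(real^3)"]) (auto simp: lifts_def)
    then show "f \<in> (\<lambda>g. induced (act3 g)) ` SL2C" using g by blast
  qed
qed

text \<open>The plane consists of the vectors whose Hermitian matrix is real. Its first coordinate
  becomes the third axis, the one that \<open>act3_rotate_axis\<close> moves.\<close>

definition plane_in :: "real \<times> (real^2) \<Rightarrow> real \<times> (real^3)" where
  "plane_in X = (fst X, vector [snd X $ 2, 0, snd X $ 1])"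

definition plane_out :: "real \<times> (real^3) \<Rightarrow> real \<times> (real^2)" where
  "plane_out X = (fst X, vector [snd X $ 3, snd X $ 1])"

definition act2 :: "mat2 \<Rightarrow> real \<times> (real^2) \<Rightarrow> real \<times> (real^2)" where
  "act2 g X = plane_out (act3 g (plane_in X))"

fun mreal :: "mat2 \<Rightarrow> bool" where
  "mreal (a, b, c, d) \<longleftrightarrow> Im a = 0 \<and> Im b = 0 \<and> Im c = 0 \<and> Im d = 0"

lemma plane_out_in [simp]: "plane_out (plane_in X) = X"
  by (simp add: plane_out_def plane_in_def prod_eq_iff vec_eq_iff forall_2 vector_2 vector_3)

lemma plane_in_out: "snd Y $ 2 = 0 \<Longrightarrow> plane_in (plane_out Y) = Y"
  by (simp add: plane_out_def plane_in_def prod_eq_iff vec_eq_iff forall_3 vector_2 vector_3)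

lemma linear_plane_in: "linear plane_in"
  by (rule linearI) (simp_all add: plane_in_def vec_eq_iff forall_3 vector_3)

lemma linear_plane_out: "linear plane_out"
  by (rule linearI) (simp_all add: plane_out_def vec_eq_iff forall_2 vector_2)

lemma hform_plane_in: "hform (plane_in X) (plane_in Y) = hform X Y"
  by (simp add: hform_def plane_in_def inner_vec_def sum_2 sum_3 vector_3)

lemma mreal_mmul: "mreal g \<Longrightarrow> mreal h \<Longrightarrow> mreal (mmul g h)"
  by (cases g; cases h) simp

lemma mreal_mstar: "mreal g \<Longrightarrow> mreal (mstar g)"
  by (cases g) simp

lemma mreal_minv: "mreal g \<Longrightarrow> mreal (minv g)"
  by (cases g) (simp add: Let_def)

lemma mreal_herm: "snd X $ 2 = 0 \<Longrightarrow> mreal (herm X)"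
  by (simp add: herm_def)

lemma act3_real: "mreal g \<Longrightarrow> snd X $ 2 = 0 \<Longrightarrow> snd (act3 g X) $ 2 = 0"
proof -
  assume "mreal g" "snd X $ 2 = 0"
  then have "mreal (mmul (mmul g (herm X)) (mstar g))"
    by (intro mreal_mmul mreal_mstar mreal_herm)
  then have "mreal (herm (act3 g X))" by (simp add: herm_act3)
  then show ?thesis by (simp add: herm_def)
qed

lemma plane_in_act2: "mreal g \<Longrightarrow> plane_in (act2 g X) = act3 g (plane_in X)"
  unfolding act2_def by (rule plane_in_out) (simp add: act3_real plane_in_def vector_3)

lemma linear_act2: "linear (act2 g)"
  using linear_compose[OF linear_compose[OF linear_plane_in linear_act3] linear_plane_out]
  by (simp add: act2_def[abs_def] comp_def)

text \<open>Modulo sign this is PGL(2, R), because an invertible real matrix can be scaled to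
  determinant 1 or -1. Determinant -1 accounts for the orientation-reversing isometries of the
  plane.\<close>

definition GL2R :: "mat2 set" where
  "GL2R = {g. mreal g \<and> (mdet g = 1 \<or> mdet g = -1)}"

lemma matrix_group_GL2R: "matrix_group GL2R"
proof
  show "mmul g h \<in> GL2R" if "g \<in> GL2R" "h \<in> GL2R" for g h
    using that by (auto simp: GL2R_def mdet_mmul mreal_mmul)
  show "minv g \<in> GL2R" if "g \<in> GL2R" for g
    using that mdet_minv[of g] by (auto simp: GL2R_def mreal_minv)
  show "mdet g = 1 \<or> mdet g = -1" if "g \<in> GL2R" for g using that by (simp add: GL2R_def)
  show "(complex_of_real t, 0, 0, complex_of_real (inverse t)) \<in> GL2R" if "t \<noteq> 0" for t
    using that by (simp add: GL2R_def flip: of_real_mult)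
qed (simp_all add: GL2R_def mone_def upper_def lower_def)

lemma act2_mmul: "h \<in> GL2R \<Longrightarrow> act2 (mmul g h) X = act2 g (act2 h X)"
  by (subst (2) act2_def) (simp add: plane_in_act2 GL2R_def, simp add: act2_def act3_mmul)

lemma hform_act2: "g \<in> GL2R \<Longrightarrow> hform (act2 g X) (act2 g Y) = hform X Y"
  by (subst hform_plane_in[symmetric]) (simp add: plane_in_act2 GL2R_def hform_act3 hform_plane_in)

lemma act2_minv:
  assumes "g \<in> GL2R"
  shows "act2 (minv g) (act2 g X) = X" "act2 g (act2 (minv g) X) = X"
proof -
  have "act2 mone X = X" by (simp add: act2_def)
  then show "act2 (minv g) (act2 g X) = X" "act2 g (act2 (minv g) X) = X"
    using assms mmul_minv[of g] matrix_group.minv[OF matrix_group_GL2R assms]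
    by (simp_all add: GL2R_def flip: act2_mmul)
qed

lemma bij_act2: "g \<in> GL2R \<Longrightarrow> bij (act2 g)"
  by (rule o_bij[of "act2 (minv g)"]) (auto simp: fun_eq_iff act2_minv simp del: split_paired_All)

lemma act2_induced_inj:
  assumes g: "g \<in> GL2R" and h: "h \<in> GL2R" and eq: "induced (act2 g) = induced (act2 h)"
  shows "h = g \<or> h = mneg g"
proof -
  have d: "mdet g = 1 \<or> mdet g = -1" and d': "mdet h = 1 \<or> mdet h = -1" using g h by (simp_all add: GL2R_def)
  let ?k = "mmul (minv g) h"
  have k: "?k \<in> GL2R" using matrix_group.mmul[OF matrix_group_GL2R matrix_group.minv[OF matrix_group_GL2R g] h] .
  have line: "\<exists>r. act3 ?k (plane_in X) = r *\<^sub>R plane_in X" if X: "hform X X > 0" for X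
  proof -
    have "span {X} \<in> hyp_space TYPE(real^2)" using X unfolding hyp_space_def by blast
    then have "act2 g ` span {X} = act2 h ` span {X}" using fun_cong[OF eq, of "span {X}"] by (simp add: induced_def)
    then obtain r where "act2 g (r *\<^sub>R X) = act2 h X"
      using fixes_line_eq[OF linear_act2 _ linear_act2] by blast
    then have "act2 ?k X = r *\<^sub>R X" using act2_minv(1)[OF g, of "r *\<^sub>R X"] h by (simp add: act2_mmul)
    then have "act3 ?k (plane_in X) = r *\<^sub>R plane_in X"
      using plane_in_act2[of ?k X] k by (simp add: GL2R_def linear_cmul[OF linear_plane_in])
    then show ?thesis ..
  qed
  have p: "hform (1, 0) (1, 0 :: real^2) > 0"
    "hform (3 / 2, vector [1 / 2, 0]) (3 / 2, vector [1 / 2, 0] :: real^2) > 0"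
    "hform (2, vector [0, 1]) (2, vector [0, 1] :: real^2) > 0"
    by (simp_all add: hform_def inner_vec_def sum_2 vector_2)
  have J: "plane_in (1, 0) = (1, 0)" "plane_in (3 / 2, vector [1 / 2, 0]) = (3 / 2, vector [0, 0, 1 / 2])"
    "plane_in (2, vector [0, 1]) = (2, vector [1, 0, 0])"
    by (simp_all add: plane_in_def vec_eq_iff forall_3 vector_3 vector_2)
  have dk: "mdet ?k = 1 \<or> mdet ?k = -1" "mreal ?k" using k by (simp_all add: GL2R_def)
  obtain a where a: "?k = (a, 0, 0, a)"
    using act3_scalar_matrix[OF dk(1)] line[OF p(1)] line[OF p(2)] line[OF p(3)] unfolding J by blast
  then have im: "Im a = 0" using dk by simp
  then have "a = of_real (Re a)" by (simp add: complex_eq_iff)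
  moreover have "a * a = 1 \<or> a * a = -1" using dk a by simp
  \<comment> \<open>A scalar matrix of determinant -1 would not be real.\<close>
  moreover have "a * a \<noteq> -1"
  proof
    assume "a * a = -1"
    then have "Re a * Re a = -1" using im by (simp add: complex_eq_iff)
    then show False using zero_le_square[of "Re a"] by simp
  qed
  ultimately have "a = 1 \<or> a = -1" by (simp add: square_eq_1_iff)
  then show ?thesis using mmul_scalar_minv[OF d _ a] by blast
qed

section \<open>Isometries of the plane in the hyperboloid model\<close>

definition sheet :: "(real \<times> 'a::real_inner) set" where
  "sheet = {X. hform X X = 1 \<and> fst X > 0}"

lemma hform_sheet_ge_1:
  assumes "X \<in> sheet" "Y \<in> sheet"
  shows "hform X Y \<ge> 1"
proof -
  have X: "fst X > 0" "hform X X = 1" and Y: "fst Y > 0" "hform Y Y = 1" using assms by (auto simp: sheet_def)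
  have "(norm (snd X))\<^sup>2 < (fst X)\<^sup>2" "(norm (snd Y))\<^sup>2 < (fst Y)\<^sup>2"
    using X Y by (simp_all add: hform_def dot_square_norm power2_eq_square)
  then have "norm (snd X) < fst X" "norm (snd Y) < fst Y"
    using X Y by (auto intro: power2_less_imp_less)
  then have "norm (snd X) * norm (snd Y) < fst X * fst Y" using X Y by (intro mult_strict_mono) auto
  moreover have "snd X \<bullet> snd Y \<le> norm (snd X) * norm (snd Y)" by (rule norm_cauchy_schwarz)
  ultimately have "hform X Y > 0" by (simp add: hform_def)
  moreover have "sqrt (hform X X * hform Y Y) \<le> \<bar>hform X Y\<bar>"
    by (rule hform_reverse_Cauchy_Schwarz) (use X Y in auto)
  ultimately show ?thesis using X Y by simp
qed

lemma hyp_space_sheet: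
  fixes x :: "(real \<times> 'h::real_inner) set"
  assumes "x \<in> hyp_space TYPE('h)"
  shows "\<exists>X\<in>sheet. x = span {X}"
proof -
  obtain Y where Y: "x = span {Y}" "hform Y Y > 0" using assms by (auto simp: hyp_space_def)
  have f0: "fst Y \<noteq> 0"
  proof
    assume "fst Y = 0"
    then have "hform Y Y \<le> 0" by (simp add: hform_def)
    then show False using Y by simp
  qed
  define r where "r = sgn (fst Y) / sqrt (hform Y Y)"
  have r0: "r \<noteq> 0" using f0 Y(2) by (simp add: r_def sgn_if)
  have "r * r = 1 / hform Y Y" using f0 Y(2) by (simp add: r_def sgn_if)
  then have "hform (r *\<^sub>R Y) (r *\<^sub>R Y) = 1" using Y(2) by (simp add: hform_scaleR)
  moreover have "fst (r *\<^sub>R Y) > 0" using f0 Y(2) by (auto simp: r_def sgn_if)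
  moreover have "span {r *\<^sub>R Y} = span {Y}"
  proof
    show "span {r *\<^sub>R Y} \<subseteq> span {Y}" by (intro span_minimal) (auto intro: span_scale span_base)
    have "Y = (1 / r) *\<^sub>R (r *\<^sub>R Y)" using r0 by simp
    then have "Y \<in> span {r *\<^sub>R Y}" by (metis singletonI span_base span_scale)
    then show "span {Y} \<subseteq> span {r *\<^sub>R Y}" by (intro span_minimal) auto
  qed
  ultimately show ?thesis using Y(1) by (intro bexI[of _ "r *\<^sub>R Y"]) (auto simp: sheet_def)
qed

text \<open>Between points of the sheet the form is at least 1, so the absolute value in the
  distance disappears and \<open>arcosh\<close> can be inverted. Preservation of distances becomes
  preservation of the form, before any linearity is known.\<close>

lemma isometry_on_sheet:
  fixes f :: "(real \<times> 'h::real_inner) set \<Rightarrow> (real \<times> 'h) set"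
  assumes f: "f \<in> hyp_isometries TYPE('h)"
  shows "\<exists>F. (\<forall>X\<in>sheet. F X \<in> sheet \<and> f (span {X}) = span {F X}) \<and>
    (\<forall>X\<in>sheet. \<forall>Y\<in>sheet. hform (F X) (F Y) = hform X Y)"
proof -
  have sp: "span {X} \<in> hyp_space TYPE('h)" if "X \<in> sheet" for X :: "real \<times> 'h"
  proof -
    have "hform X X > 0" using that by (simp add: sheet_def)
    then show ?thesis unfolding hyp_space_def by blast
  qed
  have "\<forall>X. \<exists>Y. X \<in> sheet \<longrightarrow> Y \<in> sheet \<and> f (span {X}) = span {Y}"
  proof
    fix X :: "real \<times> 'h"
    have "f (span {X}) \<in> hyp_space TYPE('h)" if "X \<in> sheet"
      using f sp[OF that] by (auto simp: hyp_isometries_def dest: Bij_imp_funcset)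
    then show "\<exists>Y. X \<in> sheet \<longrightarrow> Y \<in> sheet \<and> f (span {X}) = span {Y}" using hyp_space_sheet by blast
  qed
  from choice[OF this] obtain F where F: "\<forall>X. X \<in> sheet \<longrightarrow> F X \<in> sheet \<and> f (span {X}) = span {F X}" ..
  have d: "hdist (span {X}) (span {Y}) = arcosh (hform X Y)" if "X \<in> sheet" "Y \<in> sheet" for X Y :: "real \<times> 'h"
    using hdist_span[of X Y] hform_sheet_ge_1[OF that] that by (simp add: sheet_def)
  have "hform (F X) (F Y) = hform X Y" if X: "X \<in> sheet" and Y: "Y \<in> sheet" for X Y
  proof -
    have "hdist (f (span {X})) (f (span {Y})) = hdist (span {X}) (span {Y})"
      using f sp[OF X] sp[OF Y] by (simp add: hyp_isometries_def)
    moreover have FX: "F X \<in> sheet" "F Y \<in> sheet" using F X Y by blast+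
    ultimately have "arcosh (hform (F X) (F Y)) = arcosh (hform X Y)" using F X Y d by metis
    then show ?thesis
      using cosh_arcosh_real[OF hform_sheet_ge_1[OF FX]] cosh_arcosh_real[OF hform_sheet_ge_1[OF X Y]] by metis
  qed
  then show ?thesis using F by blast
qed

text \<open>\<open>F\<close> is not known to be linear. Three corrections make it fix
  \<open>P0\<close>, \<open>P1\<close> and \<open>P2\<close>, which form a basis, and a vector is
  determined by its form values with a basis. The last correction \<open>g3\<close> may be a
  reflection, which is where determinant -1 enters.\<close>

lemma GL2R_surjective:
  fixes F :: "real \<times> (real^2) \<Rightarrow> real \<times> (real^2)"
  assumes F: "\<And>X. X \<in> sheet \<Longrightarrow> F X \<in> sheet"
    and fm: "\<And>X Y. X \<in> sheet \<Longrightarrow> Y \<in> sheet \<Longrightarrow> hform (F X) (F Y) = hform X Y"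
  shows "\<exists>g\<in>GL2R. \<forall>X\<in>sheet. F X = act2 g X"
proof -
  have inv: "minv g \<in> GL2R" if "g \<in> GL2R" for g using matrix_group.minv[OF matrix_group_GL2R that] .
  define P0 P1 P2 where "P0 = (1 :: real, 0 :: real^2)" and "P1 = (sqrt 2, vector [1, 0] :: real^2)"
    and "P2 = (sqrt 2, vector [0, 1] :: real^2)"
  have P: "P0 \<in> sheet" "P1 \<in> sheet" "P2 \<in> sheet"
    by (simp_all add: sheet_def P0_def P1_def P2_def hform_def inner_vec_def sum_2 vector_2)
  have hP: "hform X P0 = fst X" "hform X P1 = fst X * sqrt 2 - snd X $ 1" "hform X P2 = fst X * sqrt 2 - snd X $ 2" for X
    by (simp_all add: P0_def P1_def P2_def hform_def inner_vec_def sum_2 vector_2)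
  have "hform (plane_in (F P0)) (plane_in (F P0)) = 1" "fst (plane_in (F P0)) > 0"
    using F[OF P(1)] by (simp_all add: hform_plane_in sheet_def) (simp add: plane_in_def)
  from act3_transitive[OF this] obtain a b c d where g1d: "mdet (a, b, c, d) = 1"
    "act3 (a, b, c, d) (1, 0) = plane_in (F P0)"
    "snd (plane_in (F P0)) $ 2 = 0 \<longrightarrow> Im a = 0 \<and> Im b = 0 \<and> Im c = 0 \<and> Im d = 0" by blast
  define g1 where "g1 = (a, b, c, d)"
  have g1: "g1 \<in> GL2R" "act3 g1 (1, 0) = plane_in (F P0)"
    using g1d by (simp_all add: g1_def GL2R_def plane_in_def vector_3)
  have J0: "plane_in P0 = (1, 0)" by (simp add: plane_in_def P0_def vec_eq_iff forall_3 vector_3)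
  have g1P0: "act2 g1 P0 = F P0" by (simp add: act2_def J0 g1(2))
  define F1 where "F1 X = act2 (minv g1) (F X)" for X
  have F1: "hform (F1 X) (F1 Y) = hform X Y" if "X \<in> sheet" "Y \<in> sheet" for X Y
    using fm[OF that] hform_act2[OF inv[OF g1(1)]] by (simp add: F1_def)
  have F1o: "F1 P0 = P0" using act2_minv(1)[OF g1(1), of P0] by (simp add: F1_def g1P0)
  have fst1: "fst (F1 X) = fst X" if "X \<in> sheet" for X using F1[OF that P(1)] F1o hP(1) by simp
  define u where "u = snd (F1 P1)"
  have uP: "F1 P1 = (sqrt 2, u)" using fst1[OF P(2)] by (simp add: prod_eq_iff u_def P1_def)
  have "hform (F1 P1) (F1 P1) = 1" using F1[OF P(2,2)] P(2) by (simp add: sheet_def)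
  then have uu: "u $ 1 * u $ 1 + u $ 2 * u $ 2 = 1" unfolding uP by (simp add: hform_def inner_vec_def sum_2)
  have "norm (vector [u $ 2, 0, u $ 1] :: real^3) = 1"
    using uu by (simp add: norm_eq_1 inner_vec_def sum_3 vector_3)
  from act3_rotate_axis[OF this] obtain a' b' c' d' where g2d: "mdet (a', b', c', d') = 1"
    "act3 (a', b', c', d') (1, 0) = (1, 0)"
    "act3 (a', b', c', d') (0, vector [0, 0, 1]) = (0, vector [u $ 2, 0, u $ 1])"
    "(vector [u $ 2, 0, u $ 1] :: real^3) $ 2 = 0 \<longrightarrow> Im a' = 0 \<and> Im b' = 0 \<and> Im c' = 0 \<and> Im d' = 0" by blast
  define g2 where "g2 = (a', b', c', d')"
  have g2: "g2 \<in> GL2R" "act3 g2 (1, 0) = (1, 0)"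
    "act3 g2 (0, vector [0, 0, 1]) = (0, vector [u $ 2, 0, u $ 1])"
    using g2d by (simp_all add: g2_def GL2R_def vector_3)
  have g2o: "act2 g2 P0 = P0" by (simp add: act2_def J0 g2(2)) (simp flip: J0)
  have g2P: "act2 g2 P1 = (sqrt 2, u)"
  proof -
    have "P1 = sqrt 2 *\<^sub>R P0 + (0, vector [1, 0])" by (simp add: P1_def P0_def)
    then have "act2 g2 P1 = sqrt 2 *\<^sub>R P0 + act2 g2 (0, vector [1, 0])"
      by (simp add: linear_add[OF linear_act2] linear_cmul[OF linear_act2] g2o)
    also have "act2 g2 (0, vector [1, 0]) = (0, u)"
    proof -
      have "plane_in (0, vector [1, 0]) = (0, vector [0, 0, 1])"
        by (simp add: plane_in_def vec_eq_iff forall_3 vector_3 vector_2)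
      then show ?thesis using g2(3) by (simp add: act2_def plane_out_def vec_eq_iff forall_2 vector_2 vector_3)
    qed
    finally show ?thesis by (simp add: P0_def)
  qed
  define F2 where "F2 X = act2 (minv g2) (F1 X)" for X
  have F2: "hform (F2 X) (F2 Y) = hform X Y" if "X \<in> sheet" "Y \<in> sheet" for X Y
    using F1[OF that] hform_act2[OF inv[OF g2(1)]] by (simp add: F2_def)
  have F2o: "F2 P0 = P0" using act2_minv(1)[OF g2(1), of P0] by (simp add: F2_def F1o g2o)
  have F2P: "F2 P1 = P1" using act2_minv(1)[OF g2(1), of P1] by (simp add: F2_def uP g2P)
  define x where "x = snd (F2 P2)"
  have f2: "fst (F2 P2) = sqrt 2" using F2[OF P(3,1)] F2o hP(1) by (simp add: P2_def)
  have "hform (F2 P2) P1 = hform P2 P1" using F2[OF P(3,2)] F2P by simp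
  then have x1: "x $ 1 = 0" unfolding hP by (simp add: f2 x_def[symmetric]) (simp add: P2_def vector_2)
  have "hform (F2 P2) (F2 P2) = 1" using F2[OF P(3,3)] P(3) by (simp add: sheet_def)
  then have "x $ 2 * x $ 2 = 1" using x1 f2 by (simp add: hform_def inner_vec_def sum_2 x_def)
  then have x2: "x $ 2 = 1 \<or> x $ 2 = -1" by (simp add: square_eq_1_iff)
  define g3 :: mat2 where "g3 = (1, 0, 0, of_real (x $ 2))"
  have g3: "g3 \<in> GL2R" using x2 by (auto simp: g3_def GL2R_def)
  have g3act: "act2 g3 X = (fst X, vector [snd X $ 1, x $ 2 * snd X $ 2])" for X
    using x2 by (auto simp: act2_def act3_def g3_def herm_def plane_in_def plane_out_def vector_2 vector_3
        vec_eq_iff forall_2)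
  define F3 where "F3 X = act2 (minv g3) (F2 X)" for X
  have F3: "hform (F3 X) (F3 Y) = hform X Y" if "X \<in> sheet" "Y \<in> sheet" for X Y
    using F2[OF that] hform_act2[OF inv[OF g3]] by (simp add: F3_def)
  have "F2 P2 = (sqrt 2, x)" using f2 by (simp add: prod_eq_iff x_def)
  moreover have "act2 g3 P2 = (sqrt 2, x)"
    using x1 by (simp add: g3act P2_def vec_eq_iff forall_2 vector_2)
  moreover have "act2 g3 P0 = P0" "act2 g3 P1 = P1"
    by (simp_all add: g3act P0_def P1_def vec_eq_iff forall_2 vector_2)
  ultimately have fix3: "F3 P0 = P0" "F3 P1 = P1" "F3 P2 = P2"
    using act2_minv(1)[OF g3] F2o F2P by (metis F3_def)+
  have F3X: "F3 X = X" if X: "X \<in> sheet" for X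
  proof -
    have "hform (F3 X) P0 = hform X P0" "hform (F3 X) P1 = hform X P1" "hform (F3 X) P2 = hform X P2"
      using F3[OF X P(1)] F3[OF X P(2)] F3[OF X P(3)] fix3 by simp_all
    then show ?thesis unfolding hP by (simp add: prod_eq_iff vec_eq_iff forall_2)
  qed
  define g where "g = mmul g1 (mmul g2 g3)"
  have g23: "mmul g2 g3 \<in> GL2R" using matrix_group.mmul[OF matrix_group_GL2R g2(1) g3] .
  then have gG: "g \<in> GL2R" unfolding g_def using matrix_group.mmul[OF matrix_group_GL2R g1(1)] by blast
  have "F X = act2 g X" if X: "X \<in> sheet" for X
  proof -
    have "act2 g X = act2 g1 (act2 g2 (act2 g3 (F3 X)))"
      using F3X[OF X] g3 g23 by (simp add: g_def act2_mmul)
    also have "\<dots> = F X"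
      unfolding F3_def act2_minv(2)[OF g3] F2_def act2_minv(2)[OF g2(1)] F1_def act2_minv(2)[OF g1(1)] ..
    finally show ?thesis ..
  qed
  then show ?thesis using gG by blast
qed

lemma induced_act2_image: "(\<lambda>g. induced (act2 g)) ` GL2R = carrier (Is TYPE(real^2))"
proof
  show "(\<lambda>g. induced (act2 g)) ` GL2R \<subseteq> carrier (Is TYPE(real^2))"
    using induced_in_isometries[OF linear_act2 bij_act2 hform_act2] by (auto simp: Is_def)
  show "carrier (Is TYPE(real^2)) \<subseteq> (\<lambda>g. induced (act2 g)) ` GL2R"
  proof
    fix f assume "f \<in> carrier (Is TYPE(real^2))"
    then have f: "f \<in> hyp_isometries TYPE(real^2)" by (simp add: Is_def)
    obtain F where F: "\<forall>X\<in>sheet. F X \<in> sheet \<and> f (span {X}) = span {F X}"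
      "\<forall>X\<in>sheet. \<forall>Y\<in>sheet. hform (F X) (F Y) = hform X Y" using isometry_on_sheet[OF f] by blast
    then obtain g where g: "g \<in> GL2R" "\<forall>X\<in>sheet. F X = act2 g X" using GL2R_surjective[of F] by blast
    have "f = induced (act2 g)"
      unfolding induced_def
    proof (rule extensionalityI[of _ "hyp_space TYPE(real^2)"])
      show "f \<in> extensional (hyp_space TYPE(real^2))" using f by (simp add: hyp_isometries_def Bij_def)
      fix x :: "(real \<times> (real^2)) set" assume x: "x \<in> hyp_space TYPE(real^2)"
      then obtain X where X: "X \<in> sheet" "x = span {X}" using hyp_space_sheet by blast
      have "f x = span {act2 g X}" using F(1) g(2) X by simp
      also have "\<dots> = act2 g ` x" using linear_span_image[OF linear_act2, of g "{X}"] X(2) by simp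
      finally show "f x = restrict ((`) (act2 g)) (hyp_space TYPE(real^2)) x" using x by simp
    qed simp
    then show "f \<in> (\<lambda>g. induced (act2 g)) ` GL2R" using g(1) by blast
  qed
qed

theorem theorem1p6:
  assumes "\<exists>S :: 'h::{real_inner, banach} set. hilbert_basis S \<and> countable S \<and> infinite S"
  shows "(\<exists>\<rho> \<in> hom (Is TYPE(real^2)) (Is TYPE('h)).
            irreducible_rep (Is TYPE(real^2)) \<rho> \<and>
            (\<exists>p \<in> hyp_space TYPE('h). countable {\<rho> g p | g. g \<in> carrier (Is TYPE(real^2))}))
       \<and> (\<exists>\<rho> \<in> hom (Is_plus TYPE(real^3)) (Is TYPE('h)).
            irreducible_rep (Is_plus TYPE(real^3)) \<rho> \<and>
            (\<exists>p \<in> hyp_space TYPE('h). countable {\<rho> g p | g. g \<in> carrier (Is_plus TYPE(real^3))}))"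
proof
  obtain v D where "valued_complex v D" using valued_complex_exists by blast
  then interpret valued_complex v D .
  show "\<exists>\<rho> \<in> hom (Is TYPE(real^2)) (Is TYPE('h)). irreducible_rep (Is TYPE(real^2)) \<rho> \<and>
      (\<exists>p \<in> hyp_space TYPE('h). countable {\<rho> g p | g. g \<in> carrier (Is TYPE(real^2))})"
  proof (rule transfer_representation[OF matrix_group_GL2R _ induced_act2_image _ act2_induced_inj assms])
    show "mneg g \<in> GL2R" if "g \<in> GL2R" for g using that by (cases g) (simp add: GL2R_def)
    show "induced (act2 (mmul g h)) = induced (act2 g) \<otimes>\<^bsub>Is TYPE(real^2)\<^esub> induced (act2 h)"
      if g: "g \<in> GL2R" and h: "h \<in> GL2R" for g h
    proof -
      have "act2 (mmul g h) = act2 g \<circ> act2 h" using h by (simp add: fun_eq_iff act2_mmul del: split_paired_All)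
      then show ?thesis
        using induced_comp[OF linear_act2 bij_act2[OF g] hform_act2[OF g] linear_act2 bij_act2[OF h] hform_act2[OF h]]
        by simp
    qed
  qed
  show "\<exists>\<rho> \<in> hom (Is_plus TYPE(real^3)) (Is TYPE('h)). irreducible_rep (Is_plus TYPE(real^3)) \<rho> \<and>
      (\<exists>p \<in> hyp_space TYPE('h). countable {\<rho> g p | g. g \<in> carrier (Is_plus TYPE(real^3))})"
  proof (rule transfer_representation[OF matrix_group_SL2C _ induced_act3_image _ act3_induced_inj assms])
    show "mneg g \<in> SL2C" if "g \<in> SL2C" for g using that by (cases g) (simp add: SL2C_def)
    show "induced (act3 (mmul g h)) = induced (act3 g) \<otimes>\<^bsub>Is_plus TYPE(real^3)\<^esub> induced (act3 h)"
      if g: "g \<in> SL2C" and h: "h \<in> SL2C" for g h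
    proof -
      have O: "act3 k \<in> O_form" if "k \<in> SL2C" for k using act3_O_form[of k] that by (simp add: SL2C_def)
      have "act3 (mmul g h) = act3 g \<circ> act3 h" by (simp add: fun_eq_iff act3_mmul del: split_paired_All)
      moreover have "induced (act3 g \<circ> act3 h) = induced (act3 g) \<otimes>\<^bsub>Is TYPE(real^3)\<^esub> induced (act3 h)"
        by (intro induced_comp) (use O_formD[OF O[OF g]] O_formD[OF O[OF h]] in auto)
      ultimately show ?thesis by (simp add: Is_plus_def)
    qed
  qed
qed

end
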